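(* Let $m$ be a positive integer with $m \not\equiv 1 \pmod{4}$, and let $$\phi(z) = \frac{z^2 + a}{z^2} \in \mathbb{Q}(z) \quad \text{with } a = -2(2m^2-1)^2.$$ Then $[K_n(0) : K_{n-1}(0)] = 2^{2^{n-1}}$ for all $n \geq 1$, implying that $G_\infty(0) \cong \mathrm{Aut}(T^2_\infty)$.
   Context: The ground field is $\mathbb{Q}$. For $n\ge 0$, $\phi^n$ is the $n$-th iterate ($\phi^0$ is the identity), $\phi^{-n}(0)=\{\beta\in\overline{\mathbb{Q}}:\phi^n(\beta)=0\}$, $K_n(0)=\mathbb{Q}(\phi^{-n}(0))$ (so $K_0(0)=\mathbb{Q}$), $K_\infty(0)=\bigcup_{n\ge1}K_n(0)$, and $G_\infty(0)=\mathrm{Gal}(K_\infty(0)/\mathbb{Q})$. $T^2_\infty=\bigsqcup_{n\ge0}\phi^{-n}(0)$ is the complete infinite binary rooted tree with root $0$, with edges given by the action of $\phi$; $G_\infty(0)$ embeds naturally in $\mathrm{Aut}(T^2_\infty)$ by its action on the vertices. *)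

theory Defs
  imports "HOL-Algebra.Algebra" "HOL-Algebra.Algebraic_Closure_Type" "HOL-Number_Theory.Cong"
begin

type_synonym qbar = "rat alg_closure"

abbreviation Qbar :: "qbar ring" where
  "Qbar \<equiv> ring_of_type_algebra"

(* The self-map of the projective line over qbar induced by the rational function p/q, for
   coprime p and q.  The point at infinity is None, and a finite point z is Some z. *)
definition ratmap :: "rat poly \<Rightarrow> rat poly \<Rightarrow> qbar option \<Rightarrow> qbar option" where
  "ratmap p q x =
     (let ev = (\<lambda>f z. poly (map_poly of_rat f) z);
          d = max (degree p) (degree q)
      in case x of
           Some z \<Rightarrow> if ev q z = 0 then None else Some (ev p z / ev q z)
         | None \<Rightarrow> if coeff q d = 0 then None else Some (of_rat (coeff p d / coeff q d)))"

definition preimages :: "(qbar option \<Rightarrow> qbar option) \<Rightarrow> nat \<Rightarrow> qbar set" where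
  "preimages \<phi> n = {\<beta>. (\<phi> ^^ n) (Some \<beta>) = Some 0}"

definition K_fin :: "(qbar option \<Rightarrow> qbar option) \<Rightarrow> nat \<Rightarrow> qbar set" where
  "K_fin \<phi> n = generate_field Qbar (\<rat> \<union> preimages \<phi> n)"

definition K_inf :: "(qbar option \<Rightarrow> qbar option) \<Rightarrow> qbar set" where
  "K_inf \<phi> = (\<Union>n\<in>{1..}. K_fin \<phi> n)"

(* Automorphisms are elements of Bij L, hence extensional: undefined outside L. *)
definition Gal :: "qbar set \<Rightarrow> qbar set \<Rightarrow> (qbar \<Rightarrow> qbar) monoid" where
  "Gal L F = BijGroup L
     \<lparr>carrier := {\<sigma> \<in> Bij L. \<sigma> \<in> ring_iso (Qbar\<lparr>carrier := L\<rparr>) (Qbar\<lparr>carrier := L\<rparr>) \<and>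
                            (\<forall>x\<in>F. \<sigma> x = x)}\<rparr>"

definition G_inf :: "(qbar option \<Rightarrow> qbar option) \<Rightarrow> (qbar \<Rightarrow> qbar) monoid" where
  "G_inf \<phi> = Gal (K_inf \<phi>) \<rat>"

(* The disjoint union of the sets of preimages is realised by tagging each one with its level. *)
definition tree_verts :: "(qbar option \<Rightarrow> qbar option) \<Rightarrow> (nat \<times> qbar) set" where
  "tree_verts \<phi> = (SIGMA n:UNIV. preimages \<phi> n)"

(* Edges point from a child to its parent. *)
definition tree_edges :: "(qbar option \<Rightarrow> qbar option) \<Rightarrow> ((nat \<times> qbar) \<times> (nat \<times> qbar)) set" where
  "tree_edges \<phi> = {((Suc n, \<beta>), (n, \<gamma>)) | n \<beta> \<gamma>.
     \<beta> \<in> preimages \<phi> (Suc n) \<and> \<gamma> \<in> preimages \<phi> n \<and> \<phi> (Some \<beta>) = Some \<gamma>}"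

definition rooted_aut :: "'v set \<Rightarrow> ('v \<times> 'v) set \<Rightarrow> 'v \<Rightarrow> ('v \<Rightarrow> 'v) monoid" where
  "rooted_aut V E r = BijGroup V
     \<lparr>carrier := {f \<in> Bij V. f r = r \<and> (\<forall>u\<in>V. \<forall>v\<in>V. (f u, f v) \<in> E \<longleftrightarrow> (u, v) \<in> E)}\<rparr>"

definition Aut_tree :: "(qbar option \<Rightarrow> qbar option) \<Rightarrow> (nat \<times> qbar \<Rightarrow> nat \<times> qbar) monoid" where
  "Aut_tree \<phi> = rooted_aut (tree_verts \<phi>) (tree_edges \<phi>) (0, 0)"

definition tree_action ::
    "(qbar option \<Rightarrow> qbar option) \<Rightarrow> (qbar \<Rightarrow> qbar) \<Rightarrow> nat \<times> qbar \<Rightarrow> nat \<times> qbar" where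
  "tree_action \<phi> \<sigma> = (\<lambda>(n, \<beta>)\<in>tree_verts \<phi>. (n, \<sigma> \<beta>))"

end

theory Submission
  imports Defs "HOL-Number_Theory.Number_Theory"
begin

text \<open>
  Put c = 2m^2 - 1, so that \<phi>(z) = 1 - 2c^2/z^2. A point z lies above \<beta> if and only if
  z^2 = 2c^2/(1 - \<beta>). Hence the field of level n + 1 arises from the field of level n by
  adjoining square roots of the 2^n numbers 2c^2/(1 - \<beta>), where \<beta> runs through the
  vertices of level n. Both assertions follow once these numbers are independent modulo squares in
  the field of level n (theorem Kummer_independent): the degree is then 2^(2^n), and as the images
  of independent square roots can be prescribed freely, every automorphism of the tree lifts,
  level by level, to an automorphism of the fields.

  Independence is proved by induction on n. The sets of vertices of level n for which the product
  of the square roots lies in the field of level n are closed under symmetric difference and under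
  the Galois group of that field, which by induction is the full automorphism group of the tree up
  to level n. Swapping two siblings and taking differences pushes a nonzero relation down towards
  the root, until it is the relation given by the full level (lemma full_relation). The product
  \<rho>(n) of all square roots of level n satisfies \<rho>(n)^2 = (2c^2)^(2^n) L(n+1) / L(n+2),
  where the integers L(j) describe the orbit of infinity: \<phi>^j(\<infinity>) = L(j+1) / L(j)^2.
  The elements of the field of level n with rational square are, up to rational factors, the
  products of the \<rho>(i) with i < n (lemma rational_square_in_Kf). So a relation would express
  L(n+2), modulo squares, by 2 and by the L(j) with j < n + 2. The theorem no_square_relation
  excludes this.

  Its proof is arithmetic. A prime divides L(n) exactly when its rank of apparition divides n,
  always with the same multiplicity. If L(N) were dependent on earlier terms, its primes of rank N
  would occur to even powers, and the product P(N) of the L(N/d) over squarefree d dividing N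
  would be a square up to sign. For even N with N / rad N at most 2 this is impossible because
  |P(N)| is 7 modulo 8. In all other cases a Jacobi symbol of an integer J(a) = m L(a)
  \<plusminus> c L(a-1)^2 over |P(N)| takes the value -1. These integers are where the special
  parameter enters: modulo J(a) the orbit of infinity reaches \<plusminus>c/m, and c/m maps to 1 -
  2m^2 = -c, then to -1, and then rejoins the orbit of infinity. So the orbit is periodic with
  period a modulo J(a), up to squares and two exceptional terms, and with period j modulo L(j).
  Together with reciprocity this evaluates the symbols of J(a) over L(j) by a Euclidean algorithm
  on (a, j). The exceptional term - L(a+1) is c times a square, and the condition on m modulo 4
  makes its symbol equal to -1.
\<close>

hide_const (open) Divisibility.prime

section \<open>The Jacobi symbol\<close>

definition jacobi :: "int \<Rightarrow> nat \<Rightarrow> int" where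
  "jacobi a n = (\<Prod>p\<in>#prime_factorization n. Legendre a (int p))"

lemma Legendre_cases: "Legendre a p = -1 \<or> Legendre a p = 0 \<or> Legendre a p = 1"
  by (simp add: Legendre_def)

lemma Legendre_cong:
  assumes "[a = b] (mod p)"
  shows "Legendre a p = Legendre b p"
proof -
  have "[a = 0] (mod p) \<longleftrightarrow> [b = 0] (mod p)"
    using assms cong_trans cong_sym by blast
  moreover have "QuadRes p a \<longleftrightarrow> QuadRes p b"
    unfolding QuadRes_def using assms cong_trans cong_sym by blast
  ultimately show ?thesis by (simp add: Legendre_def)
qed

lemma small_dvd_imp_zero:
  assumes "int p dvd x" "\<bar>x\<bar> \<le> 2" "2 < p"
  shows "x = 0"
  using dvd_imp_le_int[of x "int p"] assms by force

lemma Legendre_mult: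
  assumes "prime p" "2 < p"
  shows "Legendre (a * b) (int p) = Legendre a (int p) * Legendre b (int p)"
proof -
  let ?L = "\<lambda>a. Legendre a (int p)"
  have "[?L (a * b) = (a * b) ^ ((p - 1) div 2)] (mod int p)"
    using euler_criterion[OF assms] by blast
  moreover have "[?L a * ?L b = a ^ ((p - 1) div 2) * b ^ ((p - 1) div 2)] (mod int p)"
    using euler_criterion[OF assms] cong_mult by blast
  ultimately have "[?L (a * b) = ?L a * ?L b] (mod int p)"
    by (metis power_mult_distrib cong_sym cong_trans)
  then have *: "int p dvd ?L (a * b) - ?L a * ?L b"
    by (simp add: cong_iff_dvd_diff)
  have "\<bar>?L (a * b) - ?L a * ?L b\<bar> \<le> 2"
    using Legendre_cases[of "a*b" "int p"] Legendre_cases[of "a" "int p"] Legendre_cases[of "b" "int p"]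
    by auto
  from small_dvd_imp_zero[OF * this assms(2)] show ?thesis by simp
qed

lemma jacobi_1 [simp]: "jacobi a 1 = 1" "jacobi a (Suc 0) = 1"
  by (simp_all add: jacobi_def)

lemma jacobi_prime [simp]: "prime p \<Longrightarrow> jacobi a p = Legendre a (int p)"
  by (simp add: jacobi_def prime_factorization_prime)

lemma jacobi_mult_right:
  assumes "n \<noteq> 0" "k \<noteq> 0"
  shows "jacobi a (n * k) = jacobi a n * jacobi a k"
  using assms by (simp add: jacobi_def prime_factorization_mult)

lemma odd_prime_factor_gt_2:
  assumes "odd n" "p \<in># prime_factorization n"
  shows "prime p" "2 < (p::nat)"
proof -
  show "prime p" using assms(2) by (rule in_prime_factors_imp_prime)
  have "p \<noteq> 2" using assms by (auto dest: in_prime_factors_imp_dvd)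
  then show "2 < p" using prime_ge_2_nat[OF \<open>prime p\<close>] by simp
qed

lemma jacobi_mult_left:
  assumes "odd n"
  shows "jacobi (a * b) n = jacobi a n * jacobi b n"
proof -
  have "jacobi (a * b) n = (\<Prod>p\<in>#prime_factorization n. Legendre a (int p) * Legendre b (int p))"
    unfolding jacobi_def
    by (intro arg_cong[where f = prod_mset] image_mset_cong)
       (use odd_prime_factor_gt_2[OF assms] in \<open>auto intro: Legendre_mult\<close>)
  then show ?thesis by (simp add: jacobi_def prod_mset.distrib)
qed

lemma jacobi_cong:
  assumes "[a = b] (mod int n)"
  shows "jacobi a n = jacobi b n"
  unfolding jacobi_def
proof (intro arg_cong[where f = prod_mset] image_mset_cong Legendre_cong)
  fix p assume "p \<in># prime_factorization n"
  then have "int p dvd int n" by (auto dest: in_prime_factors_imp_dvd)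
  then show "[a = b] (mod int p)" using assms cong_dvd_modulus by blast
qed

lemma jacobi_cases: "jacobi a n = -1 \<or> jacobi a n = 0 \<or> jacobi a n = 1"
proof -
  have "(\<Prod>p\<in>#M. Legendre a (int p)) \<in> {-1, 0, 1}" for M
    by (induction M) (use Legendre_cases in \<open>auto simp: Legendre_def\<close>)
  then show ?thesis by (auto simp: jacobi_def)
qed

lemma jacobi_nonzero:
  assumes "n > 0" "coprime a (int n)"
  shows "jacobi a n \<noteq> 0"
proof
  assume "jacobi a n = 0"
  then obtain p where p: "p \<in># prime_factorization n" "Legendre a (int p) = 0"
    by (auto simp: jacobi_def prod_mset_zero_iff)
  then have "int p dvd a" by (auto simp: Legendre_def cong_0_iff split: if_splits)
  moreover have "int p dvd int n" using p(1) by (auto dest: in_prime_factors_imp_dvd)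
  ultimately have "is_unit (int p)" using assms(2) by (meson coprime_common_divisor)
  then show False using p(1) in_prime_factors_imp_prime not_prime_1 by fastforce
qed

lemma jacobi_1_left [simp]: "n > 0 \<Longrightarrow> odd n \<Longrightarrow> jacobi 1 n = 1"
  using jacobi_mult_left[of n 1 1] jacobi_nonzero[of n 1] by simp

lemma jacobi_square:
  assumes "odd n" "coprime x (int n)"
  shows "jacobi (x\<^sup>2) n = 1"
proof -
  have "jacobi (x\<^sup>2) n = jacobi x n * jacobi x n"
    using jacobi_mult_left[OF assms(1)] by (simp add: power2_eq_square)
  moreover have "jacobi x n \<noteq> 0" using jacobi_nonzero assms odd_pos by blast
  ultimately show ?thesis using jacobi_cases[of x n] by auto
qed

lemma jacobi_mult_square:
  assumes "odd n" "coprime x (int n)"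
  shows "jacobi (x\<^sup>2 * a) n = jacobi a n"
  using jacobi_mult_left[OF assms(1)] jacobi_square[OF assms] by simp

lemma odd_mult_mod_4:
  assumes "odd (p::nat)" "odd n"
  shows "(p * n) mod 4 = 3 \<longleftrightarrow> (p mod 4 = 3 \<longleftrightarrow> n mod 4 \<noteq> 3)"
proof -
  have "p mod 4 = 1 \<or> p mod 4 = 3" "n mod 4 = 1 \<or> n mod 4 = 3" using assms by presburger+
  then show ?thesis
    by (auto simp: mod_mult_eq[of p 4 n, symmetric] simp del: mod_mult_eq)
qed

lemma minus_one_power_half:
  assumes "odd (p::nat)"
  shows "(-1::int) ^ ((p - 1) div 2) = (if p mod 4 = 3 then -1 else 1)"
proof -
  have "p mod 4 = 1 \<or> p mod 4 = 3" using assms by presburger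
  then show ?thesis
  proof
    assume "p mod 4 = 1"
    then have "even ((p - 1) div 2)" by presburger
    then show ?thesis using \<open>p mod 4 = 1\<close> by simp
  next
    assume "p mod 4 = 3"
    then have "odd ((p - 1) div 2)" by presburger
    then show ?thesis using \<open>p mod 4 = 3\<close> by simp
  qed
qed

lemma Legendre_minus_one:
  assumes "prime p" "2 < p"
  shows "Legendre (-1) (int p) = (if p mod 4 = 3 then -1 else 1)"
proof -
  have "odd p" using assms prime_odd_nat by blast
  have *: "[Legendre (-1) (int p) = (if p mod 4 = 3 then -1 else 1)] (mod int p)"
    using euler_criterion[OF assms, of "-1"] minus_one_power_half[OF \<open>odd p\<close>] by simp
  then have *: "int p dvd Legendre (-1) (int p) - (if p mod 4 = 3 then -1 else 1)"
    by (simp add: cong_iff_dvd_diff)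
  have "\<bar>Legendre (-1) (int p) - (if p mod 4 = 3 then -1 else 1)\<bar> \<le> 2"
    using Legendre_cases[of "-1" "int p"] by auto
  from small_dvd_imp_zero[OF * this assms(2)] show ?thesis by simp
qed

lemma jacobi_minus_one:
  assumes "odd n"
  shows "jacobi (-1) n = (if n mod 4 = 3 then -1 else 1)"
  using assms
proof (induction n rule: prime_divisors_induct)
  case zero then show ?case by simp
next
  case (unit x) then show ?case by simp
next
  case (factor p n)
  then have "odd p" "odd n" "n \<noteq> 0" "p \<noteq> 0" "p \<noteq> 2" by (auto intro: odd_pos)
  then have "2 < p" using prime_ge_2_nat[OF factor(1)] by simp
  then show ?case
    using factor jacobi_mult_right[of p n] \<open>odd p\<close> \<open>odd n\<close> \<open>n \<noteq> 0\<close> \<open>p \<noteq> 0\<close>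
      odd_mult_mod_4[of p n] Legendre_minus_one[of p] by auto
qed

lemma Legendre_reciprocity:
  assumes "prime p" "2 < p" "prime q" "2 < q"
  shows "Legendre (int p) (int q) =
    (if p mod 4 = 3 \<and> q mod 4 = 3 then -1 else 1) * Legendre (int q) (int p)"
proof (cases "p = q")
  case True
  then show ?thesis by (simp add: Legendre_def cong_def)
next
  case False
  have odd: "odd p" "odd q" using assms prime_odd_nat by blast+
  have "(-1::int) ^ ((p - 1) div 2 * ((q - 1) div 2)) = (if p mod 4 = 3 \<and> q mod 4 = 3 then -1 else 1)"
    using minus_one_power_half[OF odd(1)] minus_one_power_half[OF odd(2)]
    by (auto simp: power_mult)
  then have "Legendre (int p) (int q) * Legendre (int q) (int p) =
      (if p mod 4 = 3 \<and> q mod 4 = 3 then -1 else 1)"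
    using Quadratic_Reciprocity[OF assms False] by simp
  then show ?thesis
    using Legendre_cases[of "int p" "int q"] Legendre_cases[of "int q" "int p"]
    by (auto split: if_splits)
qed

text \<open>
  Both sides are multiplicative in each argument, because for odd numbers being 3 modulo 4 behaves
  like a sign under multiplication; so induction on the prime factors of one argument and then of
  the other leads back to two primes.
\<close>

theorem jacobi_reciprocity:
  assumes "odd m" "odd n"
  shows "jacobi (int m) n = (if m mod 4 = 3 \<and> n mod 4 = 3 then -1 else 1) * jacobi (int n) m"
proof -
  have prime_case: "jacobi (int m) p = (if m mod 4 = 3 \<and> p mod 4 = 3 then -1 else 1) * jacobi (int p) m"
    if "odd m" "prime p" "2 < p" for m p :: nat
    using that(1)
  proof (induction m rule: prime_divisors_induct)
    case zero then show ?case by simp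
  next
    case (unit x) then show ?case using prime_odd_nat[OF that(2)] that by (simp add: jacobi_1_left prime_gt_0_nat del: jacobi_prime)
  next
    case (factor q m)
    then have *: "odd q" "odd m" "m \<noteq> 0" "q \<noteq> 0" "q \<noteq> 2" by (auto intro: odd_pos)
    then have "2 < q" using prime_ge_2_nat[OF factor(1)] by simp
    have "odd p" using that prime_odd_nat by blast
    have "jacobi (int (q * m)) p = jacobi (int q) p * jacobi (int m) p"
      using jacobi_mult_left[OF \<open>odd p\<close>] by simp
    moreover have "jacobi (int p) (q * m) = jacobi (int p) q * jacobi (int p) m"
      using jacobi_mult_right * by simp
    moreover have "jacobi (int q) p = (if q mod 4 = 3 \<and> p mod 4 = 3 then -1 else 1) * jacobi (int p) q"
      using Legendre_reciprocity[OF factor(1) \<open>2 < q\<close> that(2,3)] that(2) factor(1) by simp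
    ultimately show ?case
      using factor(2) *(2) odd_mult_mod_4[OF *(1,2)] by auto
  qed
  show ?thesis using assms(2)
  proof (induction n rule: prime_divisors_induct)
    case zero then show ?case by simp
  next
    case (unit x) then show ?case using assms(1) odd_pos by simp
  next
    case (factor q n)
    then have *: "odd q" "odd n" "n \<noteq> 0" "q \<noteq> 0" "q \<noteq> 2" by (auto intro: odd_pos)
    then have "2 < q" using prime_ge_2_nat[OF factor(1)] by simp
    have "jacobi (int (q * n)) m = jacobi (int q) m * jacobi (int n) m"
      using jacobi_mult_left[OF assms(1)] by simp
    moreover have "jacobi (int m) (q * n) = jacobi (int m) q * jacobi (int m) n"
      using jacobi_mult_right * by simp
    moreover have "jacobi (int m) q = (if m mod 4 = 3 \<and> q mod 4 = 3 then -1 else 1) * jacobi (int q) m"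
      using prime_case[OF assms(1) factor(1) \<open>2 < q\<close>] by simp
    ultimately show ?case
      using factor(2) *(2) odd_mult_mod_4[OF *(1,2)] by auto
  qed
qed

lemma ex_odd_part: "x > 0 \<Longrightarrow> \<exists>i y. (x::nat) = 2 ^ i * y \<and> odd y"
proof (induction x rule: less_induct)
  case (less x)
  show ?case
  proof (cases "odd x")
    case True
    then show ?thesis by (intro exI[of _ 0] exI[of _ x]) simp
  next
    case False
    then obtain z where z: "x = 2 * z" by (auto elim: evenE)
    then have "z < x" "z > 0" using less.prems by auto
    then obtain i y where "z = 2 ^ i * y" "odd y" using less.IH by blast
    then have "x = 2 ^ Suc i * y \<and> odd y" using z by simp
    then show ?thesis by blast
  qed
qed

lemma jacobi_power_eq_1: "odd n \<Longrightarrow> jacobi x n = 1 \<Longrightarrow> jacobi (x ^ i) n = 1"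
  by (induction i) (auto simp: jacobi_mult_left odd_pos)

text \<open>
  A way to recognise that 2 has symbol 1, which avoids the supplementary law for 2: the moduli below
  come with a congruence between twice a square and a square.
\<close>

lemma jacobi_2_eq_1I:
  assumes "odd n" "jacobi (2 * s\<^sup>2) n = 1"
  shows "jacobi 2 n = 1"
proof -
  have "jacobi 2 n * (jacobi s n * jacobi s n) = 1"
    using assms by (simp add: jacobi_mult_left power2_eq_square)
  then show ?thesis using jacobi_cases[of 2 n] jacobi_cases[of s n] by auto
qed

lemma jacobi_cancel_square:
  assumes "odd n" "coprime u (int n)" "coprime v (int n)" "[u\<^sup>2 * x = v\<^sup>2 * y] (mod int n)"
  shows "jacobi x n = jacobi y n"
  using jacobi_mult_square[OF assms(1,2), of x] jacobi_mult_square[OF assms(1,3), of y]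
    jacobi_cong[OF assms(4)] by simp

lemma mod_8_facts:
  shows "int n mod 8 = 7 \<Longrightarrow> n mod 8 = 7" "int n mod 8 = 1 \<Longrightarrow> n mod 8 = 1"
    "n mod 8 = 7 \<Longrightarrow> n mod 4 = 3" "n mod 8 = 1 \<Longrightarrow> n mod 4 = 1"
  by presburger+

lemma cong_int_mod_4: "n mod 4 = 3 \<Longrightarrow> [int n = -1] (mod 4)"
  unfolding cong_def by presburger

section \<open>The orbit of infinity\<close>

text \<open>
  Numerators of the orbit of infinity under \<phi>(z) = 1 - 2c^2/z^2: writing L_j for crit c j, the
  n-th iterate of \<phi> sends infinity to L_(n+1) / L_n^2. The value L_0 = 0 makes this true for
  n = 0, as 1/0 then stands for infinity.
\<close>

fun crit :: "int \<Rightarrow> nat \<Rightarrow> int" where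
  "crit c 0 = 0"
| "crit c (Suc 0) = 1"
| "crit c (Suc (Suc n)) = (crit c (Suc n))\<^sup>2 - 2 * c\<^sup>2 * crit c n ^ 4"

lemma crit_2 [simp]: "crit c 2 = 1"
  by (simp add: numeral_2_eq_2)

lemma crit_rec: "j \<ge> 1 \<Longrightarrow> crit c (j + 1) = (crit c j)\<^sup>2 - 2 * c\<^sup>2 * crit c (j - 1) ^ 4"
  by (cases j) auto

lemma odd_square_mod_8:
  assumes "odd (x::int)"
  shows "[x\<^sup>2 = 1] (mod 8)"
proof -
  obtain k where k: "x = 2 * k + 1" using assms by (auto elim: oddE)
  have "even (k * (k + 1))" by simp
  then obtain l where "k * (k + 1) = 2 * l" unfolding dvd_def by blast
  then have "x\<^sup>2 - 1 = 8 * l" unfolding k by (simp add: power2_eq_square algebra_simps)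
  then show ?thesis by (simp add: cong_iff_dvd_diff)
qed

locale crit_odd =
  fixes c :: int
  assumes odd_c: "odd c" and c_gt_1: "c > 1"
begin

abbreviation "L \<equiv> crit c"

lemma odd_L: "n \<ge> 1 \<Longrightarrow> odd (L n)"
  by (induction n rule: induct_nat_012) (auto simp: Suc_le_eq intro: gr0I)

lemma L_nonzero: "n \<ge> 1 \<Longrightarrow> L n \<noteq> 0"
  using odd_L by force

text \<open>
  For indices at least 3 the recursion only involves odd squares, which are 1 modulo 8.
\<close>

lemma L_mod_8:
  assumes "n \<ge> 3"
  shows "[L n = -1] (mod 8)"
proof -
  obtain k where k: "n = Suc (Suc (Suc k))"
    using assms by (metis Suc_le_D numeral_3_eq_3 Suc_le_mono)
  have 1: "[(L (Suc (Suc k)))\<^sup>2 = 1] (mod 8)" by (rule odd_square_mod_8, rule odd_L) simp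
  have "[(L (Suc k))\<^sup>2 = 1] (mod 8)" by (rule odd_square_mod_8, rule odd_L) simp
  then have 2: "[((L (Suc k))\<^sup>2)\<^sup>2 = 1\<^sup>2] (mod 8)" by (rule cong_pow)
  have 3: "[c\<^sup>2 = 1] (mod 8)" by (rule odd_square_mod_8[OF odd_c])
  have "[(L (Suc (Suc k)))\<^sup>2 - 2 * c\<^sup>2 * ((L (Suc k))\<^sup>2)\<^sup>2 = 1 - 2 * 1 * 1\<^sup>2] (mod 8)"
    by (rule cong_diff[OF 1 cong_mult[OF cong_mult[OF cong_refl 3] 2]])
  then show ?thesis by (simp add: k)
qed

lemma L_cong_1_mod_c: "n \<ge> 1 \<Longrightarrow> [L n = 1] (mod c)"
proof (induction n rule: induct_nat_012)
  case (ge2 n)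
  have "[L (Suc n) ^ 2 - 2 * c\<^sup>2 * L n ^ 4 = 1 ^ 2 - 0 * L n ^ 4] (mod c)"
  proof (rule cong_diff[OF cong_pow cong_mult])
    show "[2 * c\<^sup>2 = 0] (mod c)" by (simp add: cong_0_iff)
  qed (use ge2(2) in simp_all)
  then show ?case by simp
qed auto

lemma coprime_c_L: "n \<ge> 1 \<Longrightarrow> coprime c (L n)"
  using L_cong_1_mod_c cong_imp_coprime[of 1 "L n" c] by (simp add: cong_sym coprime_commute)

lemma coprime_consecutive: "coprime (L n) (L (Suc n))"
proof (induction n)
  case (Suc n)
  show ?case
  proof (cases "n = 0")
    case False
    have "coprime (L (Suc n)) (2 * c\<^sup>2 * L n ^ 4)"
      using Suc odd_L[of "Suc n"] coprime_c_L[of "Suc n"] by (auto simp: coprime_commute)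
    then have "coprime (L (Suc n)) (L (Suc n) * L (Suc n) + - (2 * c\<^sup>2 * L n ^ 4))"
      by (simp only: coprime_iff_gcd_eq_1 gcd_add_mult gcd_neg2)
    then show ?thesis by (simp add: power2_eq_square)
  qed simp
qed simp

text \<open>
  The signs alternate because the magnitudes do: if |L_(2k+1)| is large compared with L_(2k)^2, the
  square dominates the next step and the value is positive, but then it is at most L_(2k+1)^2 and
  too small to dominate the step after. The bounds are the invariant that makes this induction
  work, and they are used again to find signs of combinations of consecutive terms.
\<close>

lemma L_signs:
  assumes "k \<ge> 1"
  shows "0 < L (2 * k) \<and> L (2 * k) \<le> (L (2 * k - 1))\<^sup>2 \<and>
         L (2 * k + 1) \<le> - ((2 * c\<^sup>2 - 1) * (L (2 * k))\<^sup>2)"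
  using assms
proof (induction k rule: nat_induct_at_least)
  case base
  then show ?case by (simp add: numeral_2_eq_2)
next
  case (Suc k)
  let ?a = "L (2 * k)" and ?b = "L (2 * k + 1)"
  have e: "2 * Suc k = Suc (Suc (2 * k))" "2 * Suc k - 1 = Suc (2 * k)" by simp_all
  have c2: "c\<^sup>2 \<ge> 4" using c_gt_1 power_mono[of 2 c 2] by simp
  have A: "L (2 * Suc k) = ?b\<^sup>2 - 2 * c\<^sup>2 * ?a ^ 4" by (simp add: e)
  have pos: "?a\<^sup>2 > 0" using Suc by simp
  have nn: "(2 * c\<^sup>2 - 1) * ?a\<^sup>2 \<ge> 0"
    using c2 by (intro mult_nonneg_nonneg) auto
  have "((2 * c\<^sup>2 - 1) * ?a\<^sup>2)\<^sup>2 \<le> (- ?b)\<^sup>2"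
    using Suc nn by (intro power_mono) auto
  then have 1: "(2 * c\<^sup>2 - 1)\<^sup>2 * ?a ^ 4 \<le> ?b\<^sup>2"
    by (simp add: power_mult_distrib flip: power_mult)
  have "2 * c\<^sup>2 < (2 * c\<^sup>2 - 1)\<^sup>2"
    using mult_mono[of 7 "2 * c\<^sup>2 - 1" "2 * c\<^sup>2 - 1" "2 * c\<^sup>2 - 1"] c2 by (simp add: power2_eq_square)
  then have "2 * c\<^sup>2 * ?a ^ 4 < (2 * c\<^sup>2 - 1)\<^sup>2 * ?a ^ 4"
    using Suc by simp
  with 1 A have 2: "L (2 * Suc k) > 0" by linarith
  have 3: "L (2 * Suc k) \<le> ?b\<^sup>2" using A by simp
  have B: "L (2 * Suc k + 1) = (L (2 * Suc k))\<^sup>2 - 2 * c\<^sup>2 * ?b ^ 4" by (simp add: e)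
  have "(L (2 * Suc k))\<^sup>2 \<le> (?b\<^sup>2)\<^sup>2" using 2 3 by (intro power_mono) auto
  then have "(L (2 * Suc k))\<^sup>2 \<le> ?b ^ 4" by simp
  then have "2 * c\<^sup>2 * (L (2 * Suc k))\<^sup>2 \<le> 2 * c\<^sup>2 * ?b ^ 4" by (intro mult_left_mono) auto
  then have "L (2 * Suc k + 1) \<le> - ((2 * c\<^sup>2 - 1) * (L (2 * Suc k))\<^sup>2)"
    unfolding B by (simp add: algebra_simps)
  with 2 3 show ?case by (simp add: e)
qed

lemma L_even_pos: "even n \<Longrightarrow> n \<ge> 2 \<Longrightarrow> L n > 0"
  using L_signs[of "n div 2"] by auto

lemma L_odd_le:
  assumes "odd n" "n \<ge> 3"
  shows "L n \<le> - ((2 * c\<^sup>2 - 1) * (L (n - 1))\<^sup>2)"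
proof -
  have "n = 2 * (n div 2) + 1" "n div 2 \<ge> 1" "n - 1 = 2 * (n div 2)" using assms by presburger+
  then show ?thesis using L_signs[of "n div 2"] by metis
qed

lemma L_odd_neg:
  assumes "odd n" "n \<ge> 3"
  shows "L n < 0"
proof -
  have "c\<^sup>2 > 1" using c_gt_1 by (simp add: one_less_power)
  then have "(2 * c\<^sup>2 - 1) * (L (n - 1))\<^sup>2 > 0"
    using L_nonzero[of "n - 1"] assms by simp
  then show ?thesis using L_odd_le[OF assms] by linarith
qed

text \<open>
  The residue of L_(j+1) modulo L_j^2.
\<close>

definition lam :: "nat \<Rightarrow> int" where
  "lam j = - (2 * c\<^sup>2 * L (j - 1) ^ 4)"

lemma coprime_lam: "j \<ge> 1 \<Longrightarrow> coprime (lam j) (L j)"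
  using coprime_consecutive[of "j - 1"] odd_L[of j] coprime_c_L[of j]
  by (auto simp: lam_def)

text \<open>
  Modulo L_j the orbit is back at infinity after j steps and starts again. The recursion is
  homogeneous when L_i is given weight 2^(i-1), so starting with L_(j+1) = lam j instead of L_1 =
  1 multiplies L_i by lam j to the power 2^(i-1). The congruence even holds modulo L_j^2, since
  L_j enters the recursion only through its square and its fourth power; the square is what
  controls multiplicities.
\<close>

lemma L_shift:
  assumes "j \<ge> 1"
  shows "[L (j + Suc i) = lam j ^ (2 ^ i) * L (Suc i)] (mod (L j)\<^sup>2)"
proof (induction i rule: induct_nat_012)
  case 0
  then show ?case using crit_rec[OF assms, of c]
    by (auto simp: lam_def cong_iff_dvd_diff)
next
  case 1
  have "L (j + Suc 1) = (L (j + 1))\<^sup>2 - 2 * c\<^sup>2 * L j ^ 4" by simp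
  also have "[\<dots> = (lam j)\<^sup>2 - 0] (mod (L j)\<^sup>2)"
    using crit_rec[OF assms, of c]
    by (intro cong_diff cong_pow)
       (auto simp: lam_def cong_iff_dvd_diff intro!: dvd_mult le_imp_power_dvd)
  finally show ?case by (simp add: numeral_2_eq_2[symmetric])
next
  case (ge2 i)
  define u where "u = lam j ^ (2 ^ i)"
  have u: "lam j ^ (2 ^ Suc i) = u\<^sup>2" "lam j ^ (2 ^ Suc (Suc i)) = u ^ 4"
    by (simp_all add: u_def mult.commute flip: power_mult)
  define p where "p = L (Suc (Suc i))"
  define q where "q = L (Suc i)"
  have 1: "[L (j + Suc i) = u * q] (mod (L j)\<^sup>2)" and 2: "[L (j + Suc (Suc i)) = u\<^sup>2 * p] (mod (L j)\<^sup>2)"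
    using ge2 by (simp_all only: u u_def p_def q_def)
  have "[(L (j + Suc (Suc i)))\<^sup>2 - 2 * c\<^sup>2 * L (j + Suc i) ^ 4 = (u\<^sup>2 * p)\<^sup>2 - 2 * c\<^sup>2 * (u * q) ^ 4]
      (mod (L j)\<^sup>2)"
    by (rule cong_diff[OF cong_pow[OF 2] cong_mult[OF cong_refl cong_pow[OF 1]]])
  moreover have "(u\<^sup>2 * p)\<^sup>2 - 2 * c\<^sup>2 * (u * q) ^ 4 = u ^ 4 * (p\<^sup>2 - 2 * c\<^sup>2 * q ^ 4)"
    by (simp add: power_mult_distrib right_diff_distrib flip: power_mult)
  ultimately show ?case unfolding u(2) by (simp add: p_def q_def)
qed

lemma prime_dvd_L_shift:
  assumes "prime p" "j \<ge> 1" "i \<ge> 1" "p dvd L j"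
  shows "p dvd L (j + i) \<longleftrightarrow> p dvd L i"
proof -
  obtain i' where i: "i = Suc i'" using assms(3) by (cases i) auto
  have "p dvd (L j)\<^sup>2" using assms(4) by (simp add: power2_eq_square)
  then have "[L (j + i) = lam j ^ (2 ^ i') * L i] (mod p)"
    using L_shift[OF assms(2)] i cong_dvd_modulus by blast
  then have "p dvd L (j + i) \<longleftrightarrow> p dvd lam j ^ (2 ^ i') * L i" by (rule cong_dvd_iff)
  moreover have "\<not> p dvd lam j"
    using coprime_lam[OF assms(2)] assms(1,4) by (meson coprime_common_divisor not_prime_unit)
  ultimately show ?thesis using assms(1) by (meson prime_dvd_mult_iff prime_dvd_power)
qed

lemma multiplicity_L_shift:
  assumes "prime p" "j \<ge> 1" "i \<ge> 1" "p dvd L j" "multiplicity p (L i) = multiplicity p (L j)"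
  shows "multiplicity p (L (j + i)) = multiplicity p (L j)"
proof -
  obtain i' where i: "i = Suc i'" using assms(3) by (cases i) auto
  define v where "v = multiplicity p (L j)"
  have nu: "\<not> is_unit p" using assms(1) by auto
  have v: "v \<ge> 1" unfolding v_def
    using assms(1,2,4) L_nonzero nu by (metis multiplicity_gt_zero_iff Suc_leI One_nat_def)
  have "p ^ v dvd L j" by (simp add: v_def multiplicity_dvd)
  then have "p ^ v * p ^ v dvd (L j)\<^sup>2" unfolding power2_eq_square by (rule mult_dvd_mono) fact
  moreover have "p ^ Suc v dvd p ^ v * p ^ v" 
    using v by (simp only: power_add[symmetric] le_imp_power_dvd)
  ultimately have "p ^ Suc v dvd (L j)\<^sup>2" by (rule dvd_trans[rotated])
  then have *: "[L (j + i) = lam j ^ (2 ^ i') * L i] (mod p ^ Suc v)"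
    using L_shift[OF assms(2)] i cong_dvd_modulus by blast
  then have **: "[L (j + i) = lam j ^ (2 ^ i') * L i] (mod p ^ v)"
    by (rule cong_dvd_modulus) simp
  have nd: "\<not> p dvd lam j"
    using coprime_lam[OF assms(2)] assms(1,4) by (meson coprime_common_divisor not_prime_unit)
  have "multiplicity p (lam j ^ (2 ^ i') * L i) = v"
    using nd assms L_nonzero[of i]
    by (subst prime_elem_multiplicity_mult_distrib)
       (auto simp: v_def not_dvd_imp_multiplicity_0 prime_dvd_power_iff prime_elem_multiplicity_power_distrib)
  moreover have "lam j ^ (2 ^ i') * L i \<noteq> 0" using nd assms(3) L_nonzero by auto
  ultimately have "p ^ v dvd lam j ^ (2 ^ i') * L i" "\<not> p ^ Suc v dvd lam j ^ (2 ^ i') * L i"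
    using power_dvd_iff_le_multiplicity[OF _ nu] by (metis order_refl, metis Suc_n_not_le_n)
  then have "p ^ v dvd L (j + i)" "\<not> p ^ Suc v dvd L (j + i)"
    using * ** by (metis cong_0_iff cong_sym cong_trans)+
  then show ?thesis unfolding v_def[symmetric] by (rule multiplicity_eqI)
qed

text \<open>
  The rank of apparition of p in the sequence.
\<close>

definition rank :: "int \<Rightarrow> nat" where
  "rank p = (LEAST d. d \<ge> 1 \<and> p dvd L d)"

lemma rank_props:
  assumes "p dvd L n" "n \<ge> 1"
  shows "rank p \<ge> 1" "p dvd L (rank p)" "rank p \<le> n"
  using LeastI[of "\<lambda>d. d \<ge> 1 \<and> p dvd L d" n] Least_le[of "\<lambda>d. d \<ge> 1 \<and> p dvd L d" n] assms
  by (auto simp: rank_def)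

lemma rank_dvd_iff:
  assumes "prime p" "p dvd L n" "n \<ge> 1" "k \<ge> 1"
  shows "p dvd L k \<longleftrightarrow> rank p dvd k"
  using assms(4)
proof (induction k rule: less_induct)
  case (less k)
  note r = rank_props[OF assms(2,3)]
  consider "k < rank p" | "k = rank p" | "k > rank p" by linarith
  then show ?case
  proof cases
    case 1
    then show ?thesis using less rank_props[of p k] by (auto dest: dvd_imp_le)
  next
    case 2
    then show ?thesis using r by simp
  next
    case 3
    then have "p dvd L k \<longleftrightarrow> p dvd L (k - rank p)"
      using prime_dvd_L_shift[OF assms(1) r(1) _ r(2), of "k - rank p"] by simp
    also have "\<dots> \<longleftrightarrow> rank p dvd k - rank p" using less 3 r by simp
    also have "\<dots> \<longleftrightarrow> rank p dvd k" using 3 by (simp add: dvd_minus_self)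
    finally show ?thesis .
  qed
qed

text \<open>
  A prime occurs in all the terms it divides with the same multiplicity, since a shift by the rank
  changes L_n only by a factor prime to p, up to a multiple of L_(rank p)^2.
\<close>

lemma multiplicity_L:
  assumes "prime p" "p dvd L n" "n \<ge> 1"
  shows "multiplicity p (L n) = multiplicity p (L (rank p))"
  using assms(2,3)
proof (induction n rule: less_induct)
  case (less n)
  note r = rank_props[OF less.prems]
  show ?case
  proof (cases "n = rank p")
    case False
    then have "n > rank p" using r by simp
    moreover have "p dvd L (n - rank p)"
      using prime_dvd_L_shift[OF assms(1) r(1) _ r(2), of "n - rank p"] less.prems \<open>n > rank p\<close> by simp
    moreover have "n - rank p < n" "n - rank p \<ge> 1" "rank p + (n - rank p) = n"
      using \<open>n > rank p\<close> r(1) by auto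
    ultimately show ?thesis
      using less.IH[of "n - rank p"] multiplicity_L_shift[OF assms(1) r(1) _ r(2), of "n - rank p"]
      by metis
  qed simp
qed

end

section \<open>Test integers and their symbols\<close>

locale arboreal =
  fixes m :: nat
  assumes m_ge_2: "m \<ge> 2" and m_mod_4: "m mod 4 \<noteq> 1"
begin

definition c :: int where "c = 2 * (int m)\<^sup>2 - 1"

lemma c_gt_m: "c > int m"
proof -
  have "int m * 2 \<le> int m * int m" using m_ge_2 by (intro mult_left_mono) auto
  moreover have "int m \<ge> 2" using m_ge_2 by simp
  ultimately show ?thesis unfolding c_def power2_eq_square by linarith
qed

sublocale crit_odd c
proof
  show "odd c" by (simp add: c_def)
  show "c > 1" using c_gt_m m_ge_2 by simp
qed

text \<open>
  This choice of sign makes c a non-residue modulo the odd part of J a, in the sense of jacobi_c_J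
  below.
\<close>

definition \<sigma> :: int where "\<sigma> = (if m mod 4 = 2 then -1 else 1)"

text \<open>
  Modulo J a one has L_a / L_(a-1)^2 = - \<sigma> c / m, which says that the orbit of infinity meets
  \<plusminus> c/m at step a - 1. The special form of the parameter makes this point preperiodic:
  \<phi>(\<plusminus> c/m) = 1 - 2 m^2 = -c, then \<phi>(-c) = -1 and \<phi>(-1) = 1 - 2c^2 =
  \<phi>(1) with 1 = \<phi>(\<infinity>). So modulo J a the orbit of infinity comes back to itself
  after a steps, apart from two exceptional values, while by L_shift it does the same modulo L_j
  after j steps.
\<close>

definition J :: "nat \<Rightarrow> int" where
  "J a = int m * L a + \<sigma> * (c * (L (a - 1))\<^sup>2)"

definition ell :: "nat \<Rightarrow> nat" where "ell j = nat \<bar>L j\<bar>"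

text \<open>
  The symbol of |J_a| over |L_j|. As the orbit repeats both modulo J a and modulo L j, this symbol
  can be computed by a Euclidean algorithm on the pair of indices: chi_reduce_left subtracts j
  from a, chi_reduce_right subtracts a from j.
\<close>

definition chi :: "nat \<Rightarrow> nat \<Rightarrow> int" where
  "chi a j = jacobi \<bar>J a\<bar> (ell j)"

lemma sigma_cases: "\<sigma> = 1 \<or> \<sigma> = -1" by (simp add: \<sigma>_def)
lemma sigma_sq [simp]: "\<sigma> * \<sigma> = 1" by (simp add: \<sigma>_def)

lemma int_ell: "int (ell j) = \<bar>L j\<bar>" by (simp add: ell_def)

lemma odd_ell: "j \<ge> 1 \<Longrightarrow> odd (ell j)"
  using odd_L[of j] by (simp add: ell_def even_nat_iff)

lemma cong_ell_iff: "[x = y] (mod int (ell j)) \<longleftrightarrow> [x = y] (mod L j)"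
  by (simp add: int_ell cong_iff_dvd_diff)

lemma coprime_ell_iff: "coprime x (int (ell j)) \<longleftrightarrow> coprime x (L j)"
  by (simp add: int_ell)

lemma ell_mod_8:
  assumes "j \<ge> 3"
  shows "ell j mod 8 = (if even j then 7 else 1)"
proof -
  have *: "L j mod 8 = 7" using L_mod_8[OF assms] by (simp add: cong_def)
  show ?thesis
  proof (cases "even j")
    case True
    then have "L j > 0" using L_even_pos assms by simp
    then have "int (ell j) = L j" by (simp add: int_ell)
    then have "int (ell j) mod 8 = 7" using * by simp
    then show ?thesis using True by presburger
  next
    case False
    then have "L j < 0" using L_odd_neg assms by simp
    then have "int (ell j) = - L j" by (simp add: int_ell)
    then have "int (ell j) mod 8 = 1" using * by presburger
    then show ?thesis using False by presburger
  qed
qed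

lemma jacobi_minus_one_ell: "j \<ge> 3 \<Longrightarrow> jacobi (-1) (ell j) = (if even j then -1 else 1)"
proof -
  assume j: "j \<ge> 3"
  have "ell j mod 4 = (if even j then 3 else 1)" using ell_mod_8[OF j] by presburger
  then show ?thesis using jacobi_minus_one[OF odd_ell[of j]] j by simp
qed

text \<open>
  The recursion itself exhibits twice a square as congruent to a square modulo L_j.
\<close>

lemma jacobi_2_ell:
  assumes "j \<ge> 3"
  shows "jacobi 2 (ell j) = 1"
proof -
  define k where "k = j - 2"
  have k: "j = Suc (Suc k)" using assms by (simp add: k_def)
  have "[2 * (c * (L k)\<^sup>2)\<^sup>2 = (L (Suc k))\<^sup>2] (mod L j)"
  proof -
    have "2 * (c * (L k)\<^sup>2)\<^sup>2 - (L (Suc k))\<^sup>2 = - L j" by (simp add: k power_mult_distrib)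
    then show ?thesis by (simp only: cong_iff_dvd_diff dvd_minus_iff dvd_refl)
  qed
  then have "jacobi (2 * (c * (L k)\<^sup>2)\<^sup>2) (ell j) = jacobi ((L (Suc k))\<^sup>2) (ell j)"
    by (intro jacobi_cong) (simp add: cong_ell_iff)
  also have "\<dots> = 1"
    using coprime_consecutive[of "Suc k"] odd_ell[of j] assms
    by (intro jacobi_square) (auto simp: k coprime_ell_iff simp del: crit.simps)
  finally show ?thesis using jacobi_2_eq_1I odd_ell[of j] assms by simp
qed

text \<open>
  Reciprocity takes this uniform shape because |L_j| is 7 modulo 8 exactly when L_j is positive: the
  sign from reciprocity and the sign of L_j always combine to - L_j. The power of 2 contributes
  nothing by jacobi_2_ell.
\<close>

lemma jacobi_ell_flip:
  assumes "j \<ge> 3" "x = 2 ^ i * y" "odd y"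
  shows "jacobi (int x) (ell j) = jacobi (- L j) y"
proof -
  have o: "odd (ell j)" using odd_ell assms by simp
  have "jacobi (int x) (ell j) = jacobi (2 ^ i) (ell j) * jacobi (int y) (ell j)"
    using jacobi_mult_left[OF o, of "2 ^ i" "int y"] by (simp add: assms(2))
  also have "jacobi (2 ^ i) (ell j) = 1" by (rule jacobi_power_eq_1[OF o jacobi_2_ell[OF assms(1)]])
  finally have 1: "jacobi (int x) (ell j) = jacobi (int y) (ell j)" by simp
  have m4: "ell j mod 4 = (if even j then 3 else 1)" using ell_mod_8[OF assms(1)] by presburger
  have 2: "jacobi (int y) (ell j) =
    (if y mod 4 = 3 \<and> ell j mod 4 = 3 then -1 else 1) * jacobi (int (ell j)) y"
    by (rule jacobi_reciprocity[OF assms(3) o])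
  show ?thesis
  proof (cases "even j")
    case True
    then have "int (ell j) = L j" using L_even_pos[of j] assms by (simp add: int_ell)
    moreover have "jacobi (- L j) y = jacobi (-1) y * jacobi (L j) y"
      using jacobi_mult_left[OF assms(3), of "-1" "L j"] by simp
    ultimately show ?thesis using 1 2 m4 True jacobi_minus_one[OF assms(3)] by simp
  next
    case False
    then have "int (ell j) = - L j" using L_odd_neg[of j] assms by (simp add: int_ell)
    then show ?thesis using 1 2 m4 False by simp
  qed
qed

section \<open>Signs and coprimality of the test integers\<close>

lemma c_mod_m: "[c = -1] (mod int m)"
  by (simp add: c_def cong_iff_dvd_diff)

lemma coprime_c_m: "coprime c (int m)" "coprime (int m) c"
  using cong_imp_coprime[OF cong_sym[OF c_mod_m]] by (simp_all add: coprime_commute)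

lemma L_sq_mod_m: "n \<ge> 1 \<Longrightarrow> [(L n)\<^sup>2 = 1] (mod int m)"
  and L_mod_m: "n \<ge> 3 \<Longrightarrow> [L n = -1] (mod int m)"
proof -
  have step: "[L (Suc (Suc n)) = -1] (mod int m)"
    if "[(L n)\<^sup>2 = 1] (mod int m)" "[(L (Suc n))\<^sup>2 = 1] (mod int m)" for n
  proof -
    have "[c\<^sup>2 = (-1)\<^sup>2] (mod int m)" by (rule cong_pow[OF c_mod_m])
    then have "[(L (Suc n))\<^sup>2 - 2 * c\<^sup>2 * ((L n)\<^sup>2)\<^sup>2 = 1 - 2 * (-1)\<^sup>2 * 1\<^sup>2] (mod int m)"
      using that by (intro cong_diff[OF _ cong_mult[OF cong_mult[OF cong_refl] cong_pow]])
    then show ?thesis by simp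
  qed
  have sq: "[(L n)\<^sup>2 = 1] (mod int m)" if "n \<ge> 1" for n
    using that
  proof (induction n rule: induct_nat_012)
    case (ge2 n)
    show ?case
    proof (cases "n = 0")
      case True then show ?thesis by simp
    next
      case False
      then have "[L (Suc (Suc n)) = -1] (mod int m)" using ge2 by (intro step) auto
      from cong_pow[OF this, of 2] show ?thesis by (simp del: crit.simps)
    qed
  qed auto
  show "n \<ge> 1 \<Longrightarrow> [(L n)\<^sup>2 = 1] (mod int m)" by (rule sq)
  assume n: "n \<ge> 3"
  define k where "k = n - 2"
  have k: "n = Suc (Suc k)" "k \<ge> 1" using n by (auto simp: k_def)
  show "[L n = -1] (mod int m)" unfolding k(1) using k(2) by (intro step sq) auto
qed

lemma coprime_m_L: "n \<ge> 1 \<Longrightarrow> coprime (int m) (L n)"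
  using cong_imp_coprime[OF cong_sym[OF L_sq_mod_m[of n]]] by (simp add: coprime_commute)

lemma coprime_J:
  assumes "a \<ge> 2"
  shows "coprime (int m) (J a)" "coprime c (J a)" "coprime (L (a - 1)) (J a)"
proof -
  have s: "coprime x \<sigma>" "coprime \<sigma> x" for x using sigma_cases by auto
  have a: "a - 1 \<ge> 1" "a \<ge> 1" "Suc (a - 1) = a" using assms by auto
  have *: "coprime x (y * x + z)" if "coprime x z" for x y z :: int
    using that by (simp only: coprime_iff_gcd_eq_1 gcd_add_mult)
  have "coprime (int m) (L a * int m + \<sigma> * (c * (L (a - 1))\<^sup>2))"
    using coprime_m_L[OF a(1)] coprime_c_m s by (intro *) simp
  then show "coprime (int m) (J a)" by (simp add: J_def mult.commute)
  have "coprime c ((\<sigma> * (L (a - 1))\<^sup>2) * c + int m * L a)"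
    using coprime_c_L[OF a(2)] coprime_c_m by (intro *) auto
  then show "coprime c (J a)" by (simp add: J_def algebra_simps)
  have "coprime (L (a - 1)) ((\<sigma> * c * L (a - 1)) * L (a - 1) + int m * L a)"
    using coprime_m_L[OF a(1), unfolded coprime_commute[of "int m"]]
      coprime_consecutive[of "a - 1", unfolded a(3)] by (intro *) simp
  then show "coprime (L (a - 1)) (J a)" by (simp add: J_def algebra_simps power2_eq_square)
qed

lemma J_nonzero: "a \<ge> 2 \<Longrightarrow> J a \<noteq> 0"
  using coprime_J(1)[of a] m_ge_2 by auto

text \<open>
  For even j the number -1 is a non-residue modulo |L_j|, so replacing |J_a| by J_a costs the sign
  of J_a. That this sign depends only on the parity of a is what allows a to be reduced modulo an
  even j.
\<close>

lemma J_sign: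
  assumes "a \<ge> 2"
  shows "\<bar>J a\<bar> = (if even a then \<sigma> else -1) * J a"
proof (cases "even a")
  case True
  then have k: "2 * (a div 2) = a" "a div 2 \<ge> 1" using assms by auto
  have La: "0 < L a" "L a \<le> (L (a - 1))\<^sup>2" using L_signs[OF k(2)] k(1) by auto
  show ?thesis
  proof (cases "\<sigma> = 1")
    case 1: True
    have "int m * L a \<ge> 0" using La by simp
    moreover have "c * (L (a - 1))\<^sup>2 \<ge> 0" using c_gt_1 by simp
    ultimately show ?thesis using 1 True by (simp add: J_def)
  next
    case False
    then have s: "\<sigma> = -1" using sigma_cases by simp
    have "int m * L a \<le> int m * (L (a - 1))\<^sup>2" using La by (intro mult_left_mono) auto
    also have "\<dots> \<le> c * (L (a - 1))\<^sup>2" using c_gt_m by (intro mult_right_mono) auto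
    finally show ?thesis using s True by (simp add: J_def)
  qed
next
  case False
  then have a: "a \<ge> 3" using assms by presburger
  let ?s = "(L (a - 1))\<^sup>2"
  have c2: "c * 2 \<le> c * c" using c_gt_1 by (intro mult_left_mono) auto
  have "int m * L a \<le> int m * (- ((2 * c\<^sup>2 - 1) * ?s))"
    using L_odd_le[OF False a] by (intro mult_left_mono) auto
  also have "\<dots> \<le> 1 * (- ((2 * c\<^sup>2 - 1) * ?s))"
  proof (rule mult_right_mono_neg)
    have "0 \<le> (2 * c\<^sup>2 - 1) * ?s" using c2 c_gt_1 by (intro mult_nonneg_nonneg) (auto simp: power2_eq_square)
    then show "- ((2 * c\<^sup>2 - 1) * ?s) \<le> 0" by simp
  qed (use m_ge_2 in simp)
  also have "1 * (- ((2 * c\<^sup>2 - 1) * ?s)) \<le> - (c * ?s)"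
  proof -
    have "c * ?s \<le> (2 * c\<^sup>2 - 1) * ?s"
      using c2 c_gt_1 by (intro mult_right_mono) (auto simp: power2_eq_square)
    then show ?thesis by simp
  qed
  finally have "int m * L a + c * ?s \<le> 0" by simp
  moreover have "\<sigma> * (c * ?s) \<le> c * ?s" using sigma_cases c_gt_1 by auto
  ultimately show ?thesis using False by (simp add: J_def)
qed

lemma jacobi_abs_ell_odd:
  assumes "odd j" "j \<ge> 3"
  shows "jacobi \<bar>x\<bar> (ell j) = jacobi x (ell j)"
  using jacobi_mult_left[OF odd_ell[of j], of "-1" x] jacobi_minus_one_ell[of j] assms
  by (auto simp: abs_if)

section \<open>Reducing the first index\<close>

lemma coprime_lam_power: "j \<ge> 1 \<Longrightarrow> coprime (lam j ^ k) (L j)"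
  using coprime_lam[of j] by simp

lemma L_shift_mod:
  assumes "j \<ge> 1"
  shows "[L (j + Suc i) = lam j ^ (2 ^ i) * L (Suc i)] (mod L j)"
  by (rule cong_dvd_modulus[OF L_shift[OF assms]]) (simp add: power2_eq_square)

text \<open>
  J_a is homogeneous in the weights that govern L_shift: L_a and L_(a-1)^2 carry the same one.
\<close>

lemma J_shift:
  assumes "j \<ge> 1" "i \<ge> 2"
  obtains u where "coprime u (L j)" "[J (j + i) = u\<^sup>2 * J i] (mod L j)"
proof -
  define k where "k = i - 2"
  have k: "i = Suc (Suc k)" using assms by (simp add: k_def)
  define u where "u = lam j ^ (2 ^ k)"
  have u: "lam j ^ (2 ^ Suc k) = u\<^sup>2" by (simp add: u_def mult.commute flip: power_mult)
  have 1: "[L (j + i) = u\<^sup>2 * L i] (mod L j)"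
    using L_shift_mod[OF assms(1), of "Suc k"] unfolding k u by simp
  have "[L (j + i - 1) = u * L (i - 1)] (mod L j)"
    using L_shift_mod[OF assms(1), of k] unfolding k u_def by simp
  then have 2: "[(L (j + i - 1))\<^sup>2 = u\<^sup>2 * (L (i - 1))\<^sup>2] (mod L j)"
    using cong_pow[of _ _ _ 2] by (fastforce simp: power_mult_distrib)
  have "[J (j + i) = int m * (u\<^sup>2 * L i) + \<sigma> * (c * (u\<^sup>2 * (L (i - 1))\<^sup>2))] (mod L j)"
    unfolding J_def by (intro cong_add cong_mult cong_refl 1 2)
  moreover have "int m * (u\<^sup>2 * L i) + \<sigma> * (c * (u\<^sup>2 * (L (i - 1))\<^sup>2)) = u\<^sup>2 * J i"
    by (simp add: J_def distrib_left mult_ac)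
  moreover have "coprime u (L j)" unfolding u_def by (rule coprime_lam_power[OF assms(1)])
  ultimately show ?thesis using that by simp
qed

lemma chi_reduce_left:
  assumes "j \<ge> 3" "i \<ge> 2"
  shows "chi (j + i) j = chi i j"
proof -
  have o: "odd (ell j)" using odd_ell assms by simp
  have "j \<ge> 1" using assms by simp
  then obtain u where u: "coprime u (L j)" "[J (j + i) = u\<^sup>2 * J i] (mod L j)"
    using J_shift assms(2) by blast
  have cu: "coprime u (int (ell j))" using u(1) by (simp add: coprime_ell_iff)
  show ?thesis
  proof (cases "even j")
    case True
    define e where "e = (if even i then \<sigma> else -1)"
    have "\<bar>J (j + i)\<bar> = e * J (j + i)" "\<bar>J i\<bar> = e * J i"
      using J_sign[of "j + i"] J_sign[of i] assms True by (auto simp: e_def)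
    moreover have "[e * J (j + i) = u\<^sup>2 * (e * J i)] (mod L j)"
      using cong_mult[OF cong_refl[of e] u(2)] by (simp only: mult_ac)
    ultimately have "jacobi \<bar>J (j + i)\<bar> (ell j) = jacobi (u\<^sup>2 * \<bar>J i\<bar>) (ell j)"
      by (intro jacobi_cong) (simp only: cong_ell_iff)
    then show ?thesis using jacobi_mult_square[OF o cu] by (simp add: chi_def)
  next
    case False
    have "jacobi (J (j + i)) (ell j) = jacobi (u\<^sup>2 * J i) (ell j)"
      using u(2) by (intro jacobi_cong) (simp only: cong_ell_iff)
    then show ?thesis
      using jacobi_mult_square[OF o cu] jacobi_abs_ell_odd[OF False assms(1)] by (simp add: chi_def)
  qed
qed

lemma chi_reduce_left_mult:
  assumes "j \<ge> 3" "i \<ge> 2"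
  shows "chi (k * j + i) j = chi i j"
proof (induction k)
  case (Suc k)
  have "chi (j + (k * j + i)) j = chi (k * j + i) j" using assms by (intro chi_reduce_left) auto
  then show ?case using Suc by (simp add: add_ac)
qed simp

lemma chi_cong_left:
  assumes "j \<ge> 3" "a \<ge> 2" "b \<ge> 2" "[a = b] (mod j)"
  shows "chi a j = chi b j"
proof -
  have *: "chi a j = chi b j" if "a \<ge> 2" "b \<ge> 2" "[a = b] (mod j)" "a \<le> b" for a b
  proof -
    have "j dvd b - a" using cong_sym[OF that(3)] that(4) by (simp only: cong_altdef_nat)
    then have "b - a = ((b - a) div j) * j" by simp
    then have "b = ((b - a) div j) * j + a" using that(4) by simp
    then show ?thesis using chi_reduce_left_mult[OF assms(1) that(1), of "(b - a) div j"] by simp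
  qed
  show ?thesis using *[of a b] *[of b a] assms by (metis cong_sym nat_le_linear)
qed

text \<open>
  The case of difference 1 is not covered by J_shift, since L_0 = 0 has lost its weight: here J is -
  2m times a square modulo L_j, and L_j is -1 modulo m.
\<close>

lemma chi_reduce_left_1:
  assumes "j \<ge> 3"
  shows "chi (j + 1) j = 1"
proof -
  have o: "odd (ell j)" using odd_ell assms by simp
  define s where "s = c * (L (j - 1))\<^sup>2"
  have "Suc (j - 1) = j" using assms by simp
  then have "coprime s (L j)"
    unfolding s_def using coprime_c_L[of j] coprime_consecutive[of "j - 1"] assms by simp
  then have cs: "coprime s (int (ell j))" by (simp add: coprime_ell_iff)
  have "[J (j + 1) = int m * (lam j * 1) + \<sigma> * (c * 0)] (mod L j)"
  proof -
    have "[L (j + 1) = lam j * 1] (mod L j)" using L_shift_mod[of j 0] assms by simp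
    moreover have "[(L (j + 1 - 1))\<^sup>2 = 0] (mod L j)" by (simp add: cong_0_iff power2_eq_square)
    ultimately show ?thesis unfolding J_def by (intro cong_add cong_mult cong_refl)
  qed
  also have "int m * (lam j * 1) + \<sigma> * (c * 0) = - (s\<^sup>2 * (2 * int m))"
    by (simp add: lam_def s_def power_mult_distrib flip: power_mult)
  finally have *: "[J (j + 1) = - (s\<^sup>2 * (2 * int m))] (mod L j)" .
  have "chi (j + 1) j = jacobi (s\<^sup>2 * (2 * int m)) (ell j)"
  proof (cases "even j")
    case True
    have "\<bar>J (j + 1)\<bar> = - J (j + 1)" using J_sign[of "j + 1"] True assms by simp
    moreover have "[- J (j + 1) = s\<^sup>2 * (2 * int m)] (mod L j)"
      using * cong_minus_minus_iff[of "J (j+1)" "- (s\<^sup>2 * (2 * int m))" "L j"] by simp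
    ultimately show ?thesis unfolding chi_def
      by (intro jacobi_cong) (simp only: cong_ell_iff)
  next
    case False
    have "jacobi (J (j + 1)) (ell j) = jacobi (- (s\<^sup>2 * (2 * int m))) (ell j)"
      using * by (intro jacobi_cong) (simp only: cong_ell_iff)
    also have "\<dots> = jacobi (s\<^sup>2 * (2 * int m)) (ell j)"
      using jacobi_mult_left[OF o, of "-1" "s\<^sup>2 * (2 * int m)"] jacobi_minus_one_ell[OF assms] False by simp
    finally show ?thesis using jacobi_abs_ell_odd[OF False assms] by (simp add: chi_def)
  qed
  also have "\<dots> = jacobi (int (2 * m)) (ell j)" using jacobi_mult_square[OF o cs] by simp
  also have "\<dots> = 1"
  proof -
    obtain i y where y: "m = 2 ^ i * y" "odd y" using ex_odd_part[of m] m_ge_2 by auto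
    have "2 * m = 2 ^ Suc i * y" using y by simp
    then have "jacobi (int (2 * m)) (ell j) = jacobi (- L j) y" by (rule jacobi_ell_flip[OF assms _ y(2)])
    also have "\<dots> = jacobi 1 y"
    proof (rule jacobi_cong)
      have "[- L j = - (-1)] (mod int m)" using L_mod_m[OF assms] by (simp only: cong_minus_minus_iff)
      then have "[- L j = 1] (mod int m)" by simp
      moreover have "int y dvd int m" by (simp add: y(1))
      ultimately show "[- L j = 1] (mod int y)" by (rule cong_dvd_modulus)
    qed
    also have "\<dots> = 1" using y(2) by (simp add: odd_pos)
    finally show ?thesis .
  qed
  finally show ?thesis .
qed

definition \<kappa> :: int where "\<kappa> = jacobi (-1) (nat c)"

lemma int_nat_c: "int (nat c) = c" using c_gt_1 by simp
lemma odd_nat_c: "odd (nat c)" using odd_c c_gt_1 by (simp add: even_nat_iff)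

lemma chi_self:
  assumes "j \<ge> 3"
  shows "chi j j = \<kappa>"
proof -
  have o: "odd (ell j)" using odd_ell assms by simp
  define s where "s = L (j - 1)"
  have "Suc (j - 1) = j" using assms by simp
  then have "coprime s (L j)" unfolding s_def using coprime_consecutive[of "j - 1"] by simp
  then have cs: "coprime s (int (ell j))" by (simp add: coprime_ell_iff)
  have "J j - \<sigma> * (s\<^sup>2 * c) = int m * L j" by (simp add: J_def s_def mult_ac)
  then have *: "[J j = \<sigma> * (s\<^sup>2 * c)] (mod L j)" by (simp add: cong_iff_dvd_diff)
  have "chi j j = jacobi (s\<^sup>2 * c) (ell j)"
  proof (cases "even j")
    case True
    have "\<bar>J j\<bar> = \<sigma> * J j" using J_sign[of j] True assms by simp
    moreover have "[\<sigma> * J j = \<sigma> * (\<sigma> * (s\<^sup>2 * c))] (mod L j)" by (rule cong_mult[OF cong_refl *])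
    then have "[\<sigma> * J j = s\<^sup>2 * c] (mod L j)" by (simp add: mult.assoc[symmetric])
    ultimately show ?thesis unfolding chi_def
      by (intro jacobi_cong) (simp only: cong_ell_iff)
  next
    case False
    have "jacobi (J j) (ell j) = jacobi (\<sigma> * (s\<^sup>2 * c)) (ell j)"
      using * by (intro jacobi_cong) (simp only: cong_ell_iff)
    also have "\<dots> = jacobi (s\<^sup>2 * c) (ell j)"
      using jacobi_mult_left[OF o, of "\<sigma>" "s\<^sup>2 * c"] jacobi_minus_one_ell[OF assms] False
        sigma_cases o odd_pos by auto
    finally show ?thesis using jacobi_abs_ell_odd[OF False assms] by (simp add: chi_def)
  qed
  also have "\<dots> = jacobi (int (nat c)) (ell j)" using jacobi_mult_square[OF o cs] int_nat_c by simp
  also have "\<dots> = jacobi (- L j) (nat c)" by (rule jacobi_ell_flip[OF assms, of _ 0]) (simp_all add: odd_nat_c)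
  also have "\<dots> = \<kappa>" unfolding \<kappa>_def
  proof (rule jacobi_cong)
    show "[- L j = - 1] (mod int (nat c))"
      using L_cong_1_mod_c[of j] assms by (simp only: int_nat_c cong_minus_minus_iff)
  qed
  finally show ?thesis .
qed

section \<open>Reducing the second index\<close>

lemma jacobi_2_c: "jacobi 2 (nat c) = 1"
proof (rule jacobi_2_eq_1I[OF odd_nat_c])
  have "[2 * (int m)\<^sup>2 = 1] (mod c)" by (simp add: c_def cong_iff_dvd_diff)
  then have "jacobi (2 * (int m)\<^sup>2) (nat c) = jacobi 1 (nat c)"
    by (intro jacobi_cong) (simp only: int_nat_c)
  also have "\<dots> = 1" using odd_nat_c c_gt_1 by (intro jacobi_1_left) simp_all
  finally show "jacobi (2 * (int m)\<^sup>2) (nat c) = 1" .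
qed

lemma nat_c_mod_8: "nat c mod 8 = (if even m then 7 else 1)"
proof (cases "even m")
  case True
  then obtain k where "m = 2 * k" by (auto elim: evenE)
  then have "(int m)\<^sup>2 = 4 * (int k)\<^sup>2" by (simp add: power_mult_distrib)
  then have "c mod 8 = 7" unfolding c_def by presburger
  then have "int (nat c) mod 8 = 7" by (simp only: int_nat_c)
  then show ?thesis using True mod_8_facts(1) by simp
next
  case False
  then have "[(int m)\<^sup>2 = 1] (mod 8)" by (intro odd_square_mod_8) simp
  then have "[2 * (int m)\<^sup>2 - 1 = 2 * 1 - 1] (mod 8)" by (intro cong_diff cong_mult cong_refl)
  then have "c mod 8 = 1" by (simp add: c_def cong_def)
  then have "int (nat c) mod 8 = 1" by (simp only: int_nat_c)
  then show ?thesis using False mod_8_facts(2) by simp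
qed

text \<open>
  Since c is -1 modulo m, reciprocity turns the symbol into (-1/t) for the odd part t of m, up to
  the reciprocity sign. For odd m one has m = 3 modulo 4, and this is the source of the value -1.
\<close>

lemma jacobi_m_c: "jacobi (int m) (nat c) = (if even m then 1 else -1)"
proof -
  obtain i t where t: "m = 2 ^ i * t" "odd t" using ex_odd_part[of m] m_ge_2 by auto
  have c_t: "jacobi c t = jacobi (-1) t"
  proof (rule jacobi_cong)
    have "int t dvd int m" by (simp add: t(1))
    then show "[c = -1] (mod int t)" by (rule cong_dvd_modulus[OF c_mod_m])
  qed
  have "jacobi (int m) (nat c) = jacobi (2 ^ i) (nat c) * jacobi (int t) (nat c)"
    using jacobi_mult_left[OF odd_nat_c, of "2 ^ i" "int t"] by (simp add: t(1))
  also have "jacobi (2 ^ i) (nat c) = 1" by (rule jacobi_power_eq_1[OF odd_nat_c jacobi_2_c])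
  also have "jacobi (int t) (nat c) =
      (if t mod 4 = 3 \<and> nat c mod 4 = 3 then -1 else 1) * jacobi (-1) t"
    using jacobi_reciprocity[OF t(2) odd_nat_c] c_t by (simp only: int_nat_c)
  finally have *: "jacobi (int m) (nat c) =
      (if t mod 4 = 3 \<and> nat c mod 4 = 3 then -1 else 1) * (if t mod 4 = 3 then -1 else 1)"
    using jacobi_minus_one[OF t(2)] by simp
  show ?thesis
  proof (cases "even m")
    case True
    then have "nat c mod 8 = 7" using nat_c_mod_8 by simp
    then have "nat c mod 4 = 3" by (rule mod_8_facts)
    then show ?thesis using * True by simp
  next
    case False
    then have "i = 0" using t(1) by (cases i) auto
    then have "t mod 4 = 3" using t(1) m_mod_4 False by simp presburger
    moreover have "nat c mod 8 = 1" using nat_c_mod_8 False by simp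
    then have "nat c mod 4 = 1" by (rule mod_8_facts)
    ultimately show ?thesis using * False by simp
  qed
qed

lemma jacobi_J_c:
  assumes "a \<ge> 1"
  shows "jacobi (J a) (nat c) = (if even m then 1 else -1)"
proof -
  have "[int m * L a + \<sigma> * (c * (L (a - 1))\<^sup>2) = int m * 1 + \<sigma> * (0 * (L (a - 1))\<^sup>2)] (mod c)"
    using L_cong_1_mod_c[OF assms] by (intro cong_add cong_mult cong_refl) (simp_all add: cong_def)
  then have "[J a = int m] (mod int (nat c))" by (simp add: J_def int_nat_c del: int_nat_eq)
  then show ?thesis using jacobi_cong jacobi_m_c by metis
qed

text \<open>
  As 2 is a square modulo c, this is by reciprocity the symbol of \<plusminus> J_a over c up to
  sign, and J_a is m modulo c. If m is odd, c is 1 modulo 8 so no signs arise and the value is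
  (m/c) = -1. If m is even, (m/c) = 1 and c is 3 modulo 4, while \<sigma> has been chosen so that
  J_a is 3 modulo 4; then either the reciprocity sign or (-1/c) contributes -1.
\<close>

lemma jacobi_c_J:
  assumes "a \<ge> 2" "nat \<bar>J a\<bar> = 2 ^ i * y" "odd y"
  shows "jacobi c y = -1"
proof -
  have rec: "jacobi c y = (if nat c mod 4 = 3 \<and> y mod 4 = 3 then -1 else 1) * jacobi (int y) (nat c)"
    using jacobi_reciprocity[OF odd_nat_c assms(3)] by (simp only: int_nat_c)
  have "jacobi \<bar>J a\<bar> (nat c) = jacobi (2 ^ i) (nat c) * jacobi (int y) (nat c)"
  proof -
    have "\<bar>J a\<bar> = 2 ^ i * int y" using arg_cong[OF assms(2), of int] by simp
    then show ?thesis using jacobi_mult_left[OF odd_nat_c, of "2 ^ i" "int y"] by simp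
  qed
  also have "jacobi (2 ^ i) (nat c) = 1" by (rule jacobi_power_eq_1[OF odd_nat_c jacobi_2_c])
  finally have y: "jacobi (int y) (nat c) = jacobi \<bar>J a\<bar> (nat c)" by simp
  have abs: "jacobi \<bar>J a\<bar> (nat c) = (if J a < 0 then jacobi (-1) (nat c) else 1) * jacobi (J a) (nat c)"
    using jacobi_mult_left[OF odd_nat_c, of "-1" "J a"] by simp
  have J_c: "jacobi (J a) (nat c) = (if even m then 1 else -1)" using jacobi_J_c assms(1) by simp
  show ?thesis
  proof (cases "even m")
    case False
    then have "nat c mod 8 = 1" using nat_c_mod_8 by simp
    then have "nat c mod 4 = 1" by (rule mod_8_facts)
    then show ?thesis using rec y abs J_c False jacobi_minus_one[OF odd_nat_c] by simp
  next
    case True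
    then have "nat c mod 8 = 7" using nat_c_mod_8 by simp
    then have c4: "nat c mod 4 = 3" by (rule mod_8_facts)
    have sq: "[(L (a - 1))\<^sup>2 = 1] (mod 4)"
      by (rule cong_dvd_modulus[OF odd_square_mod_8[OF odd_L]]) (use assms(1) in auto)
    have "[c = -1] (mod 4)" using cong_int_mod_4[OF c4] by (simp only: int_nat_c)
    then have "[\<sigma> * (c * (L (a - 1))\<^sup>2) = \<sigma> * (-1 * 1)] (mod 4)"
      using sq by (intro cong_mult cong_refl)
    moreover have "[int m * L a = int m] (mod 4)"
    proof -
      have "2 dvd int m" "2 dvd L a - 1" using True odd_L[of a] assms(1) by auto
      then have "2 * 2 dvd int m * (L a - 1)" by (rule mult_dvd_mono)
      then show ?thesis by (simp add: cong_iff_dvd_diff right_diff_distrib)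
    qed
    ultimately have "[J a = int m + \<sigma> * (-1 * 1)] (mod 4)" unfolding J_def by (rule cong_add[rotated])
    moreover have "(int m - \<sigma>) mod 4 = 3"
      using True m_mod_4 unfolding \<sigma>_def by (cases "m mod 4 = 2") (simp; presburger)+
    ultimately have J4: "J a mod 4 = 3" by (simp add: cong_def)
    then have "odd \<bar>J a\<bar>" by presburger
    then have "odd (nat \<bar>J a\<bar>)" by (simp add: even_nat_iff)
    then have "i = 0" using assms(2) by (cases i) auto
    then have y': "int y = \<bar>J a\<bar>" using arg_cong[OF assms(2), of int] by simp
    show ?thesis
    proof (cases "J a < 0")
      case True
      then have "int y mod 4 = 1" using y' J4 by presburger
      then have "y mod 4 = 1" by presburger
      then show ?thesis using rec y abs J_c \<open>even m\<close> True c4 jacobi_minus_one[OF odd_nat_c] by simp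
    next
      case False
      then have "int y mod 4 = 3" using y' J4 by presburger
      then have "y mod 4 = 3" by presburger
      then show ?thesis using rec y abs J_c \<open>even m\<close> False c4 by simp
    qed
  qed
qed

text \<open>
  The return of the orbit modulo J_a in integral form. The two exceptional steps are the points -c
  and -1; from then on the values agree with those of the original orbit, since only squares of
  the previous values enter.
\<close>

lemma L_mod_J:
  assumes "a \<ge> 2"
  defines "w \<equiv> c * (L (a - 1))\<^sup>2"
  shows "[((int m)\<^sup>2) ^ (2 ^ n) * L (a + Suc n) =
          (w\<^sup>2 * c) ^ (2 ^ n) * (if n < 2 then -1 else L (Suc n))] (mod J a)"
proof -
  have sq: "\<sigma>\<^sup>2 = 1" by (simp add: power2_eq_square)
  have "[int m * L a = - (\<sigma> * w)] (mod J a)"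
    by (simp add: cong_iff_dvd_diff J_def w_def)
  then have "[(int m * L a)\<^sup>2 = (- (\<sigma> * w))\<^sup>2] (mod J a)" by (rule cong_pow)
  then have 0: "[(int m)\<^sup>2 * (L a)\<^sup>2 = w\<^sup>2] (mod J a)" by (simp add: power_mult_distrib sq)
  have L1: "L (a + 1) = (L a)\<^sup>2 - 2 * w\<^sup>2"
    using crit_rec[of a c] assms(1) by (simp add: w_def power_mult_distrib flip: power_mult)
  have "[(int m)\<^sup>2 * (L a)\<^sup>2 - (int m)\<^sup>2 * (2 * w\<^sup>2) = w\<^sup>2 - (int m)\<^sup>2 * (2 * w\<^sup>2)] (mod J a)"
    by (rule cong_diff[OF 0 cong_refl])
  moreover have "w\<^sup>2 - (int m)\<^sup>2 * (2 * w\<^sup>2) = - (w\<^sup>2 * c)" by (simp add: c_def algebra_simps)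
  ultimately have 1: "[(int m)\<^sup>2 * L (a + 1) = - (w\<^sup>2 * c)] (mod J a)"
    unfolding L1 by (simp only: right_diff_distrib)
  have L2: "L (a + 2) = (L (a + 1))\<^sup>2 - 2 * c\<^sup>2 * ((L a)\<^sup>2)\<^sup>2" by (simp flip: power_mult)
  have "[((int m)\<^sup>2 * L (a + 1))\<^sup>2 - 2 * c\<^sup>2 * ((int m)\<^sup>2 * (L a)\<^sup>2)\<^sup>2
      = (- (w\<^sup>2 * c))\<^sup>2 - 2 * c\<^sup>2 * (w\<^sup>2)\<^sup>2] (mod J a)"
    by (rule cong_diff[OF cong_pow[OF 1] cong_mult[OF cong_refl cong_pow[OF 0]]])
  moreover have "((int m)\<^sup>2 * L (a + 1))\<^sup>2 - 2 * c\<^sup>2 * ((int m)\<^sup>2 * (L a)\<^sup>2)\<^sup>2 = ((int m)\<^sup>2)\<^sup>2 * L (a + 2)"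
    unfolding L2 by (simp add: power_mult_distrib right_diff_distrib mult_ac flip: power_mult)
  moreover have "(- (w\<^sup>2 * c))\<^sup>2 - 2 * c\<^sup>2 * (w\<^sup>2)\<^sup>2 = - ((w\<^sup>2 * c)\<^sup>2)"
    by (simp add: power_mult_distrib)
  ultimately have 2: "[((int m)\<^sup>2)\<^sup>2 * L (a + 2) = - ((w\<^sup>2 * c)\<^sup>2)] (mod J a)" by (simp only:)
  define h where "h n = (if n < 2 then -1 else L (Suc n))" for n
  have h: "h (Suc (Suc n)) = (h (Suc n))\<^sup>2 - 2 * c\<^sup>2 * h n ^ 4" for n
  proof -
    consider "n = 0" | "n = 1" | "n \<ge> 2" by linarith
    then show ?thesis by cases (simp_all add: h_def)
  qed
  have "[((int m)\<^sup>2) ^ (2 ^ n) * L (a + Suc n) = (w\<^sup>2 * c) ^ (2 ^ n) * h n] (mod J a)"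
  proof (induction n rule: induct_nat_012)
    case 0
    then show ?case using 1 by (simp add: h_def)
  next
    case 1
    then show ?case using 2 by (simp add: h_def numeral_2_eq_2)
  next
    case (ge2 n)
    define u where "u = ((int m)\<^sup>2) ^ (2 ^ n)"
    define v where "v = (w\<^sup>2 * c) ^ (2 ^ n)"
    have e: "x ^ (2 ^ Suc n) = (x ^ (2 ^ n))\<^sup>2" "x ^ (2 ^ Suc (Suc n)) = (x ^ (2 ^ n)) ^ 4" for x :: int
      by (simp_all add: mult.commute flip: power_mult)
    have i0: "[u * L (a + Suc n) = v * h n] (mod J a)" using ge2(1) by (simp only: u_def v_def)
    have i1: "[u\<^sup>2 * L (a + Suc (Suc n)) = v\<^sup>2 * h (Suc n)] (mod J a)" using ge2(2) by (simp only: e u_def v_def)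
    have "[(u\<^sup>2 * L (a + Suc (Suc n)))\<^sup>2 - 2 * c\<^sup>2 * (u * L (a + Suc n)) ^ 4
        = (v\<^sup>2 * h (Suc n))\<^sup>2 - 2 * c\<^sup>2 * (v * h n) ^ 4] (mod J a)"
      by (rule cong_diff[OF cong_pow[OF i1] cong_mult[OF cong_refl cong_pow[OF i0]]])
    moreover have "(z\<^sup>2 * x)\<^sup>2 - 2 * c\<^sup>2 * (z * y) ^ 4 = z ^ 4 * (x\<^sup>2 - 2 * c\<^sup>2 * y ^ 4)" for x y z
      by (simp add: power_mult_distrib right_diff_distrib flip: power_mult)
    moreover have "L (a + Suc (Suc (Suc n))) = (L (a + Suc (Suc n)))\<^sup>2 - 2 * c\<^sup>2 * L (a + Suc n) ^ 4" by simp
    ultimately show ?case by (simp only: e u_def v_def h)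
  qed
  then show ?thesis by (simp only: h_def)
qed

text \<open>
  Reciprocity for the symbol chi with the odd part y of |J_a| made explicit, so that congruences
  modulo J_a can be used on the other side.
\<close>

lemma chi_flip:
  assumes "a \<ge> 2"
  obtains i y where "nat \<bar>J a\<bar> = 2 ^ i * y" "odd y" "int y dvd J a"
    "\<And>x. coprime x (J a) \<Longrightarrow> coprime x (int y)" "\<And>j. j \<ge> 3 \<Longrightarrow> chi a j = jacobi (- L j) y"
proof -
  obtain i y where y: "nat \<bar>J a\<bar> = 2 ^ i * y" "odd y"
    using ex_odd_part[of "nat \<bar>J a\<bar>"] J_nonzero[OF assms] by auto
  have "int y dvd int (nat \<bar>J a\<bar>)" by (simp only: y(1) of_nat_mult dvd_triv_right)
  then have d: "int y dvd J a" by simp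
  moreover have "coprime x (int y)" if "coprime x (J a)" for x
    using that d by (meson coprime_divisors dvd_refl)
  moreover have "chi a j = jacobi (- L j) y" if "j \<ge> 3" for j
    using jacobi_ell_flip[OF that y] by (simp add: chi_def)
  ultimately show ?thesis using that[of i y] y by blast
qed

text \<open>
  The values at a + 1 and a + 2 come from the two exceptional points: - L_(a+1) is c times a square
  modulo J_a, and - L_(a+2) is a square.
\<close>

lemma chi_reduce_right:
  assumes "a \<ge> 2"
  shows "chi a (a + 1) = -1" "chi a (a + 2) = 1" "b \<ge> 3 \<Longrightarrow> chi a (a + b) = chi a b"
proof -
  from chi_flip[OF assms] obtain i y where y: "nat \<bar>J a\<bar> = 2 ^ i * y" "odd y" "int y dvd J a"
    and cop: "\<And>x. coprime x (J a) \<Longrightarrow> coprime x (int y)"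
    and chi: "\<And>j. j \<ge> 3 \<Longrightarrow> chi a j = jacobi (- L j) y" by blast
  define w where "w = c * (L (a - 1))\<^sup>2"
  note cJ = coprime_J[OF assms, THEN cop]
  have cm: "coprime (int m ^ k) (int y)" for k using cJ(1) by simp
  have cw: "coprime w (int y)" "coprime (w\<^sup>2 * c) (int y)" using cJ(2,3) by (auto simp: w_def)
  have L: "[((int m)\<^sup>2) ^ (2 ^ n) * L (a + Suc n) = (w\<^sup>2 * c) ^ (2 ^ n) * (if n < 2 then -1 else L (Suc n))] (mod int y)" for n
    unfolding w_def by (rule cong_dvd_modulus[OF L_mod_J[OF assms] y(3)])
  have neg: "[x * - z = y * - t] (mod n)" if "[x * z = y * t] (mod n)" for x y z t n :: int
    using that by (simp add: cong_minus_minus_iff)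
  have "[(int m)\<^sup>2 * - L (a + 1) = w\<^sup>2 * c] (mod int y)"
    using neg[OF L[of 0]] by simp
  then have "jacobi (- L (a + 1)) y = jacobi c y"
    by (rule jacobi_cancel_square[OF y(2) cJ(1) cw(1)])
  then show "chi a (a + 1) = -1" using chi assms jacobi_c_J[OF assms y(1,2)] by simp
  have "[((int m)\<^sup>2)\<^sup>2 * - L (a + 2) = (w\<^sup>2 * c)\<^sup>2 * 1] (mod int y)"
    using neg[OF L[of 1]] by (simp add: numeral_2_eq_2)
  then have "jacobi (- L (a + 2)) y = jacobi 1 y"
    by (rule jacobi_cancel_square[OF y(2) cm cw(2)])
  then show "chi a (a + 2) = 1" using chi[of "a + 2"] assms y(2) by (simp add: odd_pos del: crit.simps)
  assume b: "b \<ge> 3"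
  define n where "n = b - 1"
  have n: "n \<ge> 2" "b = Suc n" using b by (auto simp: n_def)
  have e: "x ^ (2 ^ n) = (x ^ (2 ^ (n - 1)))\<^sup>2" for x :: int
    using n(1) by (cases n) (simp_all add: mult.commute flip: power_mult)
  have "[(((int m)\<^sup>2) ^ (2 ^ (n - 1)))\<^sup>2 * - L (a + b) = ((w\<^sup>2 * c) ^ (2 ^ (n - 1)))\<^sup>2 * - L b] (mod int y)"
    using neg[OF L[of n]] n by (simp only: e) simp
  then have "jacobi (- L (a + b)) y = jacobi (- L b) y"
    by (rule jacobi_cancel_square[OF y(2), rotated 2]) (use cJ(1) cw in simp_all)
  then show "chi a (a + b) = chi a b" using chi b by simp
qed

text \<open>
  The Euclidean algorithm with the gcd at least 2: it never reaches a difference of 1, so it ends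
  with equal indices or with a pair (a, a + 2).
\<close>

lemma chi_gcd:
  assumes "a \<ge> 2" "j \<ge> 3" "gcd a j \<ge> 2"
  shows "chi a j = (if gcd a j = 2 then 1 else \<kappa>)"
  using assms
proof (induction "a + j" arbitrary: a j rule: less_induct)
  case less
  consider "j = a" | "a < j" | "j < a" by linarith
  then show ?case
  proof cases
    case 1
    then show ?thesis using chi_self[of j] less.prems by simp
  next
    case 2
    define b where "b = j - a"
    have j: "j = a + b" "b \<ge> 1" using 2 by (auto simp: b_def)
    have g: "gcd a j = gcd a b" unfolding j(1) by (metis add.commute gcd_add2)
    then have "b \<noteq> 1" using less.prems(3) by auto
    show ?thesis
    proof (cases "b = 2")
      case True
      then have "gcd a j \<le> 2" using g by (simp add: gcd_le2_nat)
      then show ?thesis using True j chi_reduce_right(2)[OF less.prems(1)] less.prems(3) by simp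
    next
      case False
      then have b: "b \<ge> 3" using \<open>b \<noteq> 1\<close> j(2) by simp
      have "chi a b = (if gcd a b = 2 then 1 else \<kappa>)"
        by (rule less.hyps) (use b less.prems g j in auto)
      then show ?thesis using chi_reduce_right(3)[OF less.prems(1) b] g j(1) by simp
    qed
  next
    case 3
    define b where "b = a - j"
    have a: "a = j + b" "b \<ge> 1" using 3 by (auto simp: b_def)
    have g: "gcd a j = gcd b j" unfolding a(1) by (metis add.commute gcd_add1)
    then have "b \<noteq> 1" using less.prems(3) by auto
    then have b: "b \<ge> 2" using a(2) by simp
    have "chi b j = (if gcd b j = 2 then 1 else \<kappa>)"
      by (rule less.hyps) (use b less.prems g a in auto)
    then show ?thesis using chi_reduce_left[OF less.prems(2) b] g a(1) by simp
  qed
qed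

text \<open>
  This value and that of the next lemma both belong to first indices congruent to -(n + 1); they are
  the input for the second indices n and g n that arise from numbers N with cofactor N / rad N =
  n.
\<close>

lemma chi_first_factor: "n \<ge> 3 \<Longrightarrow> chi (n - 1) n = -1"
  using chi_reduce_right(1)[of "n - 1"] by simp

lemma chi_other_factor:
  assumes "n \<ge> 3" "g dvd n" "g \<ge> 2"
  shows "chi (g * n - n - 1) (g * n) = 1"
proof (cases "g = 2")
  case True
  have "chi (n - 1) ((n - 1) + (n + 1)) = chi (n - 1) (n + 1)"
    using assms by (intro chi_reduce_right(3)) auto
  also have "\<dots> = 1" using chi_reduce_right(2)[of "n - 1"] assms by simp
  finally show ?thesis using True assms(1) by (simp add: mult_2)
next
  case False
  then have g: "g \<ge> 3" "g \<le> n" using assms by (auto intro: dvd_imp_le)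
  \<comment> \<open>With n = g + l, the pair of indices passes to (a, n + 1) and then, unless l = 0, to (l + 1,
    n + 1), to (l + 1, g) and to (g + 1, g).\<close>
  obtain k where k: "g = k + 3" using g(1) by (metis add.commute le_Suc_ex)
  obtain l where l: "n = g + l" using g(2) le_Suc_ex by blast
  define a where "a = g * n - n - 1"
  have a: "a = (k + 1) * (n + 1) + (l + 1)"
    unfolding a_def k l by (simp add: algebra_simps)
  have "g * n = a + (n + 1)" unfolding a l k by (simp add: algebra_simps)
  moreover have "chi a (a + (n + 1)) = chi a (n + 1)"
    using assms(1) by (intro chi_reduce_right(3)) (auto simp: a)
  moreover have "chi a (n + 1) = 1"
  proof (cases "l = 0")
    case True
    have "a = k * (n + 1) + ((n + 1) + 1)" unfolding a using True by simp
    then have "chi a (n + 1) = chi ((n + 1) + 1) (n + 1)"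
      using assms(1) chi_reduce_left_mult[of "n + 1" "(n + 1) + 1" k] by simp
    also have "\<dots> = 1" using assms(1) by (intro chi_reduce_left_1) simp
    finally show ?thesis .
  next
    case False
    have "chi a (n + 1) = chi (l + 1) (n + 1)"
      unfolding a using False assms(1) by (intro chi_reduce_left_mult) auto
    also have "chi (l + 1) (n + 1) = chi (l + 1) g"
    proof -
      have "n + 1 = (l + 1) + g" using l by simp
      then show ?thesis using chi_reduce_right(3)[of "l + 1" g] False g by simp
    qed
    also have "\<dots> = chi (g + 1) g"
    proof (rule chi_cong_left)
      have "g dvd l" using assms(2) l by (simp add: dvd_add_right_iff)
      then have "[l = g] (mod g)" by (simp add: cong_def)
      then show "[l + 1 = g + 1] (mod g)" by (intro cong_add cong_refl)
    qed (use False g in auto)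
    also have "\<dots> = 1" by (rule chi_reduce_left_1[OF g(1)])
    finally show ?thesis .
  qed
  ultimately have "chi a (g * n) = 1" by (simp only:)
  then show ?thesis by (simp only: a_def)
qed

end

section \<open>Primitive parts are not squares\<close>

lemma prod_primes_dvd_iff:
  assumes "finite T" "\<And>p. p \<in> T \<Longrightarrow> prime (p::nat)" "n > 0"
  shows "\<Prod>T dvd n \<longleftrightarrow> T \<subseteq> prime_factors n"
  using assms(1,2)
proof (induction T rule: finite_induct)
  case (insert p T)
  have "coprime p (\<Prod>T)"
    using insert by (intro prod_coprime_right) (auto intro!: primes_coprime)
  then have "p * \<Prod>T dvd n \<longleftrightarrow> p dvd n \<and> \<Prod>T dvd n"
    by (auto intro: divides_mult dest: dvd_mult_left dvd_mult_right)
  then show ?case using insert assms(3) by (auto simp: in_prime_factors_iff)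
qed simp

text \<open>
  A nonempty finite set has an odd number of nonempty subsets.
\<close>

lemma prod_signs_Pow:
  assumes "finite A" "A \<noteq> {}"
  shows "(\<Prod>T\<in>Pow A. if T = {} then 1 else (-1::int)) = -1"
proof -
  have "(\<Prod>T\<in>Pow A. if T = {} then 1 else (-1::int)) = (\<Prod>T\<in>Pow A - {{}}. if T = {} then 1 else (-1::int))"
    using assms by (subst prod.remove[of _ "{}"]) auto
  also have "\<dots> = (\<Prod>T\<in>Pow A - {{}}. (-1::int))" by (intro prod.cong) auto
  also have "\<dots> = (-1) ^ (2 ^ card A - 1)"
    using assms by (simp add: card_Pow card_Diff_subset)
  also have "odd ((2::nat) ^ card A - 1)" using assms by (simp add: card_gt_0_iff)
  then have "(-1::int) ^ (2 ^ card A - 1) = -1" by simp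
  finally show ?thesis .
qed

lemma prod_Pow_Un:
  fixes f :: "'a set \<Rightarrow> int"
  assumes "finite A" "finite B" "A \<inter> B = {}"
  shows "(\<Prod>T\<in>Pow (A \<union> B). f T) = (\<Prod>V\<in>Pow B. \<Prod>U\<in>Pow A. f (U \<union> V))"
proof -
  have "(\<Prod>V\<in>Pow B. \<Prod>U\<in>Pow A. f (U \<union> V)) = (\<Prod>(V, U)\<in>Pow B \<times> Pow A. f (U \<union> V))"
    using assms by (simp add: prod.cartesian_product)
  also have "\<dots> = (\<Prod>T\<in>Pow (A \<union> B). f T)"
    by (rule prod.reindex_bij_witness[of _ "\<lambda>T. (T \<inter> B, T \<inter> A)" "\<lambda>(V, U). U \<union> V"])
       (use assms in \<open>auto simp: Int_Un_distrib2 Un_commute\<close>)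
  finally show ?thesis by simp
qed

context crit_odd
begin

text \<open>
  Modulo squares this is the Moebius product of the L_(N/d)^\<mu>(d) over the squarefree divisors d
  of N, represented here by sets of primes; all exponents are taken to be 1 so that the product is
  an integer.
\<close>

definition primitive :: "nat \<Rightarrow> int" where
  "primitive N = (\<Prod>T\<in>Pow (prime_factors N). L (N div \<Prod>T))"

lemma div_prod_primes:
  fixes N :: nat
  assumes "N \<ge> 1" "T \<subseteq> prime_factors N"
  shows "\<Prod>T dvd N" "N div \<Prod>T \<ge> 1" "N div \<Prod>T \<le> N"
proof -
  have "finite T" using assms(2) finite_subset by blast
  then show d: "\<Prod>T dvd N" using prod_primes_dvd_iff[of T N] assms by auto
  then have "N = \<Prod>T * (N div \<Prod>T)" by simp
  then show "N div \<Prod>T \<ge> 1" using assms(1) by (metis One_nat_def Suc_leI gr0I mult_0_right not_one_le_zero)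
qed simp

lemma dvd_div_prod_iff:
  fixes N :: nat
  assumes "N \<ge> 1" "T \<subseteq> prime_factors N"
  shows "r dvd N div \<Prod>T \<longleftrightarrow> r dvd N \<and> T \<subseteq> prime_factors (N div r)"
proof -
  have fin: "finite T" and pr: "\<And>p. p \<in> T \<Longrightarrow> prime p"
    using assms(2) finite_subset by auto
  have d: "\<Prod>T dvd N" and pos: "\<Prod>T \<noteq> 0"
    using div_prod_primes[OF assms] assms(1) by auto
  have 1: "r dvd N div \<Prod>T \<longleftrightarrow> r * \<Prod>T dvd N" using dvd_div_iff_mult[OF pos d] .
  show ?thesis
  proof (cases "r dvd N")
    case True
    then have r: "r \<noteq> 0" "N div r > 0" using assms(1) by (auto elim!: dvdE)
    have "r * \<Prod>T dvd N \<longleftrightarrow> \<Prod>T dvd N div r"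
      using dvd_div_iff_mult[OF r(1) True, of "\<Prod>T"] by (simp add: mult.commute)
    then show ?thesis using 1 True prod_primes_dvd_iff[OF fin pr r(2)] by simp
  next
    case False
    then show ?thesis using 1 dvd_mult_left by blast
  qed
qed

lemma primitive_nonzero: "N \<ge> 1 \<Longrightarrow> primitive N \<noteq> 0"
  using div_prod_primes(2)[of N] L_nonzero by (auto simp: primitive_def)

text \<open>
  A prime p of rank d dividing N divides L_(N/d') precisely for the squarefree d' dividing N/d.
  There is an even number of those unless d = N, and they all contribute the same multiplicity.
\<close>

lemma primitive_square:
  assumes N: "N \<ge> 1"
    and even: "\<And>p. prime p \<Longrightarrow> p dvd L N \<Longrightarrow> rank p = N \<Longrightarrow> even (multiplicity p (L N))"
  shows "\<exists>w. \<bar>primitive N\<bar> = w\<^sup>2"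
proof -
  have "even (multiplicity p (primitive N))" if p: "prime p" for p
  proof (cases "p dvd primitive N")
    case False
    then show ?thesis by (simp add: not_dvd_imp_multiplicity_0)
  next
    case True
    then obtain T where T: "T \<subseteq> prime_factors N" "p dvd L (N div \<Prod>T)"
      using p by (auto simp: primitive_def prime_dvd_prod_iff)
    define n where "n = N div \<Prod>T"
    have n: "n \<ge> 1" "p dvd L n" using T div_prod_primes[OF N T(1)] by (auto simp: n_def)
    note rank = rank_dvd_iff[OF p n(2,1)]
    define v where "v = multiplicity p (L (rank p))"
    have "rank p dvd n" using rank n by blast
    then have rN: "rank p dvd N" using dvd_div_prod_iff[OF N T(1)] by (auto simp: n_def)
    have "multiplicity p (primitive N) = (\<Sum>T\<in>Pow (prime_factors N). multiplicity p (L (N div \<Prod>T)))"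
      unfolding primitive_def using p L_nonzero div_prod_primes(2)[OF N]
      by (intro prime_elem_multiplicity_prod_distrib) force+
    also have "\<dots> = (\<Sum>T\<in>Pow (prime_factors N). if T \<subseteq> prime_factors (N div rank p) then v else 0)"
    proof (rule sum.cong[OF refl])
      fix T assume "T \<in> Pow (prime_factors N)"
      then have T: "T \<subseteq> prime_factors N" by simp
      have j: "N div \<Prod>T \<ge> 1" using div_prod_primes(2)[OF N T] .
      have "p dvd L (N div \<Prod>T) \<longleftrightarrow> T \<subseteq> prime_factors (N div rank p)"
        using rank[OF j] dvd_div_prod_iff[OF N T] rN by simp
      then show "multiplicity p (L (N div \<Prod>T)) = (if T \<subseteq> prime_factors (N div rank p) then v else 0)"
        using multiplicity_L[OF p _ j] by (auto simp: v_def not_dvd_imp_multiplicity_0)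
    qed
    also have "\<dots> = v * card {T \<in> Pow (prime_factors N). T \<subseteq> prime_factors (N div rank p)}"
      by (simp add: sum.If_cases Int_def)
    also have "{T \<in> Pow (prime_factors N). T \<subseteq> prime_factors (N div rank p)} = Pow (prime_factors (N div rank p))"
    proof -
      have "N = N div rank p * rank p" using rN by simp
      then have "N div rank p dvd N" by (metis dvd_triv_left)
      then have "prime_factors (N div rank p) \<subseteq> prime_factors N" using N by (intro dvd_prime_factors) auto
      then show ?thesis by blast
    qed
    also have "card \<dots> = 2 ^ card (prime_factors (N div rank p))" by (simp add: card_Pow)
    finally have m: "multiplicity p (primitive N) = v * 2 ^ card (prime_factors (N div rank p))" .
    show ?thesis
    proof (cases "rank p = N")
      case True
      have "p dvd L N" using rank[of N] rN N by simp
      then have "even v" using even[OF p _ True] by (simp add: v_def True)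
      then show ?thesis using m by simp
    next
      case False
      then have "N div rank p \<noteq> 1" using rN by auto
      moreover have "N div rank p \<noteq> 0" using rN N by (auto elim!: dvdE)
      ultimately have "card (prime_factors (N div rank p)) > 0"
        by (simp add: card_gt_0_iff prime_factorization_empty_iff)
      then show ?thesis using m by simp
    qed
  qed
  then have "is_nth_power 2 (normalize (primitive N))"
    using is_nth_power_conv_multiplicity[of 2 "primitive N"] by simp
  then show ?thesis by (auto elim!: is_nth_powerE)
qed

text \<open>
  A prime of rank N divides no earlier term and is odd, so it must occur in L_N to an even power.
\<close>

lemma primitive_square_of_relation:
  assumes "N \<ge> 1" "finite I" "\<And>i. i \<in> I \<Longrightarrow> 1 \<le> g i \<and> g i < N"
    and "2 ^ e * L N * (\<Prod>i\<in>I. L (g i)) = y\<^sup>2"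
  shows "\<exists>w. \<bar>primitive N\<bar> = w\<^sup>2"
proof (rule primitive_square[OF assms(1)])
  fix p :: int assume p: "prime p" "p dvd L N" "rank p = N"
  have "\<not> p dvd 2"
  proof
    assume "p dvd 2"
    then have "p \<le> 2" by (rule zdvd_imp_le) simp
    then have "p = 2" using prime_ge_2_int[OF p(1)] by simp
    then show False using p(2) odd_L[OF assms(1)] by simp
  qed
  then have "\<not> p dvd 2 ^ e" using p(1) prime_dvd_power by blast
  moreover have "\<not> p dvd L (g i)" if "i \<in> I" for i
    using rank_dvd_iff[OF p(1,2) assms(1), of "g i"] assms(3)[OF that] p(3) by (auto dest: dvd_imp_le)
  then have "\<not> p dvd (\<Prod>i\<in>I. L (g i))" using p(1) assms(2) by (simp add: prime_dvd_prod_iff)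
  moreover have nz: "(\<Prod>i\<in>I. L (g i)) \<noteq> 0" using L_nonzero assms(2,3) by auto
  ultimately have "multiplicity p (2 ^ e * L N * (\<Prod>i\<in>I. L (g i))) = multiplicity p (L N)"
    using L_nonzero[OF assms(1)]
      prime_elem_multiplicity_mult_distrib[OF prime_imp_prime_elem[OF p(1)], of "2 ^ e * L N" "\<Prod>i\<in>I. L (g i)"]
      prime_elem_multiplicity_mult_distrib[OF prime_imp_prime_elem[OF p(1)], of "2 ^ e" "L N"]
    by (simp add: not_dvd_imp_multiplicity_0 del: crit.simps)
  moreover have "y \<noteq> 0" using assms(4) nz L_nonzero[OF assms(1)] by auto
  then have "multiplicity p (y\<^sup>2) = 2 * multiplicity p y"
    using prime_elem_multiplicity_power_distrib[OF prime_imp_prime_elem[OF p(1)]] by simp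
  ultimately have "multiplicity p (L N) = 2 * multiplicity p y" using assms(4) by simp
  then show "even (multiplicity p (L N))" by simp
qed

end

context arboreal
begin

lemma nat_abs_primitive: "nat \<bar>primitive N\<bar> = (\<Prod>T\<in>Pow (prime_factors N). ell (N div \<Prod>T))"
proof -
  have "nat \<bar>\<Prod>T\<in>A. f T\<bar> = (\<Prod>T\<in>A. nat \<bar>f T\<bar>)" for A and f :: "'b \<Rightarrow> int"
    by (induction A rule: infinite_finite_induct) (simp_all add: abs_mult nat_mult_distrib)
  then show ?thesis by (simp add: primitive_def ell_def)
qed

text \<open>
  Complementing T turns the indices N / d into d times the cofactor N / rad N, which is the form in
  which the symbols are evaluated.
\<close>

lemma primitive_reindex:
  fixes f :: "nat \<Rightarrow> int"
  assumes "N \<ge> 1"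
  shows "(\<Prod>T\<in>Pow (prime_factors N). f (N div \<Prod>T)) =
         (\<Prod>T\<in>Pow (prime_factors N). f ((N div \<Prod>(prime_factors N)) * \<Prod>T))"
proof (rule prod.reindex_bij_witness[of _ "\<lambda>T. prime_factors N - T" "\<lambda>T. prime_factors N - T"])
  fix T assume "T \<in> Pow (prime_factors N)"
  then have T: "T \<subseteq> prime_factors N" by simp
  define P where "P = prime_factors N"
  define Q where "Q = N div \<Prod>P"
  have "N = \<Prod>P * Q" using div_prod_primes(1)[OF assms, of P] by (simp add: P_def Q_def)
  moreover have "\<Prod>P = \<Prod>T * \<Prod>(P - T)"
    using T by (subst prod.subset_diff[of T P]) (auto simp: P_def mult.commute)
  ultimately have "N = \<Prod>T * (Q * \<Prod>(P - T))" by (simp only: mult_ac)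
  moreover have "\<Prod>T \<noteq> 0" using div_prod_primes(1)[OF assms T] assms by auto
  ultimately have "N div \<Prod>T = Q * \<Prod>(P - T)"
    by (metis nonzero_mult_div_cancel_left)
  then show "f (N div \<Prod>(prime_factors N) * \<Prod>(prime_factors N - T)) = f (N div \<Prod>T)"
    by (simp only: P_def Q_def)
qed auto

lemma chi_small: "chi a (Suc 0) = 1" "chi a 2 = 1"
  by (simp_all add: chi_def ell_def numeral_2_eq_2 del: One_nat_def)

text \<open>
  The product of the symbols is the symbol over |P_N|. If that is a square, the symbol is a square
  too; a value of -1 for a single a is then a contradiction.
\<close>

lemma prod_chi_nonneg:
  assumes "N \<ge> 1" "\<bar>primitive N\<bar> = w\<^sup>2"
  shows "(\<Prod>T\<in>Pow (prime_factors N). chi a (N div \<Prod>T)) \<ge> 0"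
proof -
  have nz: "ell (N div \<Prod>T) \<noteq> 0" if "T \<in> Pow (prime_factors N)" for T
  proof -
    have "odd (ell (N div \<Prod>T))" using that by (intro odd_ell div_prod_primes(2)[OF assms(1)]) simp
    then show ?thesis by (rule odd_pos[THEN less_imp_neq[symmetric]])
  qed
  have "jacobi x (\<Prod>T\<in>A. ell (N div \<Prod>T)) = (\<Prod>T\<in>A. jacobi x (ell (N div \<Prod>T)))"
    if "finite A" "A \<subseteq> Pow (prime_factors N)" for A x
    using that
  proof (induction A rule: finite_induct)
    case (insert T A)
    have "(\<Prod>T\<in>A. ell (N div \<Prod>T)) \<noteq> 0" using insert nz by auto
    then show ?case using insert nz by (simp add: jacobi_mult_right)
  qed simp
  then have "(\<Prod>T\<in>Pow (prime_factors N). chi a (N div \<Prod>T)) = jacobi \<bar>J a\<bar> (nat \<bar>primitive N\<bar>)"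
    by (simp add: chi_def nat_abs_primitive)
  also have "nat \<bar>primitive N\<bar> = nat \<bar>w\<bar> * nat \<bar>w\<bar>"
    by (simp add: assms(2) power2_eq_square nat_mult_distrib flip: nat_abs_mult_distrib)
  also have "jacobi \<bar>J a\<bar> (nat \<bar>w\<bar> * nat \<bar>w\<bar>) = jacobi \<bar>J a\<bar> (nat \<bar>w\<bar>) * jacobi \<bar>J a\<bar> (nat \<bar>w\<bar>)"
    using primitive_nonzero[OF assms(1)] assms(2) by (intro jacobi_mult_right) auto
  finally show ?thesis by simp
qed

text \<open>
  With a = N - 1 every index d > 1 is handled by chi_first_factor, as N - 1 is d - 1 modulo d, and
  the number of such d is odd.
\<close>

lemma prod_chi_odd_squarefree:
  assumes "N \<ge> 3" "odd N" "N div \<Prod>(prime_factors N) = 1"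
  shows "(\<Prod>T\<in>Pow (prime_factors N). chi (N - 1) (N div \<Prod>T)) = -1"
proof -
  have "(\<Prod>T\<in>Pow (prime_factors N). chi (N - 1) (N div \<Prod>T)) =
        (\<Prod>T\<in>Pow (prime_factors N). chi (N - 1) (\<Prod>T))"
    using primitive_reindex[of N "chi (N - 1)"] assms by simp
  also have "\<dots> = (\<Prod>T\<in>Pow (prime_factors N). if T = {} then 1 else -1)"
  proof (rule prod.cong[OF refl])
    fix T assume "T \<in> Pow (prime_factors N)"
    then have T: "T \<subseteq> prime_factors N" by simp
    show "chi (N - 1) (\<Prod>T) = (if T = {} then 1 else -1)"
    proof (cases "T = {}")
      case True then show ?thesis using chi_small by simp
    next
      case False
      define d where "d = \<Prod>T"
      have dN: "d dvd N" unfolding d_def using div_prod_primes(1)[OF _ T] assms(1) by simp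
      obtain p where "p \<in> T" using False by auto
      then have "p dvd d" "prime p" unfolding d_def using T finite_subset[OF T] by (auto intro: dvd_prodI)
      then have "d \<noteq> 1" by auto
      moreover have "odd d" using dN assms(2) dvd_trans by blast
      ultimately have d: "d \<ge> 3" by presburger
      have "chi (N - 1) d = chi (d - 1) d"
      proof (rule chi_cong_left[OF d])
        have "int d dvd int N - int d" using dN by simp
        then show "[N - 1 = d - 1] (mod d)"
          using assms(1) d by (simp add: cong_iff_dvd_diff of_nat_diff flip: cong_int_iff)
      qed (use assms(1) d in auto)
      then show ?thesis using chi_first_factor[OF d] False by (simp add: d_def)
    qed
  qed
  also have "\<dots> = -1"
    using assms(1) by (intro prod_signs_Pow) (auto simp: prime_factorization_empty_iff)
  finally show ?thesis .
qed

lemma kappa_sq: "\<kappa> * \<kappa> = 1"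
  using jacobi_minus_one[OF odd_nat_c] by (simp add: \<kappa>_def)

text \<open>
  Let n = N / rad N. The primes of N split into those dividing n (the set A) and the others (the set
  B), and the indices become n d h with d a product of primes from A and h a product of primes
  from B. The index a is chosen to be -(n + 1) modulo n times the product of A, and 0 modulo the
  product of B. For h = 1 only the index n gives -1. For h > 1 the gcd of a with the index is h,
  so the symbol does not depend on d, and the number of possible d is even.
\<close>

lemma prod_chi_cofactor_ge_3:
  assumes N: "N \<ge> 1" and N0: "N div \<Prod>(prime_factors N) \<ge> 3"
  shows "\<exists>a. (\<Prod>T\<in>Pow (prime_factors N). chi a (N div \<Prod>T)) = -1"
proof -
  define n where "n = N div \<Prod>(prime_factors N)"
  define A where "A = prime_factors n"
  define B where "B = prime_factors N - A"
  have n: "n \<ge> 3" using N0 by (simp add: n_def)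
  have "\<Prod>(prime_factors N) dvd N" using div_prod_primes(1)[OF N] by simp
  then have "N = n * \<Prod>(prime_factors N)" by (simp add: n_def)
  then have "n dvd N" by (rule dvdI)
  then have AB: "A \<union> B = prime_factors N" "A \<inter> B = {}" "finite A" "finite B"
    using dvd_prime_factors[of N n] N by (auto simp: A_def B_def)
  have prA: "prime p \<and> p dvd n" if "p \<in> A" for p using that by (auto simp: A_def)
  have prB: "prime p \<and> \<not> p dvd n" if "p \<in> B" for p
    using that n by (auto simp: A_def B_def in_prime_factors_iff)
  have A_dvd: "\<Prod>U dvd n" if "U \<subseteq> A" for U
    using prod_primes_dvd_iff[of U n] that prA n finite_subset[OF that AB(3)] by (auto simp: A_def)
  have ne: "A \<noteq> {}" using n by (simp add: A_def prime_factorization_empty_iff)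
  have cop: "coprime (n * \<Prod>A) (\<Prod>B)"
  proof (rule prod_coprime_right)
    fix q assume q: "q \<in> B"
    have "coprime p q" if "p \<in> A" for p
      using that q prA prB AB(2) by (intro primes_coprime) auto
    moreover have "coprime q n" using prB[OF q] by (intro prime_imp_coprime) auto
    ultimately show "coprime (n * \<Prod>A) q"
      by (auto intro: prod_coprime_left simp: coprime_commute[of n q])
  qed
  have pos: "n * \<Prod>A > 0" "\<Prod>B > 0" using n prA prB prime_gt_0_nat by (auto intro!: prod_pos)
  \<comment> \<open>The residue - (n + 1) modulo n * \<Prod>A, written with natural numbers.\<close>
  obtain a0 where a0: "[a0 = n * \<Prod>A * n - n - 1] (mod n * \<Prod>A)" "[a0 = 0] (mod \<Prod>B)"
    using binary_chinese_remainder_nat[OF cop] by blast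
  \<comment> \<open>The added multiple of both moduli only serves to make a at least 2.\<close>
  define a where "a = a0 + 2 * (n * \<Prod>A * \<Prod>B)"
  have "n * \<Prod>A * \<Prod>B > 0" using pos by simp
  then have a2: "a \<ge> 2" unfolding a_def by linarith
  have "[a = a0 + 0] (mod n * \<Prod>A)" "[a = a0 + 0] (mod \<Prod>B)"
    unfolding a_def by (intro cong_add cong_refl; simp add: cong_0_iff)+
  then have a: "[a = n * \<Prod>A * n - n - 1] (mod n * \<Prod>A)" "[a = 0] (mod \<Prod>B)"
    using a0 cong_trans by fastforce+
  have big: "n * \<Prod>A * n \<ge> n + 1"
  proof -
    have "n * 1 * 3 \<le> n * \<Prod>A * n" using pos n by (intro mult_mono) auto
    then show ?thesis using n by linarith
  qed
  have a_mod: "[a + n + 1 = 0] (mod n * \<Prod>A)"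
  proof -
    have "[a + (n + 1) = (n * \<Prod>A * n - n - 1) + (n + 1)] (mod n * \<Prod>A)" by (rule cong_add[OF a(1) cong_refl])
    also have "(n * \<Prod>A * n - n - 1) + (n + 1) = n * \<Prod>A * n" using big by simp
    finally show ?thesis by (simp add: cong_0_iff cong_dvd_iff)
  qed
  have cop_a: "coprime a (n * \<Prod>U)" if "U \<subseteq> A" for U
  proof -
    have cn: "coprime a n"
    proof -
      have "n dvd a + n + 1" using a_mod by (auto simp: cong_0_iff dest: dvd_mult_left)
      then have "n dvd n + (a + 1)" by (simp add: ac_simps)
      then have "n dvd a + 1" by (simp only: dvd_add_triv_left_iff)
      moreover have "coprime a (a + 1)" by simp
      ultimately show ?thesis using coprime_divisors[of a a n "a + 1"] by simp
    qed
    then have "coprime a (\<Prod>U)" using coprime_divisors[of a a "\<Prod>U" n] A_dvd[OF that] by simp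
    then show ?thesis using cn by simp
  qed
  have main: "(\<Prod>U\<in>Pow A. chi a (n * \<Prod>(U \<union> V))) = (if V = {} then -1 else 1)" if V: "V \<subseteq> B" for V
  proof (cases "V = {}")
    case True
    have "(\<Prod>U\<in>Pow A. chi a (n * \<Prod>(U \<union> V))) = (\<Prod>U\<in>Pow A. if U = {} then -1 else 1)"
    proof (rule prod.cong[OF refl])
      fix U assume "U \<in> Pow A"
      then have U: "U \<subseteq> A" by simp
      define g where "g = \<Prod>U"
      have g: "g dvd n" "g > 0" using A_dvd[OF U] n by (auto simp: g_def intro: Nat.gr0I)
      have "n * g dvd n * \<Prod>A"
        unfolding g_def using U AB(3) by (intro mult_dvd_mono prod_dvd_prod_subset) auto
      then have am: "[a + n + 1 = 0] (mod n * g)" using a_mod cong_dvd_modulus_nat by blast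
      show "chi a (n * \<Prod>(U \<union> V)) = (if U = {} then -1 else 1)"
      proof (cases "U = {}")
        case U0: True
        have "[a + n + 1 = (n - 1) + n + 1] (mod n)"
          using am n by (simp add: U0 g_def cong_def)
        then have "[a = n - 1] (mod n)" by (simp only: cong_add_rcancel_nat)
        then have "chi a n = chi (n - 1) n" using a2 n by (intro chi_cong_left) auto
        then show ?thesis using chi_first_factor[OF n] U0 True by simp
      next
        case False
        then obtain p where "p \<in> U" by auto
        then have "p dvd g" "prime p" using U finite_subset[OF U AB(3)] prA by (auto simp: g_def intro: dvd_prodI)
        then have "g \<noteq> 1" by auto
        then have g2: "g \<ge> 2" using g(2) by simp
        have gn: "g * n \<ge> 2 * n" using g2 by simp
        have "(g * n - n - 1) + n + 1 = g * n" using gn n by linarith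
        then have "[a + n + 1 = (g * n - n - 1) + n + 1] (mod (g * n))"
          using am by (simp add: cong_def mult.commute del: One_nat_def)
        then have "[a = g * n - n - 1] (mod (g * n))" by (simp only: cong_add_rcancel_nat)
        moreover have "g * n \<ge> 3" "g * n - n - 1 \<ge> 2" using gn n by linarith+
        ultimately have "chi a (g * n) = chi (g * n - n - 1) (g * n)" using a2 by (intro chi_cong_left)
        then show ?thesis using chi_other_factor[OF n g(1) g2] False True by (simp add: g_def mult.commute)
      qed
    qed
    also have "\<dots> = (\<Prod>U\<in>Pow A. - (if U = {} then 1 else -1))" by (intro prod.cong) auto
    also have "\<dots> = (-1) ^ card (Pow A) * (\<Prod>U\<in>Pow A. if U = {} then 1 else -1)" by (rule prod_uminus)
    also have "\<dots> = -1" using prod_signs_Pow[OF AB(3) ne] AB(3) ne by (simp add: card_Pow card_gt_0_iff)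
    finally show ?thesis using True by simp
  next
    case False
    define h where "h = \<Prod>V"
    have fV: "finite V" using V AB(4) finite_subset by blast
    obtain q where "q \<in> V" using False by auto
    then have "q dvd h" "prime q" using V fV prB by (auto simp: h_def intro: dvd_prodI)
    moreover have "h > 0" unfolding h_def using V prB prime_gt_0_nat by (intro prod_pos) auto
    ultimately have h: "h \<ge> 2" using not_prime_1 by (metis Suc_leI Suc_1 dvd_1_iff_1 le_neq_implies_less One_nat_def)
    have "h dvd \<Prod>B" unfolding h_def using V AB(4) by (intro prod_dvd_prod_subset) auto
    then have ha: "h dvd a" using a(2) dvd_trans by (auto simp: cong_0_iff)
    have "chi a (n * \<Prod>(U \<union> V)) = (if h = 2 then 1 else \<kappa>)" if "U \<in> Pow A" for U
    proof -
      have U: "U \<subseteq> A" using that by simp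
      have e: "\<Prod>(U \<union> V) = \<Prod>U * h"
        unfolding h_def using U V AB fV finite_subset[OF U] by (intro prod.union_disjoint) auto
      have "gcd a (n * \<Prod>U * h) = gcd a h" by (rule gcd_mult_right_left_cancel[OF cop_a[OF U]])
      then have g: "gcd a (n * \<Prod>U * h) = h" using ha by (simp add: gcd_nat.absorb2)
      have "\<Prod>U > 0" using U prA prime_gt_0_nat by (intro prod_pos) auto
      then have "n * 1 * 1 \<le> n * \<Prod>U * h" using h by (intro mult_mono) auto
      then have "n * \<Prod>U * h \<ge> 3" using n by linarith
      from chi_gcd[OF a2 this] show ?thesis using g h e by (simp add: mult.assoc)
    qed
    then have "(\<Prod>U\<in>Pow A. chi a (n * \<Prod>(U \<union> V))) = (\<Prod>U\<in>Pow A. if h = 2 then 1 else \<kappa>)"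
      by (rule prod.cong[OF refl])
    also have "\<dots> = (if h = 2 then 1 else \<kappa>) ^ (2 ^ card A)" using AB(3) by (simp add: card_Pow)
    also have "\<dots> = 1"
    proof -
      have "card A > 0" using ne AB(3) by (simp add: card_gt_0_iff)
      then have "even ((2::nat) ^ card A)" by simp
      then obtain k where "(2::nat) ^ card A = 2 * k" by (rule evenE)
      then show ?thesis using kappa_sq by (simp add: power_mult power2_eq_square)
    qed
    finally show ?thesis using False by simp
  qed
  have "(\<Prod>T\<in>Pow (prime_factors N). chi a (N div \<Prod>T)) = (\<Prod>T\<in>Pow (A \<union> B). chi a (n * \<Prod>T))"
    using primitive_reindex[OF N, of "chi a"] by (simp add: AB(1) n_def)
  also have "\<dots> = (\<Prod>V\<in>Pow B. \<Prod>U\<in>Pow A. chi a (n * \<Prod>(U \<union> V)))"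
    by (rule prod_Pow_Un[OF AB(3,4,2)])
  also have "\<dots> = (\<Prod>V\<in>Pow B. if V = {} then -1 else 1)" by (intro prod.cong main) auto
  also have "\<dots> = -1" using AB(4) by (subst prod.remove[of _ "{}"]) auto
  finally show ?thesis by blast
qed

text \<open>
  The residue of |L_j| modulo 8. It is -1 for even j, with the exception L_2 = 1.
\<close>

definition sgn8 :: "nat \<Rightarrow> int" where "sgn8 j = (if even j \<and> j \<ge> 4 then -1 else 1)"

lemma ell_cong_sgn8: "j \<ge> 1 \<Longrightarrow> [int (ell j) = sgn8 j] (mod 8)"
proof -
  assume "j \<ge> 1"
  then consider "j = 1" | "j = 2" | "j \<ge> 3" by linarith
  then show ?thesis
  proof cases
    case 3
    then have "ell j mod 8 = (if even j then 7 else 1)" by (rule ell_mod_8)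
    then have "int (ell j) mod 8 = (if even j then 7 else 1)" by (metis of_nat_mod of_nat_numeral of_nat_1)
    then show ?thesis using 3 by (auto simp: sgn8_def cong_def)
  qed (simp_all add: sgn8_def ell_def)
qed

text \<open>
  Here the residue modulo 8 suffices: an odd number of the indices are even and at least 4, so |P_N|
  is -1 modulo 8.
\<close>

lemma primitive_not_square_even:
  assumes "N \<ge> 3" "even N" "N div \<Prod>(prime_factors N) \<le> 2"
  shows "\<bar>primitive N\<bar> \<noteq> w\<^sup>2"
proof
  assume w: "\<bar>primitive N\<bar> = w\<^sup>2"
  define n where "n = N div \<Prod>(prime_factors N)"
  have N1: "N \<ge> 1" using assms(1) by simp
  have N: "N = n * \<Prod>(prime_factors N)" using div_prod_primes(1)[OF N1, of "prime_factors N"] by (simp add: n_def)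
  have pne: "prime_factors N \<noteq> {}" using assms(1) by (simp add: prime_factorization_empty_iff)
  have pT: "\<Prod>T > 0" "T \<noteq> {} \<Longrightarrow> \<Prod>T \<ge> 2" if T: "T \<subseteq> prime_factors N" for T
  proof -
    have fT: "finite T" using T finite_subset by blast
    show p: "\<Prod>T > 0" using T prime_gt_0_nat by (intro prod_pos) auto
    assume "T \<noteq> {}"
    then obtain q where "q \<in> T" by auto
    then have "q dvd \<Prod>T" "prime q" using T fT by (auto intro: dvd_prodI)
    then show "\<Prod>T \<ge> 2" using p dvd_imp_le prime_ge_2_nat le_trans by meson
  qed
  have "n \<noteq> 0" using N assms(1) by (intro notI) simp
  then consider "n = 2" | "n = 1" using assms(3) by (fastforce simp: n_def)
  then have "(\<Prod>T\<in>Pow (prime_factors N). sgn8 (n * \<Prod>T)) = -1"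
  proof cases
    case 1
    have "(\<Prod>T\<in>Pow (prime_factors N). sgn8 (n * \<Prod>T)) = (\<Prod>T\<in>Pow (prime_factors N). if T = {} then 1 else -1)"
      using pT(2) 1 by (intro prod.cong) (auto simp: sgn8_def)
    then show ?thesis using prod_signs_Pow[OF _ pne] by simp
  next
    case 2
    define A where "A = prime_factors N - {2}"
    have 2: "2 \<in> prime_factors N" using assms(1,2) by (simp add: in_prime_factors_iff)
    have AB: "A \<union> {2} = prime_factors N" "finite A" "A \<inter> {2} = {}" using 2 by (auto simp: A_def)
    have "A \<noteq> {}"
    proof
      assume "A = {}"
      then have "prime_factors N = {2}" using AB by simp
      then show False using N \<open>n = 1\<close> assms(1) by simp
    qed
    have odd: "odd (\<Prod>U)" if "U \<subseteq> A" for U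
    proof -
      have "odd p" if "p \<in> U" for p
        using that \<open>U \<subseteq> A\<close> prime_odd_nat[of p] prime_ge_2_nat[of p] by (fastforce simp: A_def)
      then show ?thesis using finite_subset[OF that AB(2)] by (simp add: even_prod_iff)
    qed
    have "(\<Prod>T\<in>Pow (prime_factors N). sgn8 (n * \<Prod>T)) = (\<Prod>V\<in>Pow {2}. \<Prod>U\<in>Pow A. sgn8 (n * \<Prod>(U \<union> V)))"
      unfolding AB(1)[symmetric] by (rule prod_Pow_Un) (use AB in auto)
    also have "\<dots> = (\<Prod>U\<in>Pow A. sgn8 (\<Prod>U)) * (\<Prod>U\<in>Pow A. sgn8 (\<Prod>(U \<union> {2})))"
      using \<open>n = 1\<close> by (simp add: Pow_insert)
    also have "(\<Prod>U\<in>Pow A. sgn8 (\<Prod>U)) = 1" using odd by (intro prod.neutral) (auto simp: sgn8_def)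
    also have "(\<Prod>U\<in>Pow A. sgn8 (\<Prod>(U \<union> {2}))) = (\<Prod>U\<in>Pow A. if U = {} then 1 else -1)"
    proof (rule prod.cong[OF refl])
      fix U assume "U \<in> Pow A"
      then have U: "U \<subseteq> A" by simp
      then have U: "U \<subseteq> A" "finite U" "U \<subseteq> prime_factors N"
        using finite_subset[OF U AB(2)] by (auto simp: A_def)
      moreover have "2 \<notin> U" using U(1) AB(3) by auto
      ultimately have "\<Prod>(U \<union> {2}) = 2 * \<Prod>U" by simp
      then show "sgn8 (\<Prod>(U \<union> {2})) = (if U = {} then 1 else -1)" using pT(2)[OF U(3)] by (auto simp: sgn8_def)
    qed
    also have "\<dots> = -1" by (rule prod_signs_Pow) fact+
    finally show ?thesis by simp
  qed
  then have s: "(\<Prod>T\<in>Pow (prime_factors N). sgn8 (N div \<Prod>T)) = -1"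
    using primitive_reindex[OF N1, of sgn8] by (simp add: n_def)
  have "[(\<Prod>T\<in>Pow (prime_factors N). int (ell (N div \<Prod>T))) = (\<Prod>T\<in>Pow (prime_factors N). sgn8 (N div \<Prod>T))] (mod 8)"
    by (intro cong_prod ell_cong_sgn8 div_prod_primes(2)[OF N1]) simp
  then have "[int (nat \<bar>primitive N\<bar>) = -1] (mod 8)" using s by (simp add: nat_abs_primitive)
  then have "[w\<^sup>2 = -1] (mod 8)" using w by simp
  then have *: "8 dvd w\<^sup>2 + 1" by (simp add: cong_iff_dvd_diff)
  have "odd w"
  proof
    assume "even w"
    then have "even (w\<^sup>2)" by simp
    moreover have "even (w\<^sup>2 + 1)" using * by (rule dvd_trans[rotated]) simp
    ultimately show False by simp
  qed
  then have "8 dvd w\<^sup>2 - 1" using odd_square_mod_8 by (simp add: cong_iff_dvd_diff)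
  then have "8 dvd (w\<^sup>2 + 1) - (w\<^sup>2 - 1)" using * dvd_diff by blast
  then show False by simp
qed

text \<open>
  A relation would make |P_N| a square, against the value -1 of a symbol over it or against its
  residue modulo 8. The cases are distinguished by the cofactor n = N / rad N; that of n = 2 with
  N odd is void.
\<close>

theorem no_square_relation:
  assumes "N \<ge> 3" "finite I" "\<And>i. i \<in> I \<Longrightarrow> 1 \<le> g i \<and> g i < N"
  shows "2 ^ e * L N * (\<Prod>i\<in>I. L (g i)) \<noteq> y\<^sup>2"
proof
  assume "2 ^ e * L N * (\<Prod>i\<in>I. L (g i)) = y\<^sup>2"
  then obtain w where w: "\<bar>primitive N\<bar> = w\<^sup>2"
    using primitive_square_of_relation[of N I g e y] assms by auto
  have N1: "N \<ge> 1" using assms(1) by simp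
  define n where "n = N div \<Prod>(prime_factors N)"
  have "n \<noteq> 0" using div_prod_primes(2)[OF N1, of "prime_factors N"] by (simp add: n_def)
  then consider "n \<ge> 3" | "n = 1" "odd N" | "n \<le> 2" "even N" | "n = 2" "odd N" by linarith
  then show False
  proof cases
    case 1
    then obtain a where "(\<Prod>T\<in>Pow (prime_factors N). chi a (N div \<Prod>T)) = -1"
      using prod_chi_cofactor_ge_3[OF N1] by (auto simp: n_def)
    then show False using prod_chi_nonneg[OF N1 w, of a] by simp
  next
    case 2
    then show False
      using prod_chi_odd_squarefree[OF assms(1)] prod_chi_nonneg[OF N1 w, of "N - 1"] by (simp add: n_def)
  next
    case 3
    then have "N div \<Prod>(prime_factors N) \<le> 2" by (simp add: n_def)
    then show False using primitive_not_square_even[OF assms(1) 3(2)] w by blast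
  next
    case 4
    have "N = n * \<Prod>(prime_factors N)" using div_prod_primes(1)[OF N1, of "prime_factors N"] by (simp add: n_def)
    then show False using 4 by (metis dvd_triv_left dvd_trans)
  qed
qed

end

section \<open>Multiquadratic extensions\<close>

text \<open>
  Subfields of a field type as plain sets, so that the operations of the type apply directly; the
  link to subfields of the corresponding ring record is subfield_iff_is_field.
\<close>

definition is_field :: "'a::field set \<Rightarrow> bool" where
  "is_field K \<longleftrightarrow> 0 \<in> K \<and> 1 \<in> K \<and> (\<forall>x\<in>K. \<forall>y\<in>K. x + y \<in> K \<and> x * y \<in> K) \<and>
     (\<forall>x\<in>K. - x \<in> K \<and> inverse x \<in> K)"

context
  fixes K :: "'a::field set"
  assumes K: "is_field K"
begin

lemma is_field_closed:
  shows "0 \<in> K" "1 \<in> K"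
    "x \<in> K \<Longrightarrow> y \<in> K \<Longrightarrow> x + y \<in> K" "x \<in> K \<Longrightarrow> y \<in> K \<Longrightarrow> x * y \<in> K"
    "x \<in> K \<Longrightarrow> - x \<in> K" "x \<in> K \<Longrightarrow> inverse x \<in> K"
  using K by (auto simp: is_field_def)

lemma is_field_diff: "x \<in> K \<Longrightarrow> y \<in> K \<Longrightarrow> x - y \<in> K"
  using is_field_closed(3)[of x "- y"] is_field_closed(5)[of y] by simp

lemma is_field_divide: "x \<in> K \<Longrightarrow> y \<in> K \<Longrightarrow> x / y \<in> K"
  using is_field_closed(4)[of x "inverse y"] is_field_closed(6)[of y] by (simp add: field_class.field_divide_inverse)

lemma is_field_power: "x \<in> K \<Longrightarrow> x ^ n \<in> K"
  by (induction n) (auto intro: is_field_closed)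

lemma is_field_prod: "(\<And>i. i \<in> I \<Longrightarrow> f i \<in> K) \<Longrightarrow> prod f I \<in> K"
  by (induction I rule: infinite_finite_induct) (auto intro: is_field_closed)

lemma is_field_numeral: "numeral n \<in> K"
proof -
  have "of_nat k \<in> K" for k by (induction k) (auto intro: is_field_closed)
  from this[of "numeral n"] show ?thesis by simp
qed

lemma is_field_uminus_iff: "- x \<in> K \<longleftrightarrow> x \<in> K"
  using is_field_closed(5)[of x] is_field_closed(5)[of "- x"] by auto

lemma is_field_mult_cancel: "y \<in> K \<Longrightarrow> y \<noteq> 0 \<Longrightarrow> x * y \<in> K \<longleftrightarrow> x \<in> K"
  using is_field_closed(4)[of x y] is_field_divide[of "x * y" y] by auto

lemmas is_field_intros = is_field_closed is_field_diff is_field_divide is_field_power is_field_numeral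

end

lemma is_fieldI:
  assumes "1 \<in> K" "\<And>x y. x \<in> K \<Longrightarrow> y \<in> K \<Longrightarrow> x - y \<in> K" "\<And>x y. x \<in> K \<Longrightarrow> y \<in> K \<Longrightarrow> x / y \<in> K"
  shows "is_field (K :: 'a::field set)"
proof -
  have 0: "0 \<in> K" using assms(2)[OF assms(1,1)] by simp
  have minus: "- x \<in> K" if "x \<in> K" for x using assms(2)[OF 0 that] by simp
  have inv: "inverse x \<in> K" if "x \<in> K" for x using assms(3)[OF assms(1) that] by (simp add: inverse_eq_divide)
  have "x + y \<in> K" if "x \<in> K" "y \<in> K" for x y using assms(2)[OF that(1) minus[OF that(2)]] by simp
  moreover have "x * y \<in> K" if "x \<in> K" "y \<in> K" for x y
    using assms(3)[OF that(1) inv[OF that(2)]] by (simp add: field_class.field_divide_inverse)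
  ultimately show ?thesis using 0 assms(1) minus inv by (simp add: is_field_def)
qed

definition gen_field :: "'a::field set \<Rightarrow> 'a set" where
  "gen_field S = \<Inter>{K. is_field K \<and> S \<subseteq> K}"

lemma is_field_gen_field: "is_field (gen_field S)"
  unfolding is_field_def gen_field_def by (auto simp: is_field_closed)

lemma gen_field_incl: "S \<subseteq> gen_field S"
  by (auto simp: gen_field_def)

lemma gen_field_min: "is_field K \<Longrightarrow> S \<subseteq> K \<Longrightarrow> gen_field S \<subseteq> K"
  by (auto simp: gen_field_def)

lemma gen_field_mono: "S \<subseteq> T \<Longrightarrow> gen_field S \<subseteq> gen_field T"
  by (rule gen_field_min[OF is_field_gen_field]) (use gen_field_incl in blast)

lemma gen_field_field: "is_field K \<Longrightarrow> gen_field K = K"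
  using gen_field_min[of K K] gen_field_incl by blast

lemma gen_field_Un_gen_field: "gen_field (gen_field S \<union> T) = gen_field (S \<union> T)"
proof
  have "gen_field S \<subseteq> gen_field (S \<union> T)" by (rule gen_field_mono) simp
  then show "gen_field (gen_field S \<union> T) \<subseteq> gen_field (S \<union> T)"
    by (intro gen_field_min is_field_gen_field) (use gen_field_incl[of "S \<union> T"] in blast)
  show "gen_field (S \<union> T) \<subseteq> gen_field (gen_field S \<union> T)"
    by (rule gen_field_mono) (use gen_field_incl[of S] in blast)
qed

text \<open>
  The extension of K by x, provided that the square of x lies in K.
\<close>

definition adjoin :: "'a::field set \<Rightarrow> 'a \<Rightarrow> 'a set" where
  "adjoin K x = {a + b * x |a b. a \<in> K \<and> b \<in> K}"

lemma adjoin_trivial: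
  assumes "is_field K" "x \<in> K"
  shows "adjoin K x = K"
proof
  show "adjoin K x \<subseteq> K" using assms by (auto simp: adjoin_def intro: is_field_intros)
  show "K \<subseteq> adjoin K x"
  proof
    fix a assume "a \<in> K"
    moreover have "a = a + 0 * x" by simp
    ultimately show "a \<in> adjoin K x" unfolding adjoin_def using is_field_closed(1)[OF assms(1)] by blast
  qed
qed

lemma adjoinI: "a \<in> K \<Longrightarrow> b \<in> K \<Longrightarrow> a + b * x \<in> adjoin K x"
  by (auto simp: adjoin_def)

lemma adjoin_unique:
  assumes K: "is_field K" and x: "x \<notin> K"
    and "a \<in> K" "b \<in> K" "a' \<in> K" "b' \<in> K" "a + b * x = a' + b' * x"
  shows "a = a'" "b = b'"
proof -
  show "b = b'"
  proof (rule ccontr)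
    assume "b \<noteq> b'"
    then have "x = (a' - a) / (b - b')" using assms(7) by (simp add: field_simps)
    moreover have "(a' - a) / (b - b') \<in> K" using assms by (intro is_field_intros[OF K])
    ultimately show False using x by simp
  qed
  then show "a = a'" using assms(7) by simp
qed

lemma is_field_adjoin:
  assumes K: "is_field K" and x2: "x\<^sup>2 \<in> K"
  shows "is_field (adjoin K x)"
proof (cases "x \<in> K")
  case True then show ?thesis using adjoin_trivial K by metis
next
  case x: False
  note intros = is_field_intros[OF K]
  show ?thesis
    unfolding is_field_def
  proof (intro conjI ballI)
    show "0 \<in> adjoin K x" using adjoinI[of 0 K 0 x] intros by simp
    show "1 \<in> adjoin K x" using adjoinI[of 1 K 0 x] intros by simp
  next
    fix u v assume "u \<in> adjoin K x" "v \<in> adjoin K x"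
    then obtain a b a' b' where u: "u = a + b * x" "a \<in> K" "b \<in> K" and v: "v = a' + b' * x" "a' \<in> K" "b' \<in> K"
      by (auto simp: adjoin_def)
    have e: "u + v = (a + a') + (b + b') * x" using u v by (simp add: algebra_simps)
    show "u + v \<in> adjoin K x" unfolding e using u v by (intro adjoinI intros)
    have e: "u * v = (a * a' + b * b' * x\<^sup>2) + (a * b' + b * a') * x"
      using u v by (simp add: algebra_simps power2_eq_square)
    show "u * v \<in> adjoin K x" unfolding e using u v x2 by (intro adjoinI intros(3,4))
  next
    fix u assume "u \<in> adjoin K x"
    then obtain a b where u: "u = a + b * x" "a \<in> K" "b \<in> K" by (auto simp: adjoin_def)
    have e: "- u = - a + (- b) * x" using u by simp
    show "- u \<in> adjoin K x" unfolding e using u by (intro adjoinI intros)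
    show "inverse u \<in> adjoin K x"
    proof (cases "u = 0")
      case True then show ?thesis using adjoinI[of 0 K 0 x] intros by simp
    next
      case False
      define d where "d = a\<^sup>2 - b\<^sup>2 * x\<^sup>2"
      have d: "d = u * (a - b * x)" using u by (simp add: d_def algebra_simps power2_eq_square)
      have "a - b * x \<noteq> 0"
      proof
        assume "a - b * x = 0"
        then have "a + 0 * x = 0 + b * x" by simp
        from adjoin_unique[OF K x u(2) intros(1) intros(1) u(3) this] have "a = 0" "b = 0" by auto
        then show False using False u by simp
      qed
      then have d0: "d \<noteq> 0" using d False by simp
      have "inverse u = (a - b * x) / d" unfolding d using \<open>a - b * x \<noteq> 0\<close> False by (simp add: field_simps)
      also have "\<dots> = a / d + (- b / d) * x" by (simp add: diff_divide_distrib)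
      finally have e: "inverse u = a / d + (- b / d) * x" .
      have "a\<^sup>2 \<in> K" "b\<^sup>2 \<in> K" using u by (auto intro: intros(9))
      then have "d \<in> K" unfolding d_def using x2 by (intro intros(4,7))
      then show ?thesis unfolding e using u by (intro adjoinI intros)
    qed
  qed
qed

lemma adjoin_incl:
  assumes "is_field K"
  shows "K \<subseteq> adjoin K x" "x \<in> adjoin K x"
proof -
  show "K \<subseteq> adjoin K x"
  proof
    fix a assume "a \<in> K"
    from adjoinI[OF this is_field_closed(1)[OF assms], of x] show "a \<in> adjoin K x" by simp
  qed
  from adjoinI[OF is_field_closed(1,2)[OF assms], of x] show "x \<in> adjoin K x" by simp
qed

lemma gen_field_insert:
  assumes "is_field K" "x\<^sup>2 \<in> K"
  shows "gen_field (insert x K) = adjoin K x"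
proof
  show "gen_field (insert x K) \<subseteq> adjoin K x"
    using adjoin_incl[OF assms(1)] is_field_adjoin[OF assms] by (intro gen_field_min) auto
  show "adjoin K x \<subseteq> gen_field (insert x K)"
    using gen_field_incl[of "insert x K"] unfolding adjoin_def by (auto intro!: is_field_closed[OF is_field_gen_field])
qed

lemma gen_field_Un_insert:
  assumes "x\<^sup>2 \<in> K"
  shows "gen_field (K \<union> insert x S) = adjoin (gen_field (K \<union> S)) x"
proof -
  have "gen_field (K \<union> insert x S) = gen_field (insert x (gen_field (K \<union> S)))"
    using gen_field_Un_gen_field[of "K \<union> S" "{x}"] by simp
  also have "\<dots> = adjoin (gen_field (K \<union> S)) x"
    using assms gen_field_incl[of "K \<union> S"] by (intro gen_field_insert is_field_gen_field) blast
  finally show ?thesis .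
qed

text \<open>
  Write v = a + b x. The coefficient 2 a b of x in v^2 has to vanish.
\<close>

lemma square_in_adjoin:
  fixes x :: "'a::field_char_0"
  assumes K: "is_field K" and "x\<^sup>2 \<in> K" "v \<in> adjoin K x" "v\<^sup>2 \<in> K"
  shows "v \<in> K \<or> v * x \<in> K"
proof (cases "x \<in> K")
  case True then show ?thesis using adjoin_trivial[OF K True] assms by simp
next
  case x: False
  note intros = is_field_intros[OF K]
  obtain a b where v: "v = a + b * x" "a \<in> K" "b \<in> K" using assms by (auto simp: adjoin_def)
  have "v\<^sup>2 = (a\<^sup>2 + b\<^sup>2 * x\<^sup>2) + (2 * a * b) * x" using v by (simp add: algebra_simps power2_eq_square)
  then have "v\<^sup>2 + 0 * x = (a\<^sup>2 + b\<^sup>2 * x\<^sup>2) + (2 * a * b) * x" by simp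
  then have "0 = 2 * a * b"
    by (rule adjoin_unique(2)[OF K x, rotated -1]) (use v assms in \<open>auto intro!: intros\<close>)
  then have "a = 0 \<or> b = 0" by simp
  then show ?thesis
  proof
    assume "a = 0"
    then have "v * x = b * x\<^sup>2" using v by (simp add: power2_eq_square)
    then show ?thesis using v assms by (auto intro!: intros)
  next
    assume "b = 0" then show ?thesis using v by simp
  qed
qed

lemma square_in_multiquadratic:
  fixes v :: "'a::field_char_0"
  assumes K: "is_field K" and fin: "finite S" and sq: "\<And>x. x \<in> S \<Longrightarrow> x\<^sup>2 \<in> K"
    and v: "v \<in> gen_field (K \<union> S)" "v\<^sup>2 \<in> K"
  shows "\<exists>B\<subseteq>S. v * \<Prod>B \<in> K"
  using fin sq v
proof (induction S arbitrary: v rule: finite_induct)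
  case empty
  then show ?case using gen_field_field[OF K] by auto
next
  case (insert x S)
  have x2: "x\<^sup>2 \<in> K" and S2: "\<And>y. y \<in> S \<Longrightarrow> y\<^sup>2 \<in> K" using insert by auto
  have inc: "K \<subseteq> gen_field (K \<union> S)" using gen_field_incl by blast
  have "v \<in> adjoin (gen_field (K \<union> S)) x" using insert.prems gen_field_Un_insert[OF x2] by blast
  then consider "v \<in> gen_field (K \<union> S)" | "v * x \<in> gen_field (K \<union> S)"
    using square_in_adjoin[OF is_field_gen_field] x2 insert.prems inc by blast
  then show ?case
  proof cases
    case 1
    then show ?thesis using insert.IH[OF S2 1] insert.prems by blast
  next
    case 2
    have "(v * x)\<^sup>2 \<in> K" using x2 insert.prems by (simp add: power_mult_distrib is_field_closed[OF K])
    then obtain B where B: "B \<subseteq> S" "v * x * \<Prod>B \<in> K" using insert.IH[OF S2 2] by blast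
    have "x \<notin> B" "finite B" using B insert finite_subset by auto
    then have "v * \<Prod>(insert x B) \<in> K" using B by (simp add: mult.assoc)
    then show ?thesis using B by blast
  qed
qed

text \<open>
  For a set of square roots of elements of K, this says that their squares are independent in the
  multiplicative group of K modulo squares.
\<close>

definition indep :: "'a::field set \<Rightarrow> 'a set \<Rightarrow> bool" where
  "indep K S \<longleftrightarrow> (\<forall>B\<subseteq>S. \<Prod>B \<in> K \<longrightarrow> B = {})"

lemma indep_not_in:
  fixes x :: "'a::field_char_0"
  assumes K: "is_field K" and "indep K S" "finite S" "\<And>x. x \<in> S \<Longrightarrow> x\<^sup>2 \<in> K"
    and "x \<in> S" "T \<subseteq> S" "x \<notin> T"
  shows "x \<notin> gen_field (K \<union> T)"
proof
  assume xT: "x \<in> gen_field (K \<union> T)"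
  have "finite T" by (rule finite_subset[OF assms(6,3)])
  moreover have "y\<^sup>2 \<in> K" if "y \<in> T" for y using that assms(4,6) by blast
  ultimately have "\<exists>B\<subseteq>T. x * \<Prod>B \<in> K"
    by (rule square_in_multiquadratic[OF K _ _ xT assms(4)[OF assms(5)]])
  then obtain B where B: "B \<subseteq> T" "x * \<Prod>B \<in> K" by blast
  have "finite B" using B(1) \<open>finite T\<close> by (rule finite_subset)
  moreover have "x \<notin> B" using B(1) assms(7) by blast
  ultimately have "\<Prod>(insert x B) \<in> K" using B by simp
  moreover have "insert x B \<subseteq> S" using B assms by auto
  ultimately show False using assms(2) unfolding indep_def by blast
qed

text \<open>
  Homomorphisms from K into the ambient field, as total functions of which only the values on K
  count.
\<close>

definition fhom :: "'a::field set \<Rightarrow> ('a \<Rightarrow> 'a) \<Rightarrow> bool" where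
  "fhom K \<tau> \<longleftrightarrow> \<tau> 1 = 1 \<and> (\<forall>a\<in>K. \<forall>b\<in>K. \<tau> (a + b) = \<tau> a + \<tau> b \<and> \<tau> (a * b) = \<tau> a * \<tau> b)"

context
  fixes K :: "'a::field set" and \<tau>
  assumes K: "is_field K" and hom: "fhom K \<tau>"
begin

lemma fhom_simps:
  shows "\<tau> 1 = 1" "a \<in> K \<Longrightarrow> b \<in> K \<Longrightarrow> \<tau> (a + b) = \<tau> a + \<tau> b"
    "a \<in> K \<Longrightarrow> b \<in> K \<Longrightarrow> \<tau> (a * b) = \<tau> a * \<tau> b"
  using hom by (auto simp: fhom_def)

lemma fhom_0: "\<tau> 0 = 0"
proof -
  have "\<tau> (0 + 0) = \<tau> 0 + \<tau> 0" by (intro fhom_simps(2) is_field_closed(1)[OF K])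
  then have "\<tau> 0 + \<tau> 0 = \<tau> 0" by (simp only: add_0_left)
  then show ?thesis using add_cancel_left_right[of "\<tau> 0" "\<tau> 0"] by blast
qed

lemma fhom_uminus:
  assumes "a \<in> K"
  shows "\<tau> (- a) = - \<tau> a"
proof -
  have "\<tau> a + \<tau> (- a) = 0"
    using fhom_simps(2)[OF assms is_field_closed(5)[OF K assms]] fhom_0 by simp
  then show ?thesis by (rule minus_unique[symmetric])
qed

lemma fhom_diff:
  assumes "a \<in> K" "b \<in> K"
  shows "\<tau> (a - b) = \<tau> a - \<tau> b"
  using fhom_simps(2)[OF assms(1) is_field_closed(5)[OF K assms(2)]] fhom_uminus[OF assms(2)] by simp

lemma fhom_inverse: "a \<in> K \<Longrightarrow> \<tau> (inverse a) = inverse (\<tau> a)"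
proof (cases "a = 0")
  case False
  assume a: "a \<in> K"
  have "\<tau> a * \<tau> (inverse a) = 1"
    using fhom_simps(3)[OF a is_field_closed(6)[OF K a]] fhom_simps(1) False by simp
  then show ?thesis by (simp add: inverse_unique)
qed (simp add: fhom_0)

lemma fhom_divide:
  assumes "a \<in> K" "b \<in> K"
  shows "\<tau> (a / b) = \<tau> a / \<tau> b"
  using fhom_simps(3)[OF assms(1) is_field_closed(6)[OF K assms(2)]] fhom_inverse[OF assms(2)]
  by (simp add: field_class.field_divide_inverse)

lemma fhom_power: "a \<in> K \<Longrightarrow> \<tau> (a ^ n) = \<tau> a ^ n"
  by (induction n) (simp_all add: fhom_simps is_field_power[OF K])

lemma fhom_prod: "(\<And>i. i \<in> I \<Longrightarrow> f i \<in> K) \<Longrightarrow> \<tau> (prod f I) = (\<Prod>i\<in>I. \<tau> (f i))"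
  by (induction I rule: infinite_finite_induct) (simp_all add: fhom_simps is_field_prod[OF K])

lemma fhom_inj: "inj_on \<tau> K"
proof (rule inj_onI)
  fix a b assume ab: "a \<in> K" "b \<in> K" "\<tau> a = \<tau> b"
  show "a = b"
  proof (rule ccontr)
    assume "a \<noteq> b"
    have "a - b \<in> K" using ab by (intro is_field_diff[OF K])
    then have "\<tau> (a - b) * \<tau> (inverse (a - b)) = 1"
      using \<open>a \<noteq> b\<close> fhom_simps(3)[of "a - b" "inverse (a - b)"] fhom_simps(1) is_field_closed(6)[OF K]
      by simp
    then show False using ab fhom_diff by simp
  qed
qed

lemma is_field_fhom_image: "is_field (\<tau> ` K)"
proof (rule is_fieldI)
  show "1 \<in> \<tau> ` K" using imageI[OF is_field_closed(2)[OF K], of \<tau>] by (simp only: fhom_simps(1))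
  fix x y assume "x \<in> \<tau> ` K" "y \<in> \<tau> ` K"
  then obtain a b where ab: "x = \<tau> a" "y = \<tau> b" and K2: "a \<in> K" "b \<in> K" by blast
  show "x - y \<in> \<tau> ` K"
    using imageI[OF is_field_diff[OF K K2], of \<tau>] by (simp only: fhom_diff[OF K2] ab)
  show "x / y \<in> \<tau> ` K"
    using imageI[OF is_field_divide[OF K K2], of \<tau>] by (simp only: fhom_divide[OF K2] ab)
qed

lemma fhom_extend_adjoin:
  assumes x: "x \<notin> K" "x\<^sup>2 \<in> K" and y: "y\<^sup>2 = \<tau> (x\<^sup>2)"
  shows "\<exists>\<tau>'. fhom (adjoin K x) \<tau>' \<and> (\<forall>a\<in>K. \<tau>' a = \<tau> a) \<and> \<tau>' x = y"
proof -
  note intros = is_field_intros[OF K]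
  define \<tau>' where "\<tau>' z = (THE w. \<exists>a b. a \<in> K \<and> b \<in> K \<and> z = a + b * x \<and> w = \<tau> a + \<tau> b * y)" for z
  have \<tau>': "\<tau>' (a + b * x) = \<tau> a + \<tau> b * y" if "a \<in> K" "b \<in> K" for a b
    unfolding \<tau>'_def
  proof (rule the_equality)
    fix w assume "\<exists>a' b'. a' \<in> K \<and> b' \<in> K \<and> a + b * x = a' + b' * x \<and> w = \<tau> a' + \<tau> b' * y"
    then obtain a' b' where w: "a' \<in> K" "b' \<in> K" "a + b * x = a' + b' * x" "w = \<tau> a' + \<tau> b' * y" by blast
    show "w = \<tau> a + \<tau> b * y" using adjoin_unique[OF K x(1) that w(1-3)] w(4) by simp
  qed (use that in blast)
  have on_K: "\<tau>' a = \<tau> a" if "a \<in> K" for a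
    using \<tau>'[OF that intros(1)] fhom_0 by simp
  have "\<tau>' x = y" using \<tau>'[OF intros(1) intros(2)] fhom_0 fhom_simps(1) by simp
  moreover have "fhom (adjoin K x) \<tau>'"
    unfolding fhom_def
  proof (intro conjI ballI)
    show "\<tau>' 1 = 1" using on_K[OF intros(2)] fhom_simps(1) by simp
  next
    fix u v assume "u \<in> adjoin K x" "v \<in> adjoin K x"
    then obtain a b a' b' where u: "u = a + b * x" "a \<in> K" "b \<in> K" and v: "v = a' + b' * x" "a' \<in> K" "b' \<in> K"
      unfolding adjoin_def by blast
    have e: "u + v = (a + a') + (b + b') * x" using u v by (simp add: algebra_simps)
    have "\<tau>' (u + v) = \<tau> (a + a') + \<tau> (b + b') * y"
      unfolding e using u v by (intro \<tau>' intros(3))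
    then show "\<tau>' (u + v) = \<tau>' u + \<tau>' v"
      using u v by (simp add: \<tau>' fhom_simps(2) algebra_simps)
    have e: "u * v = (a * a' + b * b' * x\<^sup>2) + (a * b' + b * a') * x"
      using u v by (simp add: algebra_simps power2_eq_square)
    have cl: "a * a' \<in> K" "b * b' \<in> K" "b * b' * x\<^sup>2 \<in> K" "a * b' \<in> K" "b * a' \<in> K"
      using u v x(2) by (auto intro: intros(4))
    have "\<tau>' (u * v) = \<tau> (a * a' + b * b' * x\<^sup>2) + \<tau> (a * b' + b * a') * y"
      unfolding e using cl by (intro \<tau>' intros(3))
    also have "\<dots> = (\<tau> a * \<tau> a' + \<tau> b * \<tau> b' * y\<^sup>2) + (\<tau> a * \<tau> b' + \<tau> b * \<tau> a') * y"
      using u v x(2) cl by (simp add: fhom_simps(2,3) y)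
    also have "\<dots> = (\<tau> a + \<tau> b * y) * (\<tau> a' + \<tau> b' * y)" by (simp add: algebra_simps power2_eq_square)
    finally show "\<tau>' (u * v) = \<tau>' u * \<tau>' v" using u v by (simp add: \<tau>')
  qed
  ultimately show ?thesis using on_K by blast
qed

end

text \<open>
  The images of independent square roots can be prescribed freely, because each adjunction is a
  proper quadratic extension of the previous field.
\<close>

lemma fhom_extend_multiquadratic:
  fixes \<tau> :: "'a::field_char_0 \<Rightarrow> 'a"
  assumes K: "is_field K" "fhom K \<tau>"
    and S: "finite S" "indep K S" "\<And>x. x \<in> S \<Longrightarrow> x\<^sup>2 \<in> K" "\<And>x. x \<in> S \<Longrightarrow> (y x)\<^sup>2 = \<tau> (x\<^sup>2)"
  shows "\<exists>\<tau>'. fhom (gen_field (K \<union> S)) \<tau>' \<and> (\<forall>a\<in>K. \<tau>' a = \<tau> a) \<and> (\<forall>x\<in>S. \<tau>' x = y x)"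
proof -
  have "\<exists>\<tau>'. fhom (gen_field (K \<union> T)) \<tau>' \<and> (\<forall>a\<in>K. \<tau>' a = \<tau> a) \<and> (\<forall>x\<in>T. \<tau>' x = y x)" if "T \<subseteq> S" for T
    using finite_subset[OF that S(1)] that
  proof (induction T rule: finite_induct)
    case empty
    then show ?case using K gen_field_field[OF K(1)] by (intro exI[of _ \<tau>]) simp
  next
    case (insert x T)
    then obtain \<tau>1 where \<tau>1: "fhom (gen_field (K \<union> T)) \<tau>1" "\<forall>a\<in>K. \<tau>1 a = \<tau> a" "\<forall>x\<in>T. \<tau>1 x = y x" by auto
    have x: "x \<in> S" "x\<^sup>2 \<in> K" using insert S by auto
    have inc: "K \<union> T \<subseteq> gen_field (K \<union> T)" by (rule gen_field_incl)
    have "x \<notin> gen_field (K \<union> T)" using indep_not_in[OF K(1) S(2,1,3) x(1)] insert by auto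
    moreover have "(y x)\<^sup>2 = \<tau>1 (x\<^sup>2)" using S(4)[OF x(1)] \<tau>1(2) x(2) by simp
    moreover have "x\<^sup>2 \<in> gen_field (K \<union> T)" using x inc by blast
    ultimately obtain \<tau>' where "fhom (adjoin (gen_field (K \<union> T)) x) \<tau>'" "\<forall>a\<in>gen_field (K \<union> T). \<tau>' a = \<tau>1 a" "\<tau>' x = y x"
      using fhom_extend_adjoin[OF is_field_gen_field \<tau>1(1)] by blast
    then show ?case using \<tau>1 inc gen_field_Un_insert[OF x(2)] by (intro exI[of _ \<tau>']) auto
  qed
  then show ?thesis by blast
qed

section \<open>Degrees of multiquadratic extensions\<close>

lemma ring_of_type_algebra_simps [simp]:
  "carrier ring_of_type_algebra = UNIV" "x \<otimes>\<^bsub>ring_of_type_algebra\<^esub> y = x * y"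
  "x \<oplus>\<^bsub>ring_of_type_algebra\<^esub> y = x + y" "\<one>\<^bsub>ring_of_type_algebra\<^esub> = 1" "\<zero>\<^bsub>ring_of_type_algebra\<^esub> = 0"
  by (simp_all add: ring_of_type_algebra_def)

lemma a_inv_ring_of_type_algebra [simp]: "\<ominus>\<^bsub>ring_of_type_algebra\<^esub> x = - (x :: 'a::field)"
proof -
  interpret field "ring_of_type_algebra :: 'a ring" by (rule field_from_type_algebra)
  show ?thesis by (rule minus_equality) simp_all
qed

lemma m_inv_ring_of_type_algebra [simp]:
  assumes "x \<noteq> 0"
  shows "inv\<^bsub>ring_of_type_algebra\<^esub> x = inverse (x :: 'a::field)"
proof -
  interpret field "ring_of_type_algebra :: 'a ring" by (rule field_from_type_algebra)
  show ?thesis by (rule inv_char) (use assms in simp_all)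
qed

lemma subfield_iff_is_field: "subfield K ring_of_type_algebra \<longleftrightarrow> is_field (K :: 'a::field set)"
proof -
  interpret R: field "ring_of_type_algebra :: 'a ring" by (rule field_from_type_algebra)
  show ?thesis
  proof
    assume K: "subfield K ring_of_type_algebra"
    note sub = subringE[OF subfieldE(1)[OF K]]
    have "inverse x \<in> K" if "x \<in> K" for x
      using R.subfield_m_inv(1)[OF K, of x] that sub(2) by (cases "x = 0") auto
    then show "is_field K" using sub by (auto simp: is_field_def)
  next
    assume K: "is_field K"
    show "subfield K ring_of_type_algebra"
    proof (rule R.subfieldI')
      show "subring K ring_of_type_algebra"
        by (rule R.subringI) (use is_field_closed[OF K] in auto)
      show "inv\<^bsub>ring_of_type_algebra\<^esub> k \<in> K" if "k \<in> K - {\<zero>\<^bsub>ring_of_type_algebra\<^esub>}" for k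
        using that is_field_closed(6)[OF K] by auto
    qed
  qed
qed

lemma generate_field_eq_gen_field: "generate_field ring_of_type_algebra S = gen_field (S :: 'a::field set)"
proof -
  interpret R: field "ring_of_type_algebra :: 'a ring" by (rule field_from_type_algebra)
  show ?thesis
    by (subst R.generate_field_min_subfield2) (simp_all add: gen_field_def subfield_iff_is_field)
qed

lemma dimension_adjoin:
  assumes "is_field K" "x \<notin> K"
  shows "ring.dimension ring_of_type_algebra 2 K (adjoin K x)"
proof -
  interpret R: field "ring_of_type_algebra :: 'a ring" by (rule field_from_type_algebra)
  have "R.dimension 1 K K" using R.dimension_one assms(1) by (simp add: subfield_iff_is_field)
  then have "R.dimension (Suc 1) K (R.line_extension K x K)"
    using assms(2) by (intro R.Suc_dim) auto
  moreover have "R.line_extension K x K = adjoin K x"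
    by (auto simp: R.line_extension_def set_add_def' r_coset_def adjoin_def add.commute)
  ultimately show ?thesis by (simp add: numeral_2_eq_2)
qed

lemma dimension_multiquadratic:
  fixes K :: "'a::field_char_0 set"
  assumes K: "is_field K"
    and S: "finite S" "indep K S" "\<And>x. x \<in> S \<Longrightarrow> x\<^sup>2 \<in> K"
  shows "ring.dimension ring_of_type_algebra (2 ^ card S) K (gen_field (K \<union> S))"
proof -
  interpret R: field "ring_of_type_algebra :: 'a ring" by (rule field_from_type_algebra)
  have "R.dimension (2 ^ card T) K (gen_field (K \<union> T))" if "T \<subseteq> S" for T
    using finite_subset[OF that S(1)] that
  proof (induction T rule: finite_induct)
    case empty
    have "R.dimension 1 K K" using R.dimension_one K by (simp add: subfield_iff_is_field)
    then show ?case by (simp add: gen_field_field[OF K])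
  next
    case (insert x T)
    have x: "x \<in> S" "x\<^sup>2 \<in> K" using insert S by auto
    have "x \<notin> gen_field (K \<union> T)" using indep_not_in[OF K(1) S(2,1,3) x(1)] insert by auto
    then have "R.dimension 2 (gen_field (K \<union> T)) (gen_field (K \<union> insert x T))"
      using dimension_adjoin[OF is_field_gen_field] gen_field_Un_insert[OF x(2)] by metis
    then have "R.dimension (2 ^ card T * 2) K (gen_field (K \<union> insert x T))"
      using insert K is_field_gen_field by (intro R.telescopic_base) (auto simp: subfield_iff_is_field)
    then show ?case using insert by (simp add: mult.commute)
  qed
  then show ?thesis by blast
qed

section \<open>Subfields and homomorphisms in characteristic zero\<close>

lemma Rats_is_field: "is_field (\<rat> :: 'a::field_char_0 set)"
  by (auto simp: is_field_def)

lemma gen_field_fhom_subset: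
  assumes "fhom (gen_field S) \<tau>" "is_field M" "\<tau> ` S \<subseteq> M"
  shows "\<tau> ` gen_field S \<subseteq> M"
proof -
  let ?F = "{x \<in> gen_field S. \<tau> x \<in> M}"
  note f = is_field_gen_field[of S]
  have "is_field ?F"
  proof (rule is_fieldI)
    show "1 \<in> ?F" using fhom_simps(1)[OF f assms(1)] is_field_closed(2)[OF f] is_field_closed(2)[OF assms(2)] by simp
    fix x y assume "x \<in> ?F" "y \<in> ?F"
    then have xy: "x \<in> gen_field S" "y \<in> gen_field S" "\<tau> x \<in> M" "\<tau> y \<in> M" by auto
    show "x - y \<in> ?F"
      using fhom_diff[OF f assms(1) xy(1,2)] is_field_diff[OF f xy(1,2)] is_field_diff[OF assms(2) xy(3,4)] by simp
    show "x / y \<in> ?F"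
      using fhom_divide[OF f assms(1) xy(1,2)] is_field_divide[OF f xy(1,2)] is_field_divide[OF assms(2) xy(3,4)] by simp
  qed
  moreover have "S \<subseteq> ?F" using gen_field_incl[of S] assms(3) by blast
  ultimately show ?thesis using gen_field_min[of ?F S] by blast
qed

lemma fhom_eq_on_gen_field:
  assumes "is_field K" "fhom K \<tau>" "fhom K \<tau>'" "S \<subseteq> K" "\<And>x. x \<in> S \<Longrightarrow> \<tau> x = \<tau>' x" "x \<in> gen_field S"
  shows "\<tau> x = \<tau>' x"
proof -
  let ?F = "{x \<in> K. \<tau> x = \<tau>' x}"
  note f = assms(1)
  have "is_field ?F"
  proof (rule is_fieldI)
    show "1 \<in> ?F" using fhom_simps(1)[OF f assms(2)] fhom_simps(1)[OF f assms(3)] is_field_closed(2)[OF f] by simp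
    fix x y assume "x \<in> ?F" "y \<in> ?F"
    then have xy: "x \<in> K" "y \<in> K" "\<tau> x = \<tau>' x" "\<tau> y = \<tau>' y" by auto
    show "x - y \<in> ?F"
      using fhom_diff[OF f assms(2) xy(1,2)] fhom_diff[OF f assms(3) xy(1,2)] is_field_diff[OF f xy(1,2)] xy by simp
    show "x / y \<in> ?F"
      using fhom_divide[OF f assms(2) xy(1,2)] fhom_divide[OF f assms(3) xy(1,2)] is_field_divide[OF f xy(1,2)] xy by simp
  qed
  moreover have "S \<subseteq> ?F" using assms(4,5) by blast
  ultimately show ?thesis using gen_field_min[of ?F S] assms(6) by blast
qed

lemma fhom_of_nat:
  assumes "is_field K" "fhom K \<tau>"
  shows "\<tau> (of_nat n) = of_nat n"
proof -
  have "(of_nat k :: 'a) \<in> K" for k by (induction k) (auto intro: is_field_closed[OF assms(1)])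
  then show ?thesis
    by (induction n) (simp_all add: fhom_0[OF assms] fhom_simps[OF assms] is_field_closed[OF assms(1)])
qed

lemma Rats_subset_is_field:
  fixes K :: "'a::field_char_0 set"
  assumes "is_field K"
  shows "\<rat> \<subseteq> K"
proof
  fix x :: 'a assume "x \<in> \<rat>"
  then obtain a b where x: "x = of_int a / of_int b" by (auto elim: Rats_cases')
  have n: "(of_nat k :: 'a) \<in> K" for k by (induction k) (auto intro: is_field_closed[OF assms])
  have "(of_int i :: 'a) \<in> K" for i
    by (cases i rule: int_cases2) (use n in \<open>auto intro: is_field_closed[OF assms]\<close>)
  then show "x \<in> K" unfolding x by (intro is_field_divide[OF assms])
qed

lemma fhom_Rats:
  fixes K :: "'a::field_char_0 set"
  assumes "is_field K" "fhom K \<tau>" "x \<in> \<rat>"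
  shows "\<tau> x = x"
proof -
  obtain a b where x: "x = of_int a / of_int b" using assms(3) by (auto elim: Rats_cases')
  have K: "(of_int i :: 'a) \<in> K" "(of_nat k :: 'a) \<in> K" for i k
    using Rats_subset_is_field[OF assms(1)] by auto
  have "\<tau> (of_int i) = of_int i" for i
    by (cases i rule: int_cases2)
       (use K in \<open>simp_all add: fhom_of_nat[OF assms(1,2)] fhom_uminus[OF assms(1,2)]\<close>)
  then show ?thesis unfolding x using K by (simp add: fhom_divide[OF assms(1,2)])
qed

lemma int_square_of_rat_square:
  assumes "q \<in> (\<rat> :: 'a::field_char_0 set)" "q\<^sup>2 = of_int z"
  shows "\<exists>y. z = y\<^sup>2"
proof -
  obtain a b where ab: "b > 0" "coprime a b" "q = of_int a / of_int b" using assms(1) by (auto elim: Rats_cases')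
  have "(of_int (a\<^sup>2) :: 'a) = of_int (z * b\<^sup>2)"
    using assms(2) ab by (simp add: power_divide field_simps)
  then have e: "a\<^sup>2 = z * b\<^sup>2" by (simp only: of_int_eq_iff)
  then have "b\<^sup>2 dvd a\<^sup>2" by simp
  then have "b dvd a" by simp
  then have "b = 1" using ab(1,2) by (metis coprime_absorb_right zdvd1_eq abs_of_pos)
  then show ?thesis using e by auto
qed

section \<open>The tower of preimage fields\<close>

lemma (in arboreal) two_c_sq_not_square: "2 * c\<^sup>2 \<noteq> y\<^sup>2"
proof
  assume e: "2 * c\<^sup>2 = y\<^sup>2"
  then have "even (y\<^sup>2)" by (metis dvd_triv_left)
  then have "even y" by simp
  then obtain z where "y = 2 * z" by (rule evenE)
  then have "c\<^sup>2 = 2 * z\<^sup>2" using e by (simp add: power_mult_distrib)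
  then have "even (c\<^sup>2)" by simp
  then show False using odd_c by simp
qed

context arboreal
begin

definition phi :: "qbar option \<Rightarrow> qbar option" where
  "phi = ratmap [:- 2 * (2 * (of_nat m)\<^sup>2 - 1)\<^sup>2, 0, 1:] [:0, 0, 1:]"

definition C :: qbar where "C = of_int c"

text \<open>
  The action of \<phi> on finite nonzero points, which sends a vertex of the tree to its parent.
\<close>

definition par :: "qbar \<Rightarrow> qbar" where "par z = 1 - 2 * C\<^sup>2 / z\<^sup>2"

lemma C_nonzero: "C \<noteq> 0" using c_gt_1 by (simp add: C_def)

lemma C_Rats: "C \<in> \<rat>" by (simp add: C_def)

lemma phi_None: "phi None = Some 1"
  by (simp add: phi_def ratmap_def numeral_2_eq_2)

lemma phi_Some: "phi (Some z) = (if z = 0 then None else Some (par z))"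
proof -
  have "of_rat (- 2 * (2 * (of_nat m)\<^sup>2 - 1)\<^sup>2) = (- (2 * C\<^sup>2) :: qbar)"
    by (simp add: C_def c_def of_rat_mult of_rat_minus of_rat_power of_rat_diff)
  then have "poly (map_poly of_rat [:- 2 * (2 * (of_nat m)\<^sup>2 - 1)\<^sup>2, 0, 1:]) z = - (2 * C\<^sup>2) + z\<^sup>2"
    by (simp add: map_poly_pCons power2_eq_square)
  moreover have "poly (map_poly of_rat [:0, 0, 1:]) z = z\<^sup>2"
    by (simp add: map_poly_pCons power2_eq_square)
  ultimately show ?thesis
    by (simp add: phi_def ratmap_def par_def Let_def diff_divide_distrib)
qed

abbreviation "V \<equiv> preimages phi"

abbreviation l :: "nat \<Rightarrow> qbar" where "l n \<equiv> of_int (L n)"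

lemma l_nonzero: "n \<ge> 1 \<Longrightarrow> l n \<noteq> 0" using L_nonzero by simp

lemma par_orbit:
  assumes "k \<ge> 1"
  shows "par (l (k + 1) / (l k)\<^sup>2) = l (k + 2) / (l (k + 1))\<^sup>2"
proof -
  have "L (k + 2) = (L (k + 1))\<^sup>2 - 2 * c\<^sup>2 * L k ^ 4" by simp
  then have "l (k + 2) = (l (k + 1))\<^sup>2 - 2 * C\<^sup>2 * l k ^ 4" unfolding C_def by (simp only: of_int_diff of_int_mult of_int_power of_int_numeral)
  moreover have "par (l (k + 1) / (l k)\<^sup>2) = 1 - 2 * C\<^sup>2 * l k ^ 4 / (l (k + 1))\<^sup>2"
    by (simp add: par_def power_divide flip: power_mult)
  ultimately show ?thesis using l_nonzero[of "k + 1"] by (simp add: diff_divide_distrib del: crit.simps)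
qed

lemma phi_iterate_None: "(phi ^^ Suc n) None = Some (l (n + 2) / (l (n + 1))\<^sup>2)"
proof (induction n)
  case 0
  then show ?case by (simp add: phi_None)
next
  case (Suc n)
  have "(phi ^^ Suc (Suc n)) None = phi ((phi ^^ Suc n) None)" by simp
  also have "\<dots> = phi (Some (l (n + 2) / (l (n + 1))\<^sup>2))" by (simp only: Suc)
  also have "\<dots> = Some (par (l (n + 2) / (l (n + 1))\<^sup>2))"
    using l_nonzero[of "n + 2"] l_nonzero[of "n + 1"] by (simp add: phi_Some del: crit.simps)
  also have "\<dots> = Some (l (Suc n + 2) / (l (Suc n + 1))\<^sup>2)" using par_orbit[of "n + 1"] by (simp del: crit.simps)
  finally show ?case .
qed

text \<open>
  Infinity never maps to 0, so every vertex other than the root is a nonzero finite point and its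
  parent is given by par.
\<close>

lemma phi_iterate_None_neq: "(phi ^^ n) None \<noteq> Some 0"
  using phi_iterate_None[of "n - 1"] l_nonzero[of "n - 1 + 2"] l_nonzero[of "n - 1 + 1"]
  by (cases n) (simp_all del: crit.simps funpow.simps add: funpow_0)

lemma V_0: "V 0 = {0}"
  by (auto simp: preimages_def)

lemma V_Suc: "V (Suc n) = {z. z \<noteq> 0 \<and> par z \<in> V n}"
  using phi_iterate_None_neq[of n]
  by (auto simp: preimages_def funpow_Suc_right phi_Some simp del: funpow.simps)

text \<open>
  As 1 is the image of infinity, it never maps to 0. So the radicands 2c^2/(1-\<beta>) below are
  defined.
\<close>

lemma one_notin_V: "1 \<notin> V n"
proof -
  have "(phi ^^ Suc n) None \<noteq> Some 0" by (rule phi_iterate_None_neq)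
  then show ?thesis by (simp add: preimages_def funpow_Suc_right phi_None del: funpow.simps)
qed

text \<open>
  A choice of square root; the two children of \<beta> are r \<beta> and - r \<beta>.
\<close>

definition r :: "qbar \<Rightarrow> qbar" where
  "r \<beta> = (SOME x. x\<^sup>2 = 2 * C\<^sup>2 / (1 - \<beta>))"

lemma r_sq: "(r \<beta>)\<^sup>2 = 2 * C\<^sup>2 / (1 - \<beta>)"
proof -
  obtain x where "x ^ 2 = 2 * C\<^sup>2 / (1 - \<beta>)" using nth_root_exists[of 2] by auto
  then show ?thesis unfolding r_def by (rule someI)
qed

lemma r_nonzero:
  assumes "\<beta> \<in> V n"
  shows "r \<beta> \<noteq> 0"
proof
  assume "r \<beta> = 0"
  then have "2 * C\<^sup>2 / (1 - \<beta>) = 0" using r_sq[of \<beta>] by simp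
  moreover have "\<beta> \<noteq> 1" using assms one_notin_V by blast
  ultimately show False using C_nonzero by simp
qed

lemma sq_iff_par:
  assumes "\<beta> \<noteq> 1"
  shows "z\<^sup>2 = 2 * C\<^sup>2 / (1 - \<beta>) \<longleftrightarrow> z \<noteq> 0 \<and> par z = \<beta>"
proof
  have C: "2 * C\<^sup>2 \<noteq> 0" using C_nonzero by simp
  {
    assume z: "z\<^sup>2 = 2 * C\<^sup>2 / (1 - \<beta>)"
    then have "z\<^sup>2 \<noteq> 0" using C assms by simp
    moreover have "2 * C\<^sup>2 / (2 * C\<^sup>2 / (1 - \<beta>)) = 1 - \<beta>" using C assms by simp
    moreover have "z \<noteq> 0"
    proof
      assume "z = 0"
      with \<open>z\<^sup>2 \<noteq> 0\<close> show False by simp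
    qed
    ultimately show "z \<noteq> 0 \<and> par z = \<beta>" by (simp add: par_def z)
  }
  assume z: "z \<noteq> 0 \<and> par z = \<beta>"
  then have "1 - \<beta> = 2 * C\<^sup>2 / z\<^sup>2" by (auto simp: par_def)
  then have "2 * C\<^sup>2 / (1 - \<beta>) = 2 * C\<^sup>2 / (2 * C\<^sup>2 / z\<^sup>2)" by (simp only:)
  also have "\<dots> = z\<^sup>2" using C by simp
  finally show "z\<^sup>2 = 2 * C\<^sup>2 / (1 - \<beta>)" by simp
qed

lemma par_r:
  assumes "\<beta> \<in> V n"
  shows "par (r \<beta>) = \<beta>" "par (- r \<beta>) = \<beta>"
proof -
  have "\<beta> \<noteq> 1" using assms one_notin_V by blast
  then show "par (r \<beta>) = \<beta>" "par (- r \<beta>) = \<beta>"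
    using sq_iff_par[of \<beta> "r \<beta>"] sq_iff_par[of \<beta> "- r \<beta>"] r_sq[of \<beta>] by simp_all
qed

lemma r_in_V: "\<beta> \<in> V n \<Longrightarrow> r \<beta> \<in> V (Suc n)" "\<beta> \<in> V n \<Longrightarrow> - r \<beta> \<in> V (Suc n)"
  by (simp_all add: V_Suc par_r r_nonzero)

lemma par_in_V: "z \<in> V (Suc n) \<Longrightarrow> par z \<in> V n" by (simp add: V_Suc)

lemma par_eq_iff:
  assumes "z \<in> V (Suc n)" "w \<in> V (Suc n)"
  shows "par z = par w \<longleftrightarrow> z = w \<or> z = - w"
proof -
  have "par z \<noteq> 1" "par w \<noteq> 1" "z \<noteq> 0" "w \<noteq> 0" using assms one_notin_V[of n] by (auto simp: V_Suc)
  then have "z\<^sup>2 = 2 * C\<^sup>2 / (1 - par z)" "w\<^sup>2 = 2 * C\<^sup>2 / (1 - par w)"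
    using sq_iff_par[of "par z" z] sq_iff_par[of "par w" w] by blast+
  then have "z\<^sup>2 = w\<^sup>2" if "par z = par w" using that by (simp only:)
  moreover have "z = w \<or> z = - w \<Longrightarrow> par z = par w" by (auto simp: par_def)
  ultimately show ?thesis by (auto simp: power2_eq_iff)
qed

lemma V_Suc_cases:
  assumes "z \<in> V (Suc n)"
  shows "z = r (par z) \<or> z = - r (par z)"
  using par_eq_iff[OF assms r_in_V(1)[OF par_in_V[OF assms]]] par_r(1)[OF par_in_V[OF assms]] by simp

lemma V_Suc_eq: "V (Suc n) = r ` V n \<union> (\<lambda>\<beta>. - r \<beta>) ` V n"
proof
  show "V (Suc n) \<subseteq> r ` V n \<union> (\<lambda>\<beta>. - r \<beta>) ` V n"
  proof
    fix z assume z: "z \<in> V (Suc n)"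
    then have "par z \<in> V n" by (rule par_in_V)
    then show "z \<in> r ` V n \<union> (\<lambda>\<beta>. - r \<beta>) ` V n" using V_Suc_cases[OF z] by (metis UnI1 UnI2 imageI)
  qed
qed (auto intro: r_in_V)

lemma inj_r: "inj_on r (V n)" "inj_on (\<lambda>\<beta>. - r \<beta>) (V n)"
  by (rule inj_on_inverseI[of _ par], erule par_r)+

lemma r_disjoint: "r ` V n \<inter> (\<lambda>\<beta>. - r \<beta>) ` V n = {}"
proof -
  have False if "\<beta> \<in> V n" "\<gamma> \<in> V n" "r \<beta> = - r \<gamma>" for \<beta> \<gamma>
  proof -
    have "\<beta> = par (r \<beta>)" using par_r(1)[OF that(1)] by (rule sym)
    also have "\<dots> = par (- r \<gamma>)" by (simp only: that(3))
    also have "\<dots> = \<gamma>" by (rule par_r(2)[OF that(2)])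
    finally have "r \<beta> = - r \<beta>" using that(3) by (simp only:)
    then have "r \<beta> + r \<beta> = 0" by (simp only: eq_neg_iff_add_eq_0)
    then have "2 * r \<beta> = 0" by (simp only: mult_2)
    then show False using r_nonzero[OF that(1)] by simp
  qed
  then show ?thesis by blast
qed

lemma finite_V: "finite (V n)"
  by (induction n) (simp_all add: V_0 V_Suc_eq)

lemma card_V: "card (V n) = 2 ^ n"
proof (induction n)
  case (Suc n)
  then show ?case
    using r_disjoint[of n] finite_V[of n] inj_r[of n]
    by (simp add: V_Suc_eq card_Un_disjoint card_image)
qed (simp add: V_0)

definition Kf :: "nat \<Rightarrow> qbar set" where "Kf n = K_fin phi n"

lemma Kf_eq: "Kf n = gen_field (\<rat> \<union> V n)"
  by (simp add: Kf_def K_fin_def generate_field_eq_gen_field)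

lemma Kf_field: "is_field (Kf n)"
  by (simp add: Kf_eq is_field_gen_field)

lemma Rats_Kf: "\<rat> \<subseteq> Kf n"
  by (rule Rats_subset_is_field[OF Kf_field])

lemma V_Kf: "V n \<subseteq> Kf n"
  unfolding Kf_eq using gen_field_incl by blast

lemma Kf_0: "Kf 0 = \<rat>"
proof -
  have "\<rat> \<union> {0} = (\<rat> :: qbar set)" by auto
  then show ?thesis by (simp only: Kf_eq V_0 gen_field_field[OF Rats_is_field])
qed

lemma par_field: "is_field K \<Longrightarrow> z \<in> K \<Longrightarrow> par z \<in> K"
  unfolding par_def using Rats_subset_is_field[of K] C_Rats
  by (intro is_field_diff is_field_divide is_field_closed(2,4) is_field_power is_field_numeral) auto

lemma V_Kf_Suc: "V n \<subseteq> Kf (Suc n)"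
proof
  fix \<beta> assume \<beta>: "\<beta> \<in> V n"
  have "r \<beta> \<in> Kf (Suc n)" "par (r \<beta>) = \<beta>"
    using r_in_V(1)[OF \<beta>] V_Kf[of "Suc n"] par_r(1)[OF \<beta>] by blast+
  then show "\<beta> \<in> Kf (Suc n)" using par_field[OF Kf_field, of "r \<beta>" "Suc n"] by simp
qed

lemma Kf_Suc_mono: "Kf n \<subseteq> Kf (Suc n)"
  unfolding Kf_eq[of n] using Rats_Kf V_Kf_Suc by (intro gen_field_min Kf_field) blast

lemma Kf_mono: "k \<le> n \<Longrightarrow> Kf k \<subseteq> Kf n"
  by (rule lift_Suc_mono_le[of Kf]) (rule Kf_Suc_mono)

lemma r_sq_Kf: "\<beta> \<in> V n \<Longrightarrow> (r \<beta>)\<^sup>2 \<in> Kf n"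
  unfolding r_sq using V_Kf[of n] C_Rats Rats_Kf[of n]
  by (intro is_field_divide is_field_diff is_field_closed(2,4) is_field_power is_field_numeral Kf_field) auto

lemma Kf_Suc: "Kf (Suc n) = gen_field (Kf n \<union> r ` V n)"
proof
  have "V (Suc n) \<subseteq> gen_field (Kf n \<union> r ` V n)"
    unfolding V_Suc_eq using gen_field_incl[of "Kf n \<union> r ` V n"] is_field_closed(5)[OF is_field_gen_field] by blast
  then show "Kf (Suc n) \<subseteq> gen_field (Kf n \<union> r ` V n)"
    unfolding Kf_eq[of "Suc n"]
    using Rats_subset_is_field[OF is_field_gen_field] by (intro gen_field_min is_field_gen_field) blast
  show "gen_field (Kf n \<union> r ` V n) \<subseteq> Kf (Suc n)"
    using Kf_Suc_mono[of n] r_in_V(1)[of _ n] V_Kf[of "Suc n"] by (intro gen_field_min Kf_field) blast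
qed

text \<open>
  The radicands of the square roots adjoined to the level n field are independent modulo squares.
\<close>

definition kummer_indep :: "nat \<Rightarrow> bool" where
  "kummer_indep n \<longleftrightarrow> (\<forall>W\<subseteq>V n. prod r W \<in> Kf n \<longrightarrow> W = {})"

lemma kummer_indep_roots:
  assumes "kummer_indep n"
  shows "indep (Kf n) (r ` V n)"
  unfolding indep_def
proof (intro allI impI)
  fix B assume B: "B \<subseteq> r ` V n" "\<Prod>B \<in> Kf n"
  then obtain W where W: "W \<subseteq> V n" "B = r ` W" by (auto simp: subset_image_iff)
  have "\<Prod>B = prod r W"
    unfolding W(2) using inj_on_subset[OF inj_r(1) W(1)] by (simp add: prod.reindex)
  then show "B = {}" using assms B W unfolding kummer_indep_def by auto
qed

lemma dimension_Kf:
  assumes "kummer_indep n"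
  shows "ring.dimension Qbar (2 ^ (2 ^ n)) (Kf n) (Kf (Suc n))"
proof -
  have "ring.dimension Qbar (2 ^ card (r ` V n)) (Kf n) (gen_field (Kf n \<union> r ` V n))"
    using r_sq_Kf by (intro dimension_multiquadratic Kf_field kummer_indep_roots assms) (auto simp: finite_V)
  then show ?thesis using inj_r(1)[of n] by (simp add: Kf_Suc card_image card_V)
qed

lemma fhom_par:
  assumes "is_field K" "fhom K \<tau>" "z \<in> K"
  shows "\<tau> (par z) = par (\<tau> z)"
proof -
  have C: "C \<in> K" "2 * C\<^sup>2 \<in> K" "2 * C\<^sup>2 / z\<^sup>2 \<in> K" "2 * C\<^sup>2 \<in> \<rat>"
    using Rats_subset_is_field[OF assms(1)] C_Rats assms(3)
    by (auto intro!: is_field_closed(4) is_field_divide is_field_power is_field_numeral assms(1))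
  then show ?thesis
    using assms is_field_power[OF assms(1,3), of 2] is_field_closed(2)[OF assms(1)] fhom_Rats[OF assms(1,2) C(4)]
    by (simp add: par_def fhom_diff fhom_divide fhom_power fhom_simps(1))
qed

lemma fhom_V:
  assumes "fhom (Kf n) \<tau>" "k \<le> n" "\<beta> \<in> V k"
  shows "\<tau> \<beta> \<in> V k"
  using assms(2,3)
proof (induction k arbitrary: \<beta>)
  case 0
  then show ?case using fhom_0[OF Kf_field assms(1)] by (simp add: V_0)
next
  case (Suc k)
  have \<beta>: "\<beta> \<in> Kf n" using Suc.prems V_Kf Kf_mono by blast
  have "\<beta> \<noteq> 0" "par \<beta> \<in> V k" using Suc.prems by (auto simp: V_Suc)
  then have "par (\<tau> \<beta>) \<in> V k" using Suc.IH[of "par \<beta>"] Suc.prems fhom_par[OF Kf_field assms(1) \<beta>] by simp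
  moreover have "\<tau> \<beta> \<noteq> 0"
    using inj_onD[OF fhom_inj[OF Kf_field assms(1)], of \<beta> 0] \<beta> \<open>\<beta> \<noteq> 0\<close>
      fhom_0[OF Kf_field assms(1)] is_field_closed(1)[OF Kf_field] by metis
  ultimately show ?case by (simp add: V_Suc)
qed

lemma fhom_bij_V:
  assumes "fhom (Kf n) \<tau>" "k \<le> n"
  shows "inj_on \<tau> (V k)" "\<tau> ` V k = V k"
proof -
  have "V k \<subseteq> Kf n" using V_Kf Kf_mono[OF assms(2)] by blast
  then show i: "inj_on \<tau> (V k)" using fhom_inj[OF Kf_field assms(1)] inj_on_subset by blast
  have "\<tau> ` V k \<subseteq> V k" using fhom_V[OF assms] by blast
  then show "\<tau> ` V k = V k" using i finite_V by (simp add: endo_inj_surj)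
qed

lemma fhom_Kf_subset:
  assumes "fhom (Kf n) \<tau>"
  shows "\<tau> ` Kf n \<subseteq> Kf n"
proof -
  have "\<tau> x \<in> Kf n" if "x \<in> \<rat>" for x
    unfolding fhom_Rats[OF Kf_field assms that] using that Rats_Kf by blast
  moreover have "\<tau> x \<in> Kf n" if "x \<in> V n" for x
    using fhom_V[OF assms order_refl that] V_Kf by blast
  ultimately have "\<tau> ` (\<rat> \<union> V n) \<subseteq> Kf n" by blast
  then show ?thesis using gen_field_fhom_subset[of "\<rat> \<union> V n" \<tau> "Kf n"] assms Kf_field by (simp add: Kf_eq)
qed

lemma fhom_r_sq:
  assumes "fhom (Kf n) \<tau>" "\<beta> \<in> V n"
  shows "\<tau> ((r \<beta>)\<^sup>2) = 2 * C\<^sup>2 / (1 - \<tau> \<beta>)"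
proof -
  have b: "\<beta> \<in> Kf n" "1 - \<beta> \<in> Kf n" "2 * C\<^sup>2 \<in> \<rat>" "2 * C\<^sup>2 \<in> Kf n"
    using assms(2) V_Kf is_field_diff[OF Kf_field is_field_closed(2)[OF Kf_field]] C_Rats Rats_Kf[of n] by auto
  then show ?thesis unfolding r_sq
    using fhom_Rats[OF Kf_field assms(1) b(3)] is_field_closed(2)[OF Kf_field]
    by (simp add: fhom_divide[OF Kf_field assms(1)] fhom_diff[OF Kf_field assms(1)] fhom_simps(1)[OF Kf_field assms(1)])
qed

text \<open>
  The Kummer independence at level n allows any choice of children for the images of the vertices of
  level n.
\<close>

lemma extend_step:
  assumes "kummer_indep n" "fhom (Kf n) \<tau>" "\<And>\<beta>. \<beta> \<in> V n \<Longrightarrow> (y \<beta>)\<^sup>2 = 2 * C\<^sup>2 / (1 - \<tau> \<beta>)"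
  shows "\<exists>\<tau>'. fhom (Kf (Suc n)) \<tau>' \<and> (\<forall>x\<in>Kf n. \<tau>' x = \<tau> x) \<and> (\<forall>\<beta>\<in>V n. \<tau>' (r \<beta>) = y \<beta>)"
proof -
  have "\<exists>\<tau>'. fhom (gen_field (Kf n \<union> r ` V n)) \<tau>' \<and> (\<forall>a\<in>Kf n. \<tau>' a = \<tau> a) \<and> (\<forall>x\<in>r ` V n. \<tau>' x = y (par x))"
  proof (rule fhom_extend_multiquadratic[OF Kf_field assms(2) _ kummer_indep_roots[OF assms(1)]])
    show "finite (r ` V n)" by (simp add: finite_V)
    show "x\<^sup>2 \<in> Kf n" if "x \<in> r ` V n" for x using that r_sq_Kf by auto
    show "(y (par x))\<^sup>2 = \<tau> (x\<^sup>2)" if "x \<in> r ` V n" for x using that fhom_r_sq[OF assms(2)] assms(3) par_r by auto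
  qed
  then show ?thesis unfolding Kf_Suc using par_r by force
qed

lemma extend_lift:
  assumes "k \<le> n" "\<And>i. k \<le> i \<Longrightarrow> i < n \<Longrightarrow> kummer_indep i" "fhom (Kf k) \<tau>"
  shows "\<exists>\<tau>'. fhom (Kf n) \<tau>' \<and> (\<forall>x\<in>Kf k. \<tau>' x = \<tau> x)"
  using assms(1,2)
proof (induction n rule: dec_induct)
  case base
  then show ?case using assms(3) by blast
next
  case (step n)
  then obtain \<tau>1 where 1: "fhom (Kf n) \<tau>1" "\<forall>x\<in>Kf k. \<tau>1 x = \<tau> x" by auto
  have "kummer_indep n" using step by simp
  from extend_step[OF this 1(1), of "\<lambda>\<beta>. r (\<tau>1 \<beta>)"]
  obtain \<tau>' where "fhom (Kf (Suc n)) \<tau>'" "\<forall>x\<in>Kf n. \<tau>' x = \<tau>1 x" by (auto simp: r_sq)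
  then show ?case using 1(2) Kf_mono[OF step(1)] by (intro exI[of _ \<tau>']) auto
qed

lemma fhom_id: "fhom K (\<lambda>x. x)" by (simp add: fhom_def)

end

context arboreal
begin

section \<open>Relations between the square roots\<close>

text \<open>
  The sets W that violate independence. They form a vector space over the field with two elements,
  with symmetric difference as addition, on which the Galois group of level n acts.
\<close>

definition relation :: "nat \<Rightarrow> qbar set \<Rightarrow> bool" where
  "relation n W \<longleftrightarrow> W \<subseteq> V n \<and> prod r W \<in> Kf n"

lemma kummer_indep_iff: "kummer_indep n \<longleftrightarrow> (\<forall>W. relation n W \<longrightarrow> W = {})"
  by (auto simp: kummer_indep_def relation_def)

lemma prod_r_nonzero: "W \<subseteq> V n \<Longrightarrow> prod r W \<noteq> 0"
  using finite_subset[OF _ finite_V] r_nonzero by (auto simp: prod_zero_iff)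

lemma prod_r_sq_Kf: "W \<subseteq> V n \<Longrightarrow> (prod r W)\<^sup>2 \<in> Kf n"
  unfolding prod_power_distrib using r_sq_Kf by (intro is_field_prod[OF Kf_field]) auto

lemma relation_symdiff_product:
  assumes "W \<subseteq> V n" "W' \<subseteq> V n" "prod r W * prod r W' \<in> Kf n"
  shows "relation n ((W - W') \<union> (W' - W))"
proof -
  have fin: "finite W" "finite W'" using assms finite_subset finite_V by blast+
  let ?p = "\<lambda>W. \<Prod>\<beta>\<in>W. r \<beta>"
  have "?p W = ?p (W - W') * ?p (W \<inter> W')" "?p W' = ?p (W' - W) * ?p (W \<inter> W')"
    using prod.subset_diff[of "W \<inter> W'" W r] prod.subset_diff[of "W \<inter> W'" W' r] fin
    by (simp_all add: Diff_Int Int_commute)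
  moreover have "?p ((W - W') \<union> (W' - W)) = ?p (W - W') * ?p (W' - W)"
    using fin by (intro prod.union_disjoint) auto
  ultimately have "?p W * ?p W' = ?p ((W - W') \<union> (W' - W)) * (?p (W \<inter> W'))\<^sup>2"
    by (simp add: power2_eq_square mult_ac)
  moreover have i: "W \<inter> W' \<subseteq> V n" using assms by blast
  ultimately have "?p ((W - W') \<union> (W' - W)) * (?p (W \<inter> W'))\<^sup>2 \<in> Kf n" using assms(3) by simp
  then have "?p ((W - W') \<union> (W' - W)) \<in> Kf n"
    using is_field_mult_cancel[OF Kf_field prod_r_sq_Kf[OF i]] prod_r_nonzero[OF i] by simp
  then show ?thesis using assms by (auto simp: relation_def)
qed

lemma relation_symdiff: "relation n W \<Longrightarrow> relation n W' \<Longrightarrow> relation n ((W - W') \<union> (W' - W))"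
  using is_field_closed(4)[OF Kf_field] by (intro relation_symdiff_product) (auto simp: relation_def)

text \<open>
  The roots r \<beta> need not lie in the level n field, so \<tau> is applied to their squares; this
  still determines the products up to sign.
\<close>

lemma prod_r_image_sq:
  assumes "fhom (Kf n) \<tau>" "W \<subseteq> V n"
  shows "(prod r (\<tau> ` W))\<^sup>2 = \<tau> ((prod r W)\<^sup>2)"
proof -
  have "prod r (\<tau> ` W) = (\<Prod>\<beta>\<in>W. r (\<tau> \<beta>))"
    using inj_on_subset[OF fhom_bij_V(1)[OF assms(1) order_refl] assms(2)] by (simp add: prod.reindex)
  then have "(prod r (\<tau> ` W))\<^sup>2 = (\<Prod>\<beta>\<in>W. (r (\<tau> \<beta>))\<^sup>2)" by (simp only: prod_power_distrib)
  also have "\<dots> = (\<Prod>\<beta>\<in>W. \<tau> ((r \<beta>)\<^sup>2))"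
  proof (rule prod.cong[OF refl])
    fix \<beta> assume "\<beta> \<in> W"
    then have "\<beta> \<in> V n" using assms(2) by blast
    then show "(r (\<tau> \<beta>))\<^sup>2 = \<tau> ((r \<beta>)\<^sup>2)" by (simp only: fhom_r_sq[OF assms(1)] r_sq[of "\<tau> \<beta>"])
  qed
  also have "\<dots> = \<tau> ((prod r W)\<^sup>2)"
    unfolding prod_power_distrib using assms(2) r_sq_Kf
    by (intro fhom_prod[OF Kf_field assms(1), symmetric]) auto
  finally show ?thesis .
qed

lemma relation_image:
  assumes "fhom (Kf n) \<tau>" "relation n W"
  shows "relation n (\<tau> ` W)"
proof -
  have W: "W \<subseteq> V n" "prod r W \<in> Kf n" using assms(2) by (auto simp: relation_def)
  have "(prod r (\<tau> ` W))\<^sup>2 = (\<tau> (prod r W))\<^sup>2"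
    using prod_r_image_sq[OF assms(1) W(1)] fhom_power[OF Kf_field assms(1) W(2)] by simp
  then have "prod r (\<tau> ` W) = \<tau> (prod r W) \<or> prod r (\<tau> ` W) = - \<tau> (prod r W)"
    by (simp only: power2_eq_iff)
  moreover have "\<tau> (prod r W) \<in> Kf n" using fhom_Kf_subset[OF assms(1)] W(2) by blast
  ultimately have "prod r (\<tau> ` W) \<in> Kf n" using is_field_closed(5)[OF Kf_field] by metis
  moreover have "\<tau> ` W \<subseteq> V n" using fhom_V[OF assms(1) order_refl] W(1) by blast
  ultimately show ?thesis by (simp add: relation_def)
qed

section \<open>Descent to the full relation\<close>

definition descendants :: "nat \<Rightarrow> nat \<Rightarrow> qbar set \<Rightarrow> qbar set" where
  "descendants n j W = {\<beta> \<in> V n. (par ^^ j) \<beta> \<in> W}"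

lemma par_iterate_V: "j \<le> n \<Longrightarrow> \<beta> \<in> V n \<Longrightarrow> (par ^^ j) \<beta> \<in> V (n - j)"
proof (induction j)
  case (Suc j)
  then have "(par ^^ j) \<beta> \<in> V (Suc (n - Suc j))" by (simp add: Suc_diff_Suc)
  then show ?case using par_in_V by simp
qed simp

lemma fhom_par_iterate:
  assumes "fhom (Kf n) \<tau>" "\<beta> \<in> V n" "j \<le> n"
  shows "\<tau> ((par ^^ j) \<beta>) = (par ^^ j) (\<tau> \<beta>)"
  using assms(3)
proof (induction j)
  case (Suc j)
  have "(par ^^ j) \<beta> \<in> V (n - j)" using Suc.prems assms(2) by (intro par_iterate_V) simp_all
  then have "(par ^^ j) \<beta> \<in> Kf n" using V_Kf[of "n - j"] Kf_mono[of "n - j" n] by auto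
  from fhom_par[OF Kf_field assms(1) this] show ?case using Suc by simp
qed simp

lemma descendants_image:
  assumes "fhom (Kf n) \<tau>" "j \<le> n" "W \<subseteq> V (n - j)"
  shows "\<tau> ` descendants n j W = descendants n j (\<tau> ` W)"
proof
  show "\<tau> ` descendants n j W \<subseteq> descendants n j (\<tau> ` W)"
  proof
    fix x assume "x \<in> \<tau> ` descendants n j W"
    then obtain \<beta> where b: "x = \<tau> \<beta>" "\<beta> \<in> V n" "(par ^^ j) \<beta> \<in> W" by (auto simp: descendants_def)
    have "(par ^^ j) (\<tau> \<beta>) = \<tau> ((par ^^ j) \<beta>)" using fhom_par_iterate[OF assms(1) b(2) assms(2)] by simp
    then have "(par ^^ j) (\<tau> \<beta>) \<in> \<tau> ` W" using b(3) by blast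
    then show "x \<in> descendants n j (\<tau> ` W)" using fhom_V[OF assms(1) order_refl b(2)] by (simp add: descendants_def b(1))
  qed
  show "descendants n j (\<tau> ` W) \<subseteq> \<tau> ` descendants n j W"
  proof
    fix x assume "x \<in> descendants n j (\<tau> ` W)"
    then have x: "x \<in> V n" "(par ^^ j) x \<in> \<tau> ` W" by (auto simp: descendants_def)
    obtain \<beta> where b: "x = \<tau> \<beta>" "\<beta> \<in> V n" using fhom_bij_V(2)[OF assms(1) order_refl] x(1) by blast
    obtain w where w: "(par ^^ j) x = \<tau> w" "w \<in> W" using x(2) by blast
    have "\<tau> ((par ^^ j) \<beta>) = \<tau> w" using fhom_par_iterate[OF assms(1) b(2) assms(2)] w(1) b(1) by simp
    then have "(par ^^ j) \<beta> = w"
      using inj_onD[OF fhom_bij_V(1)[OF assms(1), of "n - j"]] par_iterate_V[OF assms(2) b(2)] w(2) assms(3) by auto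
    then show "x \<in> \<tau> ` descendants n j W" using b w(2) by (auto simp: descendants_def)
  qed
qed

text \<open>
  Independence at level k allows a single square root to change its sign while all others stay
  fixed.
\<close>

lemma swap_siblings_exists:
  assumes "kummer_indep k" "w \<in> V (Suc k)"
  shows "\<exists>\<tau>. fhom (Kf (Suc k)) \<tau> \<and> \<tau> w = - w \<and> \<tau> (- w) = w \<and> (\<forall>z\<in>V (Suc k). z \<noteq> w \<longrightarrow> z \<noteq> - w \<longrightarrow> \<tau> z = z)"
proof -
  define y where "y \<beta> = (if \<beta> = par w then - r \<beta> else r \<beta>)" for \<beta>
  have "(y \<beta>)\<^sup>2 = 2 * C\<^sup>2 / (1 - \<beta>)" for \<beta> by (simp add: y_def r_sq)
  then obtain \<tau> where t: "fhom (Kf (Suc k)) \<tau>" "\<forall>x\<in>Kf k. \<tau> x = x" "\<forall>\<beta>\<in>V k. \<tau> (r \<beta>) = y \<beta>"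
    using extend_step[OF assms(1) fhom_id, of y] by auto
  have t': "\<tau> z = (if par z = par w then - z else z)" if "z \<in> V (Suc k)" for z
  proof -
    have p: "par z \<in> V k" using par_in_V[OF that] .
    have "r (par z) \<in> Kf (Suc k)" using r_in_V(1)[OF p] V_Kf by blast
    then have "\<tau> (- r (par z)) = - \<tau> (r (par z))" by (rule fhom_uminus[OF Kf_field t(1)])
    then have "\<tau> (r (par z)) = y (par z)" "\<tau> (- r (par z)) = - y (par z)" using t(3) p by simp_all
    then show ?thesis using V_Suc_cases[OF that] by (auto simp: y_def)
  qed
  have w': "- w \<in> V (Suc k)" using assms(2) by (simp add: V_Suc par_def)
  have "par (- w) = par w" by (simp add: par_def)
  then show ?thesis
    using t(1) t'[OF assms(2)] t'[OF w'] t' par_eq_iff[OF _ assms(2)] by (intro exI[of _ \<tau>]) auto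
qed

text \<open>
  By induction on j there is a relation consisting of all descendants of a nonempty set W of
  vertices j levels up. If W is closed under taking siblings, pass to the parents. If w belongs to
  W but its sibling does not, swap the two: the difference of the relation and its image consists
  of the descendants of w and - w, which are the descendants of their parent.
\<close>

lemma descent:
  assumes kummer_indep: "\<And>k. k < n \<Longrightarrow> kummer_indep k" and W: "relation n W" "W \<noteq> {}" and "j \<le> n"
  shows "\<exists>W'\<subseteq>V (n - j). W' \<noteq> {} \<and> relation n (descendants n j W')"
  using assms(4)
proof (induction j)
  case 0
  have "descendants n 0 W = W" using W by (auto simp: descendants_def relation_def)
  then show ?case using W by (intro exI[of _ W]) (auto simp: relation_def)
next
  case (Suc j)
  define k where "k = n - Suc j"
  have k: "n - j = Suc k" "k < n" using Suc.prems by (auto simp: k_def)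
  obtain W where W: "W \<subseteq> V (Suc k)" "W \<noteq> {}" "relation n (descendants n j W)" using Suc k(1) by auto
  have it: "(par ^^ j) \<beta> \<in> V (Suc k)" if "\<beta> \<in> V n" for \<beta>
    using par_iterate_V[OF _ that, of j] Suc.prems k(1) by simp
  show ?case
  proof (cases "\<forall>w\<in>W. - w \<in> W")
    case True
    have "descendants n (Suc j) (par ` W) = descendants n j W"
    proof -
      have "(par ^^ Suc j) \<beta> \<in> par ` W \<longleftrightarrow> (par ^^ j) \<beta> \<in> W" if "\<beta> \<in> V n" for \<beta>
      proof
        assume "(par ^^ Suc j) \<beta> \<in> par ` W"
        then obtain w where w: "par ((par ^^ j) \<beta>) = par w" "w \<in> W" by auto
        then have "(par ^^ j) \<beta> = w \<or> (par ^^ j) \<beta> = - w" using par_eq_iff[OF it[OF that]] W(1) by blast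
        then show "(par ^^ j) \<beta> \<in> W" using True w(2) by auto
      qed simp
      then show ?thesis by (auto simp only: descendants_def)
    qed
    moreover have "par ` W \<subseteq> V k" using W(1) par_in_V by blast
    ultimately show ?thesis using W by (intro exI[of _ "par ` W"]) (simp add: k_def)
  next
    case False
    then obtain w where w: "w \<in> W" "- w \<notin> W" by blast
    have wV: "w \<in> V (Suc k)" using w W by blast
    obtain \<tau>0 where t0: "fhom (Kf (Suc k)) \<tau>0" "\<tau>0 w = - w" "\<tau>0 (- w) = w"
        "\<And>z. z \<in> V (Suc k) \<Longrightarrow> z \<noteq> w \<Longrightarrow> z \<noteq> - w \<Longrightarrow> \<tau>0 z = z"
      using swap_siblings_exists[OF kummer_indep[OF k(2)] wV] by blast
    have "Suc k \<le> n" using k by simp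
    then obtain \<tau> where t: "fhom (Kf n) \<tau>" "\<forall>x\<in>Kf (Suc k). \<tau> x = \<tau>0 x"
      using extend_lift[OF _ _ t0(1), of n] kummer_indep by auto
    have tz: "\<tau> z = (if z = w then - w else z)" if "z \<in> W" for z
    proof -
      have "z \<in> V (Suc k)" "z \<noteq> - w" using that W(1) w(2) by auto
      then show ?thesis using t0(2,4) t(2) V_Kf[of "Suc k"] by auto
    qed
    have im: "\<tau> ` W = insert (- w) (W - {w})" using tz w by force
    have "\<tau> ` descendants n j W = descendants n j (\<tau> ` W)"
      using t(1) W(1) Suc.prems k(1) by (intro descendants_image) auto
    then have R2: "relation n (descendants n j (insert (- w) (W - {w})))" using relation_image[OF t(1) W(3)] im by simp
    have w0: "w \<noteq> - w" using w by auto
    have sd: "(descendants n j W - descendants n j (insert (- w) (W - {w}))) \<union> (descendants n j (insert (- w) (W - {w})) - descendants n j W) = descendants n j {w, - w}"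
      using w w0 by (auto simp: descendants_def)
    have "descendants n (Suc j) {par w} = descendants n j {w, - w}"
      using par_eq_iff[OF it wV] by (auto simp: descendants_def)
    then have "relation n (descendants n (Suc j) {par w})" using relation_symdiff[OF W(3) R2] sd by simp
    moreover have "par w \<in> V k" using par_in_V[OF wV] .
    ultimately show ?thesis by (intro exI[of _ "{par w}"]) (simp add: k_def)
  qed
qed

text \<open>
  The descent ends at the root, whose descendants make up the whole level.
\<close>

lemma full_relation:
  assumes "\<And>k. k < n \<Longrightarrow> kummer_indep k" "\<not> kummer_indep n"
  shows "relation n (V n)"
proof -
  obtain W where "relation n W" "W \<noteq> {}" using assms(2) kummer_indep_iff by auto
  then obtain W' where W': "W' \<subseteq> V 0" "W' \<noteq> {}" "relation n (descendants n n W')"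
    using descent[where n = n and W = W and j = n] assms(1) by auto
  then have "W' = {0}" by (auto simp: V_0)
  moreover have "descendants n n {0} = V n" using par_iterate_V[of n n] by (auto simp: descendants_def V_0)
  ultimately show ?thesis using W' by simp
qed

section \<open>Norms and rational squares\<close>

definition fibre_prod :: "nat \<Rightarrow> qbar \<Rightarrow> qbar" where "fibre_prod n y = (\<Prod>\<beta>\<in>V n. y - \<beta>)"

lemma fibre_prod_Suc:
  assumes "y \<noteq> 0"
  shows "fibre_prod (Suc n) y = y ^ (2 * 2 ^ n) * fibre_prod n (par y) / fibre_prod n 1"
proof -
  have "fibre_prod (Suc n) y = (\<Prod>\<beta>\<in>V n. y - r \<beta>) * (\<Prod>\<beta>\<in>V n. y - - r \<beta>)"
    unfolding fibre_prod_def V_Suc_eq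
    by (subst prod.union_disjoint) (use finite_V r_disjoint inj_r in \<open>simp_all add: prod.reindex\<close>)
  also have "\<dots> = (\<Prod>\<beta>\<in>V n. y\<^sup>2 * (par y - \<beta>) / (1 - \<beta>))"
    unfolding prod.distrib[symmetric]
  proof (rule prod.cong[OF refl])
    fix \<beta> assume "\<beta> \<in> V n"
    then have b: "1 - \<beta> \<noteq> 0" using one_notin_V by auto
    have "y\<^sup>2 * (par y - \<beta>) = y\<^sup>2 * (1 - \<beta>) - 2 * C\<^sup>2" using assms by (simp add: par_def algebra_simps)
    then have "y\<^sup>2 * (par y - \<beta>) / (1 - \<beta>) = y\<^sup>2 - 2 * C\<^sup>2 / (1 - \<beta>)" using b by (simp add: diff_divide_distrib)
    also have "\<dots> = (y - r \<beta>) * (y - - r \<beta>)" by (simp only: r_sq[symmetric]) (simp add: power2_eq_square algebra_simps)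
    finally show "(y - r \<beta>) * (y - - r \<beta>) = y\<^sup>2 * (par y - \<beta>) / (1 - \<beta>)" by simp
  qed
  also have "\<dots> = y ^ (2 * 2 ^ n) * fibre_prod n (par y) / fibre_prod n 1"
    by (simp add: fibre_prod_def prod_dividef prod.distrib card_V power_mult)
  finally show ?thesis .
qed

text \<open>
  Up to constants, fibre_prod n is the numerator of the n-th iterate of \<phi>, so its values along
  the orbit of infinity are given by the later terms of the orbit.
\<close>

lemma fibre_prod_orbit:
  assumes "k \<ge> 1"
  shows "fibre_prod n (l (k + 1) / (l k)\<^sup>2) * l k ^ (2 * 2 ^ n) = l (n + k + 1) / l (n + 1)"
  using assms
proof (induction n arbitrary: k)
  case 0
  then show ?case using l_nonzero[of k] by (simp add: fibre_prod_def V_0 power2_eq_square del: crit.simps(3))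
next
  case (Suc n)
  define y where "y = l (k + 1) / (l k)\<^sup>2"
  have nz: "l k \<noteq> 0" "l (k + 1) \<noteq> 0" "l (n + 1) \<noteq> 0" "l (n + 2) \<noteq> 0"
    using Suc.prems by (auto intro!: l_nonzero simp del: crit.simps of_int_eq_0_iff)
  then have y: "y \<noteq> 0" by (simp add: y_def del: crit.simps)
  have P1: "fibre_prod n 1 = l (n + 2) / l (n + 1)" using Suc.IH[of 1] by (simp add: numeral_2_eq_2)
  have "fibre_prod n (l (k + 2) / (l (k + 1))\<^sup>2) * l (k + 1) ^ (2 * 2 ^ n) = l (n + (k + 1) + 1) / l (n + 1)"
    using Suc.IH[of "k + 1"] by (simp del: crit.simps)
  then have "fibre_prod n (par y) * l (k + 1) ^ (2 * 2 ^ n) = l (Suc n + k + 1) / l (n + 1)"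
    using par_orbit[OF Suc.prems] by (simp add: y_def del: crit.simps)
  moreover have "y ^ (2 * 2 ^ n) * l k ^ (2 * 2 ^ Suc n) = l (k + 1) ^ (2 * 2 ^ n)"
    using nz(1) by (simp add: y_def power_divide mult.assoc del: crit.simps flip: power_mult)
  ultimately have "y ^ (2 * 2 ^ n) * l k ^ (2 * 2 ^ Suc n) * fibre_prod n (par y) = l (Suc n + k + 1) / l (n + 1)"
    by (simp only: mult.commute)
  moreover have "fibre_prod (Suc n) y * l k ^ (2 * 2 ^ Suc n) = (y ^ (2 * 2 ^ n) * l k ^ (2 * 2 ^ Suc n) * fibre_prod n (par y)) / fibre_prod n 1"
    by (simp add: fibre_prod_Suc[OF y] mult_ac del: crit.simps)
  ultimately have "fibre_prod (Suc n) y * l k ^ (2 * 2 ^ Suc n) = (l (Suc n + k + 1) / l (n + 1)) / (l (n + 2) / l (n + 1))"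
    by (simp only: P1)
  then show ?case using nz by (simp add: y_def numeral_2_eq_2 del: crit.simps)
qed

text \<open>
  A square root of the product of the radicands 2c^2/(1-\<beta>) over all \<beta> of level n. This
  product is a norm when the Galois group acts transitively on the level.
\<close>

definition \<rho> :: "nat \<Rightarrow> qbar" where "\<rho> n = prod r (V n)"

text \<open>
  The denominator is fibre_prod n evaluated at 1, the image of infinity.
\<close>

lemma rho_sq: "(\<rho> n)\<^sup>2 = (2 * C\<^sup>2) ^ (2 ^ n) * (l (n + 1) / l (n + 2))"
proof -
  have "(\<rho> n)\<^sup>2 = (2 * C\<^sup>2) ^ (2 ^ n) / fibre_prod n 1"
    by (simp only: \<rho>_def fibre_prod_def prod_power_distrib r_sq prod_dividef prod_constant card_V)
  moreover have "fibre_prod n 1 = l (n + 2) / l (n + 1)"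
    using fibre_prod_orbit[of 1 n] by (simp add: numeral_2_eq_2)
  ultimately show ?thesis by simp
qed

lemma rho_sq_Rats: "(\<rho> n)\<^sup>2 \<in> \<rat>"
  unfolding rho_sq using C_Rats by simp

text \<open>
  Lift an automorphism that takes the parent of \<beta> to the parent of \<gamma>, prescribing
  \<gamma> as the image of \<beta>.
\<close>

lemma Galois_transitive_on_level:
  assumes "\<And>i. i < k \<Longrightarrow> kummer_indep i" "\<beta> \<in> V k" "\<gamma> \<in> V k"
  shows "\<exists>\<tau>. fhom (Kf k) \<tau> \<and> \<tau> \<beta> = \<gamma>"
  using assms
proof (induction k arbitrary: \<beta> \<gamma>)
  case 0
  then show ?case using fhom_id by (auto simp: V_0)
next
  case (Suc k)
  note b = par_in_V[OF Suc.prems(2)] and g = par_in_V[OF Suc.prems(3)]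
  obtain \<tau>0 where t0: "fhom (Kf k) \<tau>0" "\<tau>0 (par \<beta>) = par \<gamma>" using Suc.IH[OF _ b g] Suc.prems(1) by auto
  have gsq: "\<gamma>\<^sup>2 = 2 * C\<^sup>2 / (1 - par \<gamma>)" using V_Suc_cases[OF Suc.prems(3)] r_sq[of "par \<gamma>"] by (metis power2_minus)
  \<comment> \<open>The sign with \<beta> = s r (par \<beta>); hence r (par \<beta>) has to be sent to s
    \<gamma>.\<close>
  define s :: qbar where "s = (if \<beta> = r (par \<beta>) then 1 else -1)"
  have s: "\<beta> = s * r (par \<beta>)" "s * s = 1" using V_Suc_cases[OF Suc.prems(2)] by (auto simp: s_def)
  define y where "y b = (if b = par \<beta> then s * \<gamma> else r (\<tau>0 b))" for b
  have "(s * \<gamma>)\<^sup>2 = \<gamma>\<^sup>2" by (simp add: s_def)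
  then have "(y b)\<^sup>2 = 2 * C\<^sup>2 / (1 - \<tau>0 b)" for b using t0(2) gsq by (simp add: y_def r_sq)
  moreover have "kummer_indep k" using Suc.prems(1) by simp
  ultimately obtain \<tau> where t: "fhom (Kf (Suc k)) \<tau>" "\<forall>b\<in>V k. \<tau> (r b) = y b"
    using extend_step[OF _ t0(1), of y] by auto
  have "\<tau> \<beta> = \<tau> (s * r (par \<beta>))" using s(1) by (simp only:)
  also have "\<dots> = \<tau> s * \<tau> (r (par \<beta>))"
    using r_in_V(1)[OF b] V_Kf[of "Suc k"] Rats_Kf[of "Suc k"]
    by (intro fhom_simps(3)[OF Kf_field t(1)]) (auto simp: s_def)
  also have "\<tau> s = s" by (rule fhom_Rats[OF Kf_field t(1)]) (simp add: s_def)
  also have "\<tau> (r (par \<beta>)) = s * \<gamma>" using t(2) b by (simp add: y_def)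
  also have "s * (s * \<gamma>) = \<gamma>" using s(2) by (simp add: mult.assoc[symmetric])
  finally show ?case using t(1) by blast
qed

text \<open>
  The square roots of rational numbers in the tower come from the \<rho> i alone. If v lies in the
  field of level k + 1, Kummer theory gives a set W of vertices of level k with v times the
  product of the r \<beta> over W in the field of level k. Conjugates of v are \<plusminus> v, so
  by independence W is invariant under the Galois group, which acts transitively on the level. So
  W is empty or everything, and v or v \<rho> k lies one level below.
\<close>

lemma rational_square_in_Kf:
  assumes "\<And>i. i < k \<Longrightarrow> kummer_indep i" "v \<in> Kf k" "v\<^sup>2 \<in> \<rat>"
  shows "\<exists>S\<subseteq>{..<k}. v * (\<Prod>i\<in>S. \<rho> i) \<in> \<rat>"
  using assms
proof (induction k arbitrary: v)
  case 0
  then show ?case by (auto simp: Kf_0)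
next
  case (Suc k)
  have Hk: "kummer_indep k" using Suc.prems(1) by simp
  show ?case
  proof (cases "v = 0")
    case True then show ?thesis by auto
  next
    case v0: False
    have v2: "v\<^sup>2 \<in> Kf k" using Suc.prems(3) Rats_Kf by blast
    have "\<exists>B\<subseteq>r ` V k. v * \<Prod>B \<in> Kf k"
    proof (rule square_in_multiquadratic[OF Kf_field])
      show "v \<in> gen_field (Kf k \<union> r ` V k)" using Suc.prems(2) by (simp only: Kf_Suc)
    qed (use v2 r_sq_Kf finite_V in auto)
    then obtain W where W: "W \<subseteq> V k" "v * \<Prod>(r ` W) \<in> Kf k" by (auto simp: subset_image_iff)
    have pW: "\<Prod>(r ` W) = prod r W" using inj_on_subset[OF inj_r(1) W(1)] by (simp add: prod.reindex)
    have inv: "\<tau> ` W = W" if t: "fhom (Kf k) \<tau>" for \<tau>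
    proof -
      obtain \<tau>' where t': "fhom (Kf (Suc k)) \<tau>'" "\<forall>x\<in>Kf k. \<tau>' x = \<tau> x"
        using extend_step[OF Hk t, of "\<lambda>\<beta>. r (\<tau> \<beta>)"] by (auto simp: r_sq)
      have "(\<tau>' v)\<^sup>2 = v\<^sup>2"
        using fhom_power[OF Kf_field t'(1) Suc.prems(2), of 2] fhom_Rats[OF Kf_field t'(1) Suc.prems(3)] by simp
      then have tv: "\<tau>' v = v \<or> \<tau>' v = - v" by (simp only: power2_eq_iff)
      have pK: "prod r W \<in> Kf (Suc k)"
        using W(1) r_in_V(1)[of _ k] V_Kf[of "Suc k"] by (intro is_field_prod[OF Kf_field]) blast
      have tp: "prod r (\<tau> ` W) = \<tau>' (prod r W) \<or> prod r (\<tau> ` W) = - \<tau>' (prod r W)"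
      proof -
        have "(prod r (\<tau> ` W))\<^sup>2 = (\<tau>' (prod r W))\<^sup>2"
          using prod_r_image_sq[OF t W(1)] prod_r_sq_Kf[OF W(1)] t'(2) fhom_power[OF Kf_field t'(1) pK, of 2] by simp
        then show ?thesis by (simp only: power2_eq_iff)
      qed
      have "\<tau>' (v * prod r W) \<in> Kf k" using W(2) t'(2) fhom_Kf_subset[OF t] pW by auto
      then have "\<tau>' v * \<tau>' (prod r W) \<in> Kf k" using fhom_simps(3)[OF Kf_field t'(1) Suc.prems(2) pK] by simp
      then have "v * prod r (\<tau> ` W) \<in> Kf k"
        using tv tp is_field_uminus_iff[OF Kf_field, of "v * \<tau>' (prod r W)" k] by auto
      then have "(v * prod r W) * (v * prod r (\<tau> ` W)) \<in> Kf k"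
        using W(2) pW is_field_closed(4)[OF Kf_field] by simp
      then have "(prod r W * prod r (\<tau> ` W)) * v\<^sup>2 \<in> Kf k"
        by (simp add: power2_eq_square mult_ac)
      then have pp: "prod r W * prod r (\<tau> ` W) \<in> Kf k"
        using is_field_mult_cancel[OF Kf_field v2] v0 by simp
      have "\<tau> ` W \<subseteq> V k" using fhom_V[OF t order_refl] W(1) by blast
      from relation_symdiff_product[OF W(1) this pp] have "(W - \<tau> ` W) \<union> (\<tau> ` W - W) = {}"
        using Hk kummer_indep_iff by blast
      then show ?thesis by blast
    qed
    have "W = {} \<or> W = V k"
    proof (rule ccontr)
      assume "\<not> (W = {} \<or> W = V k)"
      then obtain \<beta> \<gamma> where "\<beta> \<in> W" "\<gamma> \<in> V k" "\<gamma> \<notin> W" using W(1) by blast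
      moreover obtain \<tau> where "fhom (Kf k) \<tau>" "\<tau> \<beta> = \<gamma>"
        using Galois_transitive_on_level[where k = k and \<beta> = \<beta> and \<gamma> = \<gamma>] Suc.prems(1) calculation W(1) by auto
      ultimately show False using inv by blast
    qed
    then show ?thesis
    proof
      assume "W = {}"
      then have "v \<in> Kf k" using W(2) by simp
      then obtain S where "S \<subseteq> {..<k}" "v * (\<Prod>i\<in>S. \<rho> i) \<in> \<rat>" using Suc.IH[of v] Suc.prems by auto
      then show ?thesis by (intro exI[of _ S]) auto
    next
      assume "W = V k"
      then have "v * \<rho> k \<in> Kf k" using W(2) pW by (simp add: \<rho>_def)
      moreover have "(v * \<rho> k)\<^sup>2 \<in> \<rat>" using Suc.prems(3) rho_sq_Rats by (simp add: power_mult_distrib)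
      ultimately obtain S where S: "S \<subseteq> {..<k}" "v * \<rho> k * (\<Prod>i\<in>S. \<rho> i) \<in> \<rat>"
        using Suc.IH[of "v * \<rho> k"] Suc.prems(1) by auto
      then have "k \<notin> S" "finite S" using finite_subset by auto
      then have "v * (\<Prod>i\<in>insert k S. \<rho> i) \<in> \<rat>" using S(2) by (simp add: mult.assoc)
      then show ?thesis using S(1) by (intro exI[of _ "insert k S"]) auto
    qed
  qed
qed

text \<open>
  If independence fails at level n for the first time, then \<rho> n lies in the field of level n,
  and by rational_square_in_Kf the product of \<rho> n with some earlier \<rho> i is rational. Its
  square is, up to squares, a product of a power of 2, of L_(n+2) once, and of terms with smaller
  index.
\<close>

theorem Kummer_independent: "kummer_indep n"
proof (induction n rule: less_induct)
  case (less n)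
  show ?case
  proof (rule ccontr)
    assume "\<not> kummer_indep n"
    then have "\<rho> n \<in> Kf n" using full_relation[of n] less by (simp add: relation_def \<rho>_def)
    then obtain S where S: "S \<subseteq> {..<n}" "\<rho> n * (\<Prod>i\<in>S. \<rho> i) \<in> \<rat>"
      using rational_square_in_Kf[of n "\<rho> n"] less rho_sq_Rats by auto
    define T where "T = insert n S"
    have fS: "finite S" "n \<notin> S" using S(1) finite_subset by auto
    then have fT: "finite T" by (simp add: T_def)
    \<comment> \<open>Clearing denominators: q^2 is the integer (2c^2)^E times the product of the L_(i+1)
      L_(i+2).\<close>
    define q where "q = (\<Prod>i\<in>T. \<rho> i) * (\<Prod>i\<in>T. l (i + 2))"
    define E where "E = (\<Sum>i\<in>T. 2 ^ i :: nat)"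
    define I where "I = (\<Prod>i\<in>T. L (i + 1)) * (\<Prod>i\<in>S. L (i + 2))"
    have pT: "(\<Prod>i\<in>T. L (i + 2)) = L (n + 2) * (\<Prod>i\<in>S. L (i + 2))" using fS by (simp add: T_def del: crit.simps)
    have qQ: "q \<in> \<rat>"
    proof -
      have "(\<Prod>i\<in>T. \<rho> i) \<in> \<rat>" using S(2) fS by (simp add: T_def)
      moreover have "(\<Prod>i\<in>T. l (i + 2)) \<in> \<rat>" by (simp flip: of_int_prod del: crit.simps)
      ultimately show ?thesis by (simp add: q_def)
    qed
    have "q\<^sup>2 = (\<Prod>i\<in>T. (\<rho> i)\<^sup>2 * (l (i + 2))\<^sup>2)"
      by (simp add: q_def power_mult_distrib prod_power_distrib prod.distrib del: crit.simps)
    also have "\<dots> = (\<Prod>i\<in>T. (2 * C\<^sup>2) ^ (2 ^ i) * (l (i + 1) * l (i + 2)))"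
    proof (rule prod.cong[OF refl])
      fix i
      have "l (i + 2) \<noteq> 0" by (rule l_nonzero) simp
      then show "(\<rho> i)\<^sup>2 * (l (i + 2))\<^sup>2 = (2 * C\<^sup>2) ^ (2 ^ i) * (l (i + 1) * l (i + 2))"
        by (simp only: rho_sq) (simp add: power2_eq_square del: crit.simps)
    qed
    also have "\<dots> = (2 * C\<^sup>2) ^ E * ((\<Prod>i\<in>T. l (i + 1)) * (\<Prod>i\<in>T. l (i + 2)))"
      by (simp add: prod.distrib power_sum E_def del: crit.simps)
    also have "\<dots> = of_int ((2 * c\<^sup>2) ^ E * ((\<Prod>i\<in>T. L (i + 1)) * (\<Prod>i\<in>T. L (i + 2))))"
      by (simp add: C_def del: crit.simps)
    finally have "\<exists>y. (2 * c\<^sup>2) ^ E * ((\<Prod>i\<in>T. L (i + 1)) * (\<Prod>i\<in>T. L (i + 2))) = y\<^sup>2"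
      by (rule int_square_of_rat_square[OF qQ])
    then obtain y where y: "(2 * c\<^sup>2) ^ E * (L (n + 2) * I) = y\<^sup>2" unfolding pT I_def by (auto simp: mult_ac)
    show False
    proof (cases "n = 0")
      case True
      then have "S = {}" "T = {0}" using S(1) by (auto simp: T_def)
      then have "2 * c\<^sup>2 = y\<^sup>2" using y True by (simp add: E_def I_def)
      then show False using two_c_sq_not_square by blast
    next
      case False
      have "(2 * c\<^sup>2) ^ E = 2 ^ E * (c ^ E)\<^sup>2" by (simp add: power_mult_distrib mult.commute flip: power_mult)
      then have y: "2 ^ E * L (n + 2) * I * (c ^ E)\<^sup>2 = y\<^sup>2" using y by (simp add: mult_ac)
      have "(c ^ E)\<^sup>2 dvd y\<^sup>2" unfolding y[symmetric] by simp
      then have "c ^ E dvd y" by simp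
      then obtain z where z: "y = c ^ E * z" by (rule dvdE)
      have "(c ^ E)\<^sup>2 * (2 ^ E * L (n + 2) * I) = (c ^ E)\<^sup>2 * z\<^sup>2" using y z by (simp add: power_mult_distrib mult_ac)
      moreover have "(c ^ E)\<^sup>2 \<noteq> 0" using c_gt_1 by simp
      ultimately have z: "2 ^ E * L (n + 2) * I = z\<^sup>2" by (simp only: mult_cancel_left) simp
      \<comment> \<open>The indices i + 1 for i in T and i + 2 for i in S may coincide, so a disjoint sum
        indexes them.\<close>
      define g where "g = case_sum (\<lambda>i. i + 1) (\<lambda>i::nat. i + 2 :: nat)"
      have I: "I = (\<Prod>i\<in>T <+> S. L (g i))"
        using fT fS by (simp add: I_def g_def prod.Plus comp_def del: crit.simps)
      have "1 \<le> g i \<and> g i < n + 2" if "i \<in> T <+> S" for i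
        using that S(1) by (auto simp: g_def T_def)
      moreover have "finite (T <+> S)" using fT fS by simp
      ultimately show False
        using no_square_relation[of "n + 2" "T <+> S" g E z] False z I by simp
    qed
  qed
qed

end

section \<open>The Galois action on the tree\<close>

lemma fhom_mono: "fhom K \<tau> \<Longrightarrow> F \<subseteq> K \<Longrightarrow> fhom F \<tau>"
  unfolding fhom_def by blast

context arboreal
begin

lemma Kinf_eq: "K_inf phi = (\<Union>n. Kf n)"
proof
  show "(\<Union>n. Kf n) \<subseteq> K_inf phi"
    unfolding K_inf_def Kf_def[symmetric] using Kf_Suc_mono by fastforce
qed (auto simp: K_inf_def Kf_def)

lemma Kf_Kinf: "Kf n \<subseteq> K_inf phi"
  unfolding Kinf_eq by blast

lemma V_Kinf: "V n \<subseteq> K_inf phi"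
  using V_Kf Kf_Kinf by blast

lemma Kinf_common_level:
  assumes "x \<in> K_inf phi" "y \<in> K_inf phi"
  obtains n where "x \<in> Kf n" "y \<in> Kf n"
proof -
  obtain i j where ij: "x \<in> Kf i" "y \<in> Kf j" using assms unfolding Kinf_eq by blast
  have "x \<in> Kf (max i j)" "y \<in> Kf (max i j)"
    using ij Kf_mono[of i "max i j"] Kf_mono[of j "max i j"] by auto
  then show thesis by (rule that)
qed

lemma Kinf_field: "is_field (K_inf phi)"
proof (rule is_fieldI)
  show "1 \<in> K_inf phi" using Kf_Kinf[of 0] is_field_closed(2)[OF Kf_field[of 0]] by blast
  fix x y assume "x \<in> K_inf phi" "y \<in> K_inf phi"
  then obtain n where n: "x \<in> Kf n" "y \<in> Kf n" by (rule Kinf_common_level)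
  show "x - y \<in> K_inf phi" using Kf_Kinf is_field_diff[OF Kf_field n] by blast
  show "x / y \<in> K_inf phi" using Kf_Kinf is_field_divide[OF Kf_field n] by blast
qed

lemma ring_of_type_algebra_carrier_update:
  "carrier (ring_of_type_algebra\<lparr>carrier := K\<rparr>) = K"
  "x \<otimes>\<^bsub>ring_of_type_algebra\<lparr>carrier := K\<rparr>\<^esub> y = x * (y :: 'a::field)"
  "x \<oplus>\<^bsub>ring_of_type_algebra\<lparr>carrier := K\<rparr>\<^esub> y = x + (y :: 'a::field)"
  "\<one>\<^bsub>ring_of_type_algebra\<lparr>carrier := K\<rparr>\<^esub> = (1 :: 'a::field)"
  by (simp_all add: ring_of_type_algebra_def)

text \<open>
  Homomorphisms of fields of characteristic 0 fix the rational numbers, which accounts for the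
  clause on \<rat>.
\<close>

lemma carrier_G_inf:
  "carrier (G_inf phi) =
     {\<alpha>. \<alpha> \<in> extensional (K_inf phi) \<and> bij_betw \<alpha> (K_inf phi) (K_inf phi) \<and> fhom (K_inf phi) \<alpha>}"
proof -
  have "\<alpha> \<in> ring_iso (Qbar\<lparr>carrier := K_inf phi\<rparr>) (Qbar\<lparr>carrier := K_inf phi\<rparr>) \<longleftrightarrow> fhom (K_inf phi) \<alpha>"
    if "bij_betw \<alpha> (K_inf phi) (K_inf phi)" for \<alpha>
  proof
    note simps = ring_of_type_algebra_carrier_update
    {
      assume "\<alpha> \<in> ring_iso (Qbar\<lparr>carrier := K_inf phi\<rparr>) (Qbar\<lparr>carrier := K_inf phi\<rparr>)"
      then have hom: "\<alpha> \<in> ring_hom (Qbar\<lparr>carrier := K_inf phi\<rparr>) (Qbar\<lparr>carrier := K_inf phi\<rparr>)"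
        unfolding ring_iso_def by blast
      note h = ring_hom_one[OF hom] ring_hom_add[OF hom] ring_hom_mult[OF hom]
      show "fhom (K_inf phi) \<alpha>" unfolding fhom_def
        by (intro conjI ballI h[unfolded simps]; assumption)
    }
    assume hom: "fhom (K_inf phi) \<alpha>"
    have "\<alpha> x \<in> K_inf phi" if "x \<in> K_inf phi" for x
      using bij_betwE[OF \<open>bij_betw \<alpha> (K_inf phi) (K_inf phi)\<close>] that by blast
    then have "\<alpha> \<in> ring_hom (Qbar\<lparr>carrier := K_inf phi\<rparr>) (Qbar\<lparr>carrier := K_inf phi\<rparr>)"
      by (intro ring_hom_memI; unfold simps) (rule fhom_simps[OF Kinf_field hom]; assumption | assumption)+
    then show "\<alpha> \<in> ring_iso (Qbar\<lparr>carrier := K_inf phi\<rparr>) (Qbar\<lparr>carrier := K_inf phi\<rparr>)"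
      unfolding ring_iso_def simps using that by blast
  qed
  moreover have "\<forall>x\<in>\<rat>. \<alpha> x = x" if "fhom (K_inf phi) \<alpha>" for \<alpha>
    using fhom_Rats[OF Kinf_field that] by (rule ballI)
  ultimately have iff: "\<alpha> \<in> ring_iso (Qbar\<lparr>carrier := K_inf phi\<rparr>) (Qbar\<lparr>carrier := K_inf phi\<rparr>) \<and> (\<forall>x\<in>\<rat>. \<alpha> x = x)
      \<longleftrightarrow> fhom (K_inf phi) \<alpha>" if "bij_betw \<alpha> (K_inf phi) (K_inf phi)" for \<alpha>
    using that by blast
  have "carrier (G_inf phi) = {\<alpha> \<in> Bij (K_inf phi).
      \<alpha> \<in> ring_iso (Qbar\<lparr>carrier := K_inf phi\<rparr>) (Qbar\<lparr>carrier := K_inf phi\<rparr>) \<and> (\<forall>x\<in>\<rat>. \<alpha> x = x)}"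
    by (simp add: G_inf_def Gal_def)
  then show ?thesis using iff unfolding Bij_def by blast
qed

lemma G_inf_V:
  assumes "\<alpha> \<in> carrier (G_inf phi)"
  shows "inj_on \<alpha> (V n)" "\<alpha> ` V n = V n"
proof -
  have "fhom (K_inf phi) \<alpha>" using assms by (simp add: carrier_G_inf)
  then have "fhom (Kf n) \<alpha>" by (rule fhom_mono[OF _ Kf_Kinf])
  from fhom_bij_V[OF this order_refl] show "inj_on \<alpha> (V n)" "\<alpha> ` V n = V n" .
qed

lemma tree_verts_iff: "(n, \<beta>) \<in> tree_verts phi \<longleftrightarrow> \<beta> \<in> V n"
  by (simp add: tree_verts_def)

lemma tree_edges_iff:
  "((n, \<beta>), (k, \<gamma>)) \<in> tree_edges phi \<longleftrightarrow> n = Suc k \<and> \<beta> \<in> V n \<and> \<gamma> = par \<beta>"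
  by (auto simp: tree_edges_def phi_Some V_Suc)

lemma tree_action_apply: "\<beta> \<in> V n \<Longrightarrow> tree_action phi \<alpha> (n, \<beta>) = (n, \<alpha> \<beta>)"
  by (simp add: tree_action_def tree_verts_iff)

lemma carrier_Aut_tree:
  "f \<in> carrier (Aut_tree phi) \<longleftrightarrow>
     f \<in> extensional (tree_verts phi) \<and> bij_betw f (tree_verts phi) (tree_verts phi) \<and> f (0, 0) = (0, 0) \<and>
     (\<forall>u\<in>tree_verts phi. \<forall>v\<in>tree_verts phi. (f u, f v) \<in> tree_edges phi \<longleftrightarrow> (u, v) \<in> tree_edges phi)"
  by (auto simp: Aut_tree_def rooted_aut_def Bij_def)

lemma tree_action_carrier:
  assumes "\<alpha> \<in> carrier (G_inf phi)"
  shows "tree_action phi \<alpha> \<in> carrier (Aut_tree phi)"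
  unfolding carrier_Aut_tree
proof (intro conjI ballI)
  note s = G_inf_V[OF assms]
  have hom: "fhom (K_inf phi) \<alpha>" using assms by (simp add: carrier_G_inf)
  show "tree_action phi \<alpha> \<in> extensional (tree_verts phi)" by (simp add: tree_action_def)
  show "bij_betw (tree_action phi \<alpha>) (tree_verts phi) (tree_verts phi)"
    unfolding bij_betw_def
  proof
    show "inj_on (tree_action phi \<alpha>) (tree_verts phi)"
    proof (rule inj_onI)
      fix u v assume uv: "u \<in> tree_verts phi" "v \<in> tree_verts phi" "tree_action phi \<alpha> u = tree_action phi \<alpha> v"
      obtain n \<beta> k \<gamma> where e: "u = (n, \<beta>)" "v = (k, \<gamma>)" by (metis surj_pair)
      have V: "\<beta> \<in> V n" "\<gamma> \<in> V k" using uv(1,2) e by (simp_all add: tree_verts_iff)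
      then have "n = k" "\<alpha> \<beta> = \<alpha> \<gamma>" using uv(3) e by (simp_all add: tree_action_apply)
      then show "u = v" using inj_onD[OF s(1)[of k], of \<beta> \<gamma>] V e by simp
    qed
    show "tree_action phi \<alpha> ` tree_verts phi = tree_verts phi"
    proof
      show "tree_action phi \<alpha> ` tree_verts phi \<subseteq> tree_verts phi"
        using s(2) by (auto simp: tree_action_def tree_verts_def)
      show "tree_verts phi \<subseteq> tree_action phi \<alpha> ` tree_verts phi"
      proof
        fix v assume "v \<in> tree_verts phi"
        then obtain n \<beta> where v: "v = (n, \<beta>)" "\<beta> \<in> V n" by (auto simp: tree_verts_def)
        have "\<beta> \<in> \<alpha> ` V n" unfolding s(2) by (rule v(2))
        then obtain \<gamma> where "\<gamma> \<in> V n" "\<alpha> \<gamma> = \<beta>" by blast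
        then have "v = tree_action phi \<alpha> (n, \<gamma>)" "(n, \<gamma>) \<in> tree_verts phi"
          by (simp_all add: v(1) tree_action_apply tree_verts_iff)
        then show "v \<in> tree_action phi \<alpha> ` tree_verts phi" by blast
      qed
    qed
  qed
  show "tree_action phi \<alpha> (0, 0) = (0, 0)"
    using fhom_0[OF Kinf_field hom] by (simp add: tree_action_apply V_0)
  fix u v assume uv: "u \<in> tree_verts phi" "v \<in> tree_verts phi"
  obtain n \<beta> k \<gamma> where e: "u = (n, \<beta>)" "v = (k, \<gamma>)" by (metis surj_pair)
  have V: "\<beta> \<in> V n" "\<gamma> \<in> V k" using uv e by (simp_all add: tree_verts_iff)
  have p: "\<alpha> (par \<beta>) = par (\<alpha> \<beta>)"
    using fhom_par[OF Kinf_field hom] V(1) V_Kinf by blast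
  have i: "\<alpha> \<gamma> = \<alpha> (par \<beta>) \<longleftrightarrow> \<gamma> = par \<beta>" if "n = Suc k"
    using inj_on_eq_iff[OF s(1)[of k] V(2), of "par \<beta>"] par_in_V V(1) that by blast
  have "\<alpha> \<beta> \<in> V n" using s(2) V(1) by blast
  then show "(tree_action phi \<alpha> u, tree_action phi \<alpha> v) \<in> tree_edges phi \<longleftrightarrow> (u, v) \<in> tree_edges phi"
    using V i p by (auto simp: e tree_action_apply tree_edges_iff)
qed

lemma tree_action_mult:
  assumes "\<alpha> \<in> carrier (G_inf phi)" "\<tau> \<in> carrier (G_inf phi)"
  shows "tree_action phi (\<alpha> \<otimes>\<^bsub>G_inf phi\<^esub> \<tau>) =
    tree_action phi \<alpha> \<otimes>\<^bsub>Aut_tree phi\<^esub> tree_action phi \<tau>"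
proof -
  have "\<alpha> \<otimes>\<^bsub>G_inf phi\<^esub> \<tau> = compose (K_inf phi) \<alpha> \<tau>"
    using assms by (simp add: G_inf_def Gal_def BijGroup_def)
  moreover have "tree_action phi \<alpha> \<otimes>\<^bsub>Aut_tree phi\<^esub> tree_action phi \<tau>
      = compose (tree_verts phi) (tree_action phi \<alpha>) (tree_action phi \<tau>)"
    using assms[THEN tree_action_carrier] by (simp add: Aut_tree_def rooted_aut_def BijGroup_def)
  moreover have "tree_action phi (compose (K_inf phi) \<alpha> \<tau>)
      = compose (tree_verts phi) (tree_action phi \<alpha>) (tree_action phi \<tau>)"
  proof (rule extensionalityI[of _ "tree_verts phi"])
    fix v assume "v \<in> tree_verts phi"
    then obtain n \<beta> where v: "v = (n, \<beta>)" "\<beta> \<in> V n" by (auto simp: tree_verts_def)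
    have "\<tau> \<beta> \<in> V n" "\<beta> \<in> K_inf phi" using G_inf_V(2)[OF assms(2)] v(2) V_Kinf by blast+
    then show "tree_action phi (compose (K_inf phi) \<alpha> \<tau>) v
        = compose (tree_verts phi) (tree_action phi \<alpha>) (tree_action phi \<tau>) v"
      using v by (simp add: compose_def tree_action_apply tree_verts_iff)
  qed (simp_all add: tree_action_def)
  ultimately show ?thesis by simp
qed

lemma tree_action_inj: "inj_on (tree_action phi) (carrier (G_inf phi))"
proof (rule inj_onI)
  fix \<alpha> \<tau> assume st: "\<alpha> \<in> carrier (G_inf phi)" "\<tau> \<in> carrier (G_inf phi)"
    and eq: "tree_action phi \<alpha> = tree_action phi \<tau>"
  have hom: "fhom (K_inf phi) \<alpha>" "fhom (K_inf phi) \<tau>" using st by (simp_all add: carrier_G_inf)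
  have V: "\<alpha> \<beta> = \<tau> \<beta>" if "\<beta> \<in> V n" for n \<beta>
    using fun_cong[OF eq, of "(n, \<beta>)"] that by (simp add: tree_action_apply)
  show "\<alpha> = \<tau>"
  proof (rule extensionalityI[of _ "K_inf phi"])
    fix x assume "x \<in> K_inf phi"
    then obtain n where "x \<in> gen_field (\<rat> \<union> V n)" unfolding Kinf_eq Kf_eq by blast
    moreover have "\<rat> \<union> V n \<subseteq> K_inf phi" using Rats_subset_is_field[OF Kinf_field] V_Kinf by blast
    moreover have "\<alpha> y = \<tau> y" if "y \<in> \<rat> \<union> V n" for y
    proof (cases "y \<in> \<rat>")
      case True
      then show ?thesis using fhom_Rats[OF Kinf_field hom(1)] fhom_Rats[OF Kinf_field hom(2)] by simp
    next
      case False
      then show ?thesis using that V by blast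
    qed
    ultimately show "\<alpha> x = \<tau> x" using fhom_eq_on_gen_field[OF Kinf_field hom] by blast
  qed (use st in \<open>simp_all add: carrier_G_inf\<close>)
qed

text \<open>
  An automorphism of the rooted tree preserves levels, since each vertex other than the root has an
  edge to the previous level; it can therefore be replaced by a family of maps, one on each level,
  compatible with par.
\<close>

lemma Aut_tree_levelwise:
  assumes "f \<in> carrier (Aut_tree phi)"
  obtains g where "\<And>n \<beta>. \<beta> \<in> V n \<Longrightarrow> f (n, \<beta>) = (n, g n \<beta>)" "\<And>n \<beta>. \<beta> \<in> V n \<Longrightarrow> g n \<beta> \<in> V n"
    "\<And>n \<beta>. \<beta> \<in> V (Suc n) \<Longrightarrow> par (g (Suc n) \<beta>) = g n (par \<beta>)" "\<And>n. inj_on (g n) (V n)"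
proof -
  have f: "bij_betw f (tree_verts phi) (tree_verts phi)" "f (0, 0) = (0, 0)"
    "\<And>u v. u \<in> tree_verts phi \<Longrightarrow> v \<in> tree_verts phi \<Longrightarrow> (u, v) \<in> tree_edges phi \<Longrightarrow> (f u, f v) \<in> tree_edges phi"
    using assms unfolding carrier_Aut_tree by auto
  define g where "g n \<beta> = snd (f (n, \<beta>))" for n \<beta>
  have edge: "(f (Suc n, \<beta>), f (n, par \<beta>)) \<in> tree_edges phi" if "\<beta> \<in> V (Suc n)" for n \<beta>
    using that par_in_V[OF that] by (intro f(3)) (simp_all add: tree_verts_iff tree_edges_iff)
  have level: "fst (f (n, \<beta>)) = n" if "\<beta> \<in> V n" for n \<beta>
    using that
  proof (induction n arbitrary: \<beta>)
    case 0
    then show ?case using f(2) by (simp add: V_0)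
  next
    case (Suc n)
    have "fst (f (n, par \<beta>)) = n" using Suc.IH par_in_V[OF Suc.prems] .
    moreover have "((fst (f (Suc n, \<beta>)), snd (f (Suc n, \<beta>))), (fst (f (n, par \<beta>)), snd (f (n, par \<beta>)))) \<in> tree_edges phi"
      using edge[OF Suc.prems] by simp
    ultimately show ?case unfolding tree_edges_iff by simp
  qed
  have g: "f (n, \<beta>) = (n, g n \<beta>)" if "\<beta> \<in> V n" for n \<beta>
    using level[OF that] by (metis g_def prod.collapse)
  have gV: "g n \<beta> \<in> V n" if "\<beta> \<in> V n" for n \<beta>
  proof -
    have "f (n, \<beta>) \<in> tree_verts phi" using bij_betwE[OF f(1)] that by (simp add: tree_verts_iff)
    then show ?thesis using g[OF that] by (simp add: tree_verts_iff)
  qed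
  have par: "par (g (Suc n) \<beta>) = g n (par \<beta>)" if "\<beta> \<in> V (Suc n)" for n \<beta>
    using edge[OF that] g[OF that] g[OF par_in_V[OF that]] by (simp add: tree_edges_iff)
  have inj: "inj_on (g n) (V n)" for n
  proof (rule inj_onI)
    fix \<beta> \<gamma> assume bg: "\<beta> \<in> V n" "\<gamma> \<in> V n" "g n \<beta> = g n \<gamma>"
    then have "f (n, \<beta>) = f (n, \<gamma>)" by (simp add: g)
    then show "\<beta> = \<gamma>" using bij_betw_imp_inj_on[OF f(1)] bg by (simp add: inj_on_def tree_verts_def)
  qed
  show thesis by (rule that[OF g gV par inj])
qed

text \<open>
  The image of r \<beta> is prescribed by g and may be any child of the image of \<beta>. That - r
  \<beta> then goes to the right place follows from injectivity: its image is a child of the same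
  vertex other than the image of r \<beta>.
\<close>

lemma tree_automorphism_extends:
  assumes gV: "\<And>n \<beta>. \<beta> \<in> V n \<Longrightarrow> g n \<beta> \<in> V n"
    and par: "\<And>n \<beta>. \<beta> \<in> V (Suc n) \<Longrightarrow> par (g (Suc n) \<beta>) = g n (par \<beta>)"
    and inj: "\<And>n. inj_on (g n) (V n)"
    and \<tau>: "fhom (Kf n) \<tau>" "\<forall>\<beta>\<in>V n. \<tau> \<beta> = g n \<beta>"
  shows "\<exists>\<tau>'. (fhom (Kf (Suc n)) \<tau>' \<and> (\<forall>\<beta>\<in>V (Suc n). \<tau>' \<beta> = g (Suc n) \<beta>)) \<and> (\<forall>x\<in>Kf n. \<tau>' x = \<tau> x)"
proof -
  define y where "y \<beta> = g (Suc n) (r \<beta>)" for \<beta>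
  have "(y \<beta>)\<^sup>2 = 2 * C\<^sup>2 / (1 - \<tau> \<beta>)" if b: "\<beta> \<in> V n" for \<beta>
  proof -
    have "g n \<beta> \<noteq> 1" using gV[OF b] one_notin_V[of n] by auto
    moreover have "y \<beta> \<noteq> 0" using gV[OF r_in_V(1)[OF b]] by (simp add: y_def V_Suc)
    moreover have "par (y \<beta>) = g n \<beta>" using par[OF r_in_V(1)[OF b]] par_r(1)[OF b] by (simp add: y_def)
    ultimately show ?thesis using sq_iff_par[of "g n \<beta>" "y \<beta>"] \<tau>(2) b by simp
  qed
  then obtain \<tau>' where t: "fhom (Kf (Suc n)) \<tau>'" "\<forall>x\<in>Kf n. \<tau>' x = \<tau> x" "\<forall>\<beta>\<in>V n. \<tau>' (r \<beta>) = y \<beta>"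
    using extend_step[OF Kummer_independent \<tau>(1), of y] by blast
  have "\<tau>' z = g (Suc n) z" if z: "z \<in> V (Suc n)" for z
  proof -
    define b where "b = par z"
    have b: "b \<in> V n" using par_in_V[OF z] by (simp add: b_def)
    note rb = r_in_V[OF b]
    have "r b \<noteq> - r b"
      using r_disjoint[of n] b by blast
    then have "g (Suc n) (r b) \<noteq> g (Suc n) (- r b)"
      using inj_onD[OF inj _ rb] by blast
    moreover have "par (g (Suc n) (- r b)) = par (g (Suc n) (r b))"
      using par[OF rb(1)] par[OF rb(2)] par_r[OF b] by simp
    ultimately have minus: "g (Suc n) (- r b) = - g (Suc n) (r b)"
      using par_eq_iff[OF gV[OF rb(2)] gV[OF rb(1)]] by metis
    have "\<tau>' (r b) = g (Suc n) (r b)" using t(3) b by (simp add: y_def)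
    moreover have "\<tau>' (- r b) = - \<tau>' (r b)"
      using fhom_uminus[OF Kf_field t(1)] rb(1) V_Kf by blast
    moreover have "z = r b \<or> z = - r b" using V_Suc_cases[OF z] by (simp only: b_def)
    ultimately show ?thesis using minus by (elim disjE) simp_all
  qed
  then show ?thesis using t(1,2) by blast
qed

text \<open>
  The extensions of a levelwise map to the fields of the tower are chosen one after the other and
  glued.
\<close>

lemma tree_action_surj:
  assumes "f \<in> carrier (Aut_tree phi)"
  shows "\<exists>\<alpha>\<in>carrier (G_inf phi). tree_action phi \<alpha> = f"
proof -
  obtain g where g: "\<And>n \<beta>. \<beta> \<in> V n \<Longrightarrow> f (n, \<beta>) = (n, g n \<beta>)" and gV: "\<And>n \<beta>. \<beta> \<in> V n \<Longrightarrow> g n \<beta> \<in> V n"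
    and gpar: "\<And>n \<beta>. \<beta> \<in> V (Suc n) \<Longrightarrow> par (g (Suc n) \<beta>) = g n (par \<beta>)" and ginj: "\<And>n. inj_on (g n) (V n)"
    using Aut_tree_levelwise[OF assms] by blast
  have "\<exists>\<tau>. \<forall>n. (fhom (Kf n) (\<tau> n) \<and> (\<forall>\<beta>\<in>V n. \<tau> n \<beta> = g n \<beta>)) \<and> (\<forall>x\<in>Kf n. \<tau> (Suc n) x = \<tau> n x)"
  proof (rule dependent_nat_choice)
    have "g 0 0 = 0" using gV[of 0 0] by (simp add: V_0)
    then show "\<exists>\<tau>. fhom (Kf 0) \<tau> \<and> (\<forall>\<beta>\<in>V 0. \<tau> \<beta> = g 0 \<beta>)"
      using fhom_id by (intro exI[of _ "\<lambda>x. x"]) (simp add: V_0)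
    fix \<tau> n assume "fhom (Kf n) \<tau> \<and> (\<forall>\<beta>\<in>V n. \<tau> \<beta> = g n \<beta>)"
    then show "\<exists>\<tau>'. (fhom (Kf (Suc n)) \<tau>' \<and> (\<forall>\<beta>\<in>V (Suc n). \<tau>' \<beta> = g (Suc n) \<beta>)) \<and> (\<forall>x\<in>Kf n. \<tau>' x = \<tau> x)"
      by (elim conjE) (rule tree_automorphism_extends[OF gV gpar ginj])
  qed
  then obtain \<tau> where \<tau>: "\<And>n. fhom (Kf n) (\<tau> n)" "\<And>n \<beta>. \<beta> \<in> V n \<Longrightarrow> \<tau> n \<beta> = g n \<beta>"
    "\<And>n x. x \<in> Kf n \<Longrightarrow> \<tau> (Suc n) x = \<tau> n x" by blast
  have coherent: "\<tau> n x = \<tau> k x" if "k \<le> n" "x \<in> Kf k" for k n x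
    using that(1)
  proof (induction n rule: dec_induct)
    case (step i)
    have "x \<in> Kf i" using that(2) Kf_mono[OF step(1)] by blast
    from \<tau>(3)[OF this] show ?case using step.IH by (rule trans)
  qed simp
  define \<alpha> where "\<alpha> = (\<lambda>x\<in>K_inf phi. \<tau> (LEAST n. x \<in> Kf n) x)"
  have \<alpha>: "\<alpha> x = \<tau> n x" if "x \<in> Kf n" for n x
  proof -
    have "(LEAST n. x \<in> Kf n) \<le> n" "x \<in> Kf (LEAST n. x \<in> Kf n)"
      using that by (rule Least_le, rule LeastI)
    then have "\<tau> n x = \<tau> (LEAST n. x \<in> Kf n) x" by (rule coherent)
    then show ?thesis using that Kf_Kinf by (auto simp: \<alpha>_def)
  qed
  have hom: "fhom (K_inf phi) \<alpha>"
    unfolding fhom_def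
  proof (intro conjI ballI)
    show "\<alpha> 1 = 1" using \<alpha>[OF is_field_closed(2)[OF Kf_field[of 0]]] fhom_simps(1)[OF Kf_field \<tau>(1)] by simp
    fix a b assume "a \<in> K_inf phi" "b \<in> K_inf phi"
    then obtain n where n: "a \<in> Kf n" "b \<in> Kf n" by (rule Kinf_common_level)
    show "\<alpha> (a + b) = \<alpha> a + \<alpha> b"
      using fhom_simps(2)[OF Kf_field \<tau>(1) n] by (simp only: \<alpha>[OF n(1)] \<alpha>[OF n(2)] \<alpha>[OF is_field_closed(3)[OF Kf_field n]])
    show "\<alpha> (a * b) = \<alpha> a * \<alpha> b"
      using fhom_simps(3)[OF Kf_field \<tau>(1) n] by (simp only: \<alpha>[OF n(1)] \<alpha>[OF n(2)] \<alpha>[OF is_field_closed(4)[OF Kf_field n]])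
  qed
  have \<alpha>V: "\<alpha> \<beta> = g n \<beta>" if "\<beta> \<in> V n" for n \<beta>
    using \<alpha>[of \<beta> n] \<tau>(2)[OF that] that V_Kf by auto
  have "\<alpha> ` K_inf phi = K_inf phi"
  proof
    show "\<alpha> ` K_inf phi \<subseteq> K_inf phi"
    proof
      fix y assume "y \<in> \<alpha> ` K_inf phi"
      then obtain n x where x: "x \<in> Kf n" "y = \<alpha> x" unfolding Kinf_eq by blast
      then have "y \<in> \<tau> n ` Kf n" using \<alpha> by simp
      then show "y \<in> K_inf phi" using fhom_Kf_subset[OF \<tau>(1)] Kf_Kinf by blast
    qed
    have field: "is_field (\<alpha> ` K_inf phi)" by (rule is_field_fhom_image[OF Kinf_field hom])
    have "V n \<subseteq> \<alpha> ` K_inf phi" for n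
    proof -
      have "fhom (Kf n) \<alpha>" by (rule fhom_mono[OF hom Kf_Kinf])
      then have "V n = \<alpha> ` V n" using fhom_bij_V(2)[of n \<alpha> n] by simp
      then show ?thesis using V_Kinf by blast
    qed
    then have "Kf n \<subseteq> \<alpha> ` K_inf phi" for n
      unfolding Kf_eq using Rats_subset_is_field[OF field] by (intro gen_field_min[OF field]) blast
    then show "K_inf phi \<subseteq> \<alpha> ` K_inf phi" unfolding Kinf_eq[symmetric] by (subst (1) Kinf_eq) blast
  qed
  then have "\<alpha> \<in> carrier (G_inf phi)"
    using hom fhom_inj[OF Kinf_field hom] by (simp add: carrier_G_inf bij_betw_def \<alpha>_def)
  moreover have "tree_action phi \<alpha> = f"
  proof (rule extensionalityI[of _ "tree_verts phi"])
    show "f \<in> extensional (tree_verts phi)" using assms by (simp add: carrier_Aut_tree)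
    fix v assume "v \<in> tree_verts phi"
    then obtain n \<beta> where v: "v = (n, \<beta>)" "\<beta> \<in> V n" by (auto simp: tree_verts_def)
    show "tree_action phi \<alpha> v = f v" by (simp add: v(1) tree_action_apply[OF v(2)] g[OF v(2)] \<alpha>V[OF v(2)])
  qed (simp add: tree_action_def)
  ultimately show ?thesis by blast
qed

theorem tree_action_iso: "tree_action phi \<in> iso (G_inf phi) (Aut_tree phi)"
proof -
  have "tree_action phi \<in> hom (G_inf phi) (Aut_tree phi)"
    using tree_action_carrier tree_action_mult by (simp add: hom_def)
  moreover have "tree_action phi ` carrier (G_inf phi) = carrier (Aut_tree phi)"
    using tree_action_carrier tree_action_surj by blast
  ultimately show ?thesis using tree_action_inj by (simp add: iso_iff)
qed

end

theorem theorem1p2: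
  fixes m :: nat and a :: rat and \<phi> :: "qbar option \<Rightarrow> qbar option"
  assumes "m > 0" and "\<not> [m = 1] (mod 4)"
    and "a = - 2 * (2 * (of_nat m)\<^sup>2 - 1)\<^sup>2"
    and "\<phi> = ratmap [:a, 0, 1:] [:0, 0, 1:]"
  shows "(\<forall>n\<ge>1. ring.dimension Qbar (2 ^ (2 ^ (n - 1))) (K_fin \<phi> (n - 1)) (K_fin \<phi> n)) \<and>
         tree_action \<phi> \<in> iso (G_inf \<phi>) (Aut_tree \<phi>) \<and>
         G_inf \<phi> \<cong> Aut_tree \<phi>"
proof -
  have "m mod 4 \<noteq> 1" using assms(2) by (simp add: cong_def)
  moreover have "m \<noteq> 1" using assms(2) by auto
  ultimately interpret arboreal m using assms(1) by unfold_locales simp_all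
  have \<phi>: "\<phi> = phi" unfolding assms(3,4) phi_def ..
  have "ring.dimension Qbar (2 ^ (2 ^ (n - 1))) (K_fin phi (n - 1)) (K_fin phi n)" if "n \<ge> 1" for n
    using dimension_Kf[OF Kummer_independent, of "n - 1"] that by (simp add: Kf_def)
  then show ?thesis unfolding \<phi> using tree_action_iso is_isoI[OF tree_action_iso] by blast
qed

end
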